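(* Let $G$ be a discrete group, let $(X,G)$ be a tame $G$-flow, and let $\operatorname{Min}^{\mathrm{am}}_G(X)$ denote the collection of all amenable minimal subflows of $X$. Then the support map $$\operatorname{Erg}_G(X)\longrightarrow\operatorname{Min}^{\mathrm{am}}_G(X),\qquad \mu\longmapsto\operatorname{supp}(\mu),$$ is a bijection. Its inverse assigns to each $Y\in\operatorname{Min}^{\mathrm{am}}_G(X)$ its unique invariant probability measure $\mu_Y$, regarded as a measure on $X$. Consequently, distinct ergodic invariant probability measures on $X$ have disjoint supports. If $(X,G)$ is hereditarily amenable, then $\operatorname{Min}^{\mathrm{am}}_G(X)$ is the collection of all minimal subflows of $X$.
   Context: All compact spaces are Hausdorff and all probability measures on compact spaces are regular Borel measures. A $G$-flow $(X,G)$ is a compact space $X$ with an action of the discrete group $G$ by homeomorphisms; a subflow is a nonempty closed $G$-invariant subset; a (sub)flow is minimal if every orbit in it is dense in it. $\operatorname{Prob}_G(X)$ is the convex set of $G$-invariant regular Borel probability measures on $X$, and $\operatorname{Erg}_G(X)$ is the set of its extreme points (ergodic measures). A flow is amenable if it carries a $G$-invariant probability measure, and hereditarily amenable if every subflow is amenable. The enveloping semigroup $E(X,G)$ is the closure of $\{g_X:g\in G\}$ in $X^X$ with the product topology, where $g_X(x)=gx$. A map $f:X\to Y$ from a compact space to a uniform space is fragmented if for every nonempty $A\subseteq X$ and every entourage $V$ of $Y$ there is a nonempty relatively open $U\subseteq A$ with $(f(x),f(y))\in V$ for all $x,y\in U$. The flow $(X,G)$ is tame if every element of $E(X,G)$ is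 a fragmented map $X\to X$ (with $X$ carrying its unique compatible uniformity). *)

theory Defs
  imports "HOL-Probability.Probability_Measure" "HOL-Algebra.Group_Action"
begin

section \<open>Flows\<close>

text \<open>The acting group is discrete, so no continuity in the group variable is required.
  Compact spaces are abstract topologies, so that a subflow \<open>Y\<close> is again a flow, on
  \<^term>\<open>subtopology X Y\<close>. As in \<^locale>\<open>group_action\<close>, the maps \<open>\<phi> g\<close> are extensional, i.e.
  \<^const>\<open>undefined\<close> outside of the space; hence the action has to be restricted
  along with the space.\<close>

locale flow = group_action G "topspace X" \<phi>
  for G :: "('g, 'm) monoid_scheme" (structure)
    and X :: "'a topology" and \<phi> :: "'g \<Rightarrow> 'a \<Rightarrow> 'a" +
  assumes compact: "compact_space X"
    and Hausdorff: "Hausdorff_space X"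
    and homeomorphism: "g \<in> carrier G \<Longrightarrow> homeomorphic_map X X (\<phi> g)"

definition restrict_action :: "('g \<Rightarrow> 'a \<Rightarrow> 'a) \<Rightarrow> 'a set \<Rightarrow> 'g \<Rightarrow> 'a \<Rightarrow> 'a" where
  "restrict_action \<phi> Y = (\<lambda>g. restrict (\<phi> g) Y)"

definition subflow ::
    "('g, 'm) monoid_scheme \<Rightarrow> 'a topology \<Rightarrow> ('g \<Rightarrow> 'a \<Rightarrow> 'a) \<Rightarrow> 'a set \<Rightarrow> bool" where
  "subflow G X \<phi> Y \<longleftrightarrow> Y \<noteq> {} \<and> closedin X Y \<and> (\<forall>g\<in>carrier G. \<phi> g ` Y \<subseteq> Y)"

definition minimal_flow ::
    "('g, 'm) monoid_scheme \<Rightarrow> 'a topology \<Rightarrow> ('g \<Rightarrow> 'a \<Rightarrow> 'a) \<Rightarrow> bool" where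
  "minimal_flow G X \<phi> \<longleftrightarrow> (\<forall>x\<in>topspace X. X closure_of (orbit G \<phi> x) = topspace X)"

definition minimal_subflow ::
    "('g, 'm) monoid_scheme \<Rightarrow> 'a topology \<Rightarrow> ('g \<Rightarrow> 'a \<Rightarrow> 'a) \<Rightarrow> 'a set \<Rightarrow> bool" where
  "minimal_subflow G X \<phi> Y \<longleftrightarrow>
     subflow G X \<phi> Y \<and> minimal_flow G (subtopology X Y) (restrict_action \<phi> Y)"


section \<open>Invariant measures\<close>

definition borel_of :: "'a topology \<Rightarrow> 'a measure" where
  "borel_of X = sigma (topspace X) {U. openin X U}"

definition regular_borel_measure :: "'a topology \<Rightarrow> 'a measure \<Rightarrow> bool" where
  "regular_borel_measure X \<mu> \<longleftrightarrow>
     sets \<mu> = sets (borel_of X) \<and>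
     (\<forall>A\<in>sets \<mu>.
        emeasure \<mu> A = (SUP K\<in>{K. compactin X K \<and> K \<subseteq> A}. emeasure \<mu> K) \<and>
        emeasure \<mu> A = (INF U\<in>{U. openin X U \<and> A \<subseteq> U}. emeasure \<mu> U))"

definition Prob ::
    "('g, 'm) monoid_scheme \<Rightarrow> 'a topology \<Rightarrow> ('g \<Rightarrow> 'a \<Rightarrow> 'a) \<Rightarrow> 'a measure set" where
  "Prob G X \<phi> =
     {\<mu>. prob_space \<mu> \<and> regular_borel_measure X \<mu> \<and> (\<forall>g\<in>carrier G. distr \<mu> \<mu> (\<phi> g) = \<mu>)}"

text \<open>The type of measures is not a vector space, so \<^const>\<open>extreme_point_of\<close> is unfolded, with
  convex combinations of measures taken setwise.\<close>

definition Erg ::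
    "('g, 'm) monoid_scheme \<Rightarrow> 'a topology \<Rightarrow> ('g \<Rightarrow> 'a \<Rightarrow> 'a) \<Rightarrow> 'a measure set" where
  "Erg G X \<phi> =
     {\<mu> \<in> Prob G X \<phi>. \<not> (\<exists>\<nu>\<^sub>1\<in>Prob G X \<phi>. \<exists>\<nu>\<^sub>2\<in>Prob G X \<phi>. \<exists>t::real. 0 < t \<and> t < 1 \<and> \<nu>\<^sub>1 \<noteq> \<nu>\<^sub>2 \<and>
        (\<forall>A\<in>sets (borel_of X). measure \<mu> A = (1 - t) * measure \<nu>\<^sub>1 A + t * measure \<nu>\<^sub>2 A))}"

definition supp :: "'a topology \<Rightarrow> 'a measure \<Rightarrow> 'a set" where
  "supp X \<mu> = {x \<in> topspace X. \<forall>U. openin X U \<and> x \<in> U \<longrightarrow> emeasure \<mu> U > 0}"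

definition amenable_flow ::
    "('g, 'm) monoid_scheme \<Rightarrow> 'a topology \<Rightarrow> ('g \<Rightarrow> 'a \<Rightarrow> 'a) \<Rightarrow> bool" where
  "amenable_flow G X \<phi> \<longleftrightarrow> Prob G X \<phi> \<noteq> {}"

definition amenable_subflow ::
    "('g, 'm) monoid_scheme \<Rightarrow> 'a topology \<Rightarrow> ('g \<Rightarrow> 'a \<Rightarrow> 'a) \<Rightarrow> 'a set \<Rightarrow> bool" where
  "amenable_subflow G X \<phi> Y \<longleftrightarrow>
     subflow G X \<phi> Y \<and> amenable_flow G (subtopology X Y) (restrict_action \<phi> Y)"

definition hereditarily_amenable ::
    "('g, 'm) monoid_scheme \<Rightarrow> 'a topology \<Rightarrow> ('g \<Rightarrow> 'a \<Rightarrow> 'a) \<Rightarrow> bool" where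
  "hereditarily_amenable G X \<phi> \<longleftrightarrow> (\<forall>Y. subflow G X \<phi> Y \<longrightarrow> amenable_subflow G X \<phi> Y)"

definition Min_am ::
    "('g, 'm) monoid_scheme \<Rightarrow> 'a topology \<Rightarrow> ('g \<Rightarrow> 'a \<Rightarrow> 'a) \<Rightarrow> 'a set set" where
  "Min_am G X \<phi> = {Y. minimal_subflow G X \<phi> Y \<and> amenable_subflow G X \<phi> Y}"


section \<open>Uniformities and fragmented maps\<close>

text \<open>Carrier-based versions of the axioms of the type classes \<^class>\<open>uniform_space\<close> and
  \<^class>\<open>open_uniformity\<close>.\<close>

definition is_uniformity :: "'a set \<Rightarrow> ('a \<times> 'a) filter \<Rightarrow> bool" where
  "is_uniformity S \<U> \<longleftrightarrow>
     \<U> \<le> principal (S \<times> S) \<and>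
     (\<forall>E. eventually E \<U> \<longrightarrow> (\<forall>x\<in>S. E (x, x))) \<and>
     (\<forall>E. eventually E \<U> \<longrightarrow> eventually (\<lambda>(x, y). E (y, x)) \<U>) \<and>
     (\<forall>E. eventually E \<U> \<longrightarrow>
        (\<exists>D. eventually D \<U> \<and> (\<forall>x y z. D (x, y) \<longrightarrow> D (y, z) \<longrightarrow> E (x, z))))"

definition compatible_uniformity :: "'a topology \<Rightarrow> ('a \<times> 'a) filter \<Rightarrow> bool" where
  "compatible_uniformity X \<U> \<longleftrightarrow>
     is_uniformity (topspace X) \<U> \<and>
     (\<forall>T. openin X T \<longleftrightarrow>
        T \<subseteq> topspace X \<and> (\<forall>x\<in>T. eventually (\<lambda>(x', y). x' = x \<longrightarrow> y \<in> T) \<U>))"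

text \<open>Well-defined for compact Hausdorff \<open>X\<close>; see \<open>compatible_uniformity_unique\<close> below.\<close>

definition the_uniformity :: "'a topology \<Rightarrow> ('a \<times> 'a) filter" where
  "the_uniformity X = (THE \<U>. compatible_uniformity X \<U>)"

definition fragmented :: "'a topology \<Rightarrow> ('b \<times> 'b) filter \<Rightarrow> ('a \<Rightarrow> 'b) \<Rightarrow> bool" where
  "fragmented X \<V> f \<longleftrightarrow>
     (\<forall>A V. A \<noteq> {} \<and> A \<subseteq> topspace X \<and> eventually V \<V> \<longrightarrow>
        (\<exists>U. openin (subtopology X A) U \<and> U \<noteq> {} \<and> (\<forall>x\<in>U. \<forall>y\<in>U. V (f x, f y))))"

definition enveloping_semigroup ::
    "('g, 'm) monoid_scheme \<Rightarrow> 'a topology \<Rightarrow> ('g \<Rightarrow> 'a \<Rightarrow> 'a) \<Rightarrow> ('a \<Rightarrow> 'a) set" where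
  "enveloping_semigroup G X \<phi> = product_topology (\<lambda>_. X) (topspace X) closure_of (\<phi> ` carrier G)"

definition tame ::
    "('g, 'm) monoid_scheme \<Rightarrow> 'a topology \<Rightarrow> ('g \<Rightarrow> 'a \<Rightarrow> 'a) \<Rightarrow> bool" where
  "tame G X \<phi> \<longleftrightarrow> (\<forall>p\<in>enveloping_semigroup G X \<phi>. fragmented X (the_uniformity X) p)"


section \<open>Well-definedness\<close>

lemma compatible_uniformity_nhd:
  assumes U: "compatible_uniformity X \<U>" and x: "x \<in> topspace X" and E: "eventually E \<U>"
  obtains O' where "openin X O'" "x \<in> O'" "\<And>y. y \<in> O' \<Longrightarrow> E (x, y)"
proof -
  define O' where
    "O' = {y \<in> topspace X. eventually (\<lambda>(y', z). y' = y \<longrightarrow> E (x, z)) \<U>}"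
  have refl: "eventually F \<U> \<Longrightarrow> y \<in> topspace X \<Longrightarrow> F (y, y)" for F y
    using U by (auto simp: compatible_uniformity_def is_uniformity_def)
  have trans: "eventually E \<U> \<Longrightarrow>
      \<exists>D. eventually D \<U> \<and> (\<forall>x y z. D (x, y) \<longrightarrow> D (y, z) \<longrightarrow> E (x, z))" for E
    using U by (simp add: compatible_uniformity_def is_uniformity_def)
  have "openin X O'"
  proof -
    have "eventually (\<lambda>(y', z). y' = y \<longrightarrow> z \<in> O') \<U>" if y: "y \<in> O'" for y
    proof -
      have "eventually (\<lambda>(y', z). y' = y \<longrightarrow> E (x, z)) \<U>"
        using y by (simp add: O'_def)
      then obtain D where D: "eventually D \<U>"
        and DD: "\<And>a b c. D (a, b) \<Longrightarrow> D (b, c) \<Longrightarrow> a = y \<longrightarrow> E (x, c)"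
        using trans by fastforce
      have sub: "eventually (\<lambda>p. p \<in> topspace X \<times> topspace X) \<U>"
        using U by (simp add: compatible_uniformity_def is_uniformity_def le_principal)
      show ?thesis
        using D sub
      proof eventually_elim
        case (elim p)
        obtain a b where p: "p = (a, b)" by force
        have "b \<in> O'" if "a = y"
        proof -
          have "eventually (\<lambda>(y', z). y' = b \<longrightarrow> E (x, z)) \<U>"
            using D by (rule eventually_mono) (use DD elim p that in auto)
          then show ?thesis using elim p by (auto simp: O'_def)
        qed
        then show ?case by (simp add: p)
      qed
    qed
    moreover have "O' \<subseteq> topspace X" by (auto simp: O'_def)
    ultimately show ?thesis using U unfolding compatible_uniformity_def by blast
  qed
  moreover have "x \<in> O'"
    using x E by (auto simp: O'_def elim: eventually_mono)
  moreover have "E (x, y)" if "y \<in> O'" for y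
    using that refl[of "\<lambda>(y', z). y' = y \<longrightarrow> E (x, z)" y] by (auto simp: O'_def)
  ultimately show ?thesis using that by blast
qed

lemma compatible_uniformity_eventually:
  assumes X: "compact_space X" and U: "compatible_uniformity X \<U>"
  shows "eventually P \<U> \<longleftrightarrow>
    (\<exists>W. openin (prod_topology X X) W \<and> (\<forall>x\<in>topspace X. (x, x) \<in> W) \<and> (\<forall>p\<in>W. P p))"
    (is "_ \<longleftrightarrow> ?R")
proof
  have sym: "eventually E \<U> \<Longrightarrow> eventually (\<lambda>(x, y). E (y, x)) \<U>" for E
    using U by (simp add: compatible_uniformity_def is_uniformity_def)
  have refl: "eventually F \<U> \<Longrightarrow> y \<in> topspace X \<Longrightarrow> F (y, y)" for F y
    using U by (auto simp: compatible_uniformity_def is_uniformity_def)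
  have trans: "eventually E \<U> \<Longrightarrow>
      \<exists>D. eventually D \<U> \<and> (\<forall>x y z. D (x, y) \<longrightarrow> D (y, z) \<longrightarrow> E (x, z))" for E
    using U by (simp add: compatible_uniformity_def is_uniformity_def)
  have sub: "eventually (\<lambda>p. p \<in> topspace X \<times> topspace X) \<U>"
    using U by (simp add: compatible_uniformity_def is_uniformity_def le_principal)
  {
    assume "eventually P \<U>"
    then obtain D where D: "eventually D \<U>"
      and DD: "\<And>a b c. D (a, b) \<Longrightarrow> D (b, c) \<Longrightarrow> P (a, c)"
      using trans by metis
    have D': "eventually (\<lambda>p. D p \<and> (case p of (x, y) \<Rightarrow> D (y, x))) \<U>"
      using D sym[OF D] by (rule eventually_conj)
    have "\<exists>O'. openin X O' \<and> x \<in> O' \<and> (\<forall>y\<in>O'. D (x, y) \<and> D (y, x))"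
      if "x \<in> topspace X" for x
      by (rule compatible_uniformity_nhd[OF U that D']) auto
    then obtain N where N: "\<And>x. x \<in> topspace X \<Longrightarrow>
        openin X (N x) \<and> x \<in> N x \<and> (\<forall>y\<in>N x. D (x, y) \<and> D (y, x))"
      by metis
    have "openin (prod_topology X X) (\<Union>x\<in>topspace X. N x \<times> N x)"
      using N by (intro openin_Union) (auto simp: openin_prod_Times_iff)
    moreover have "\<forall>p\<in>(\<Union>x\<in>topspace X. N x \<times> N x). P p"
      using N DD by blast
    ultimately show ?R
      by (intro exI[of _ "\<Union>x\<in>topspace X. N x \<times> N x"]) (use N in blast)
  }
  {
    assume ?R
    then obtain W where W: "openin (prod_topology X X) W"
      and diag: "\<And>x. x \<in> topspace X \<Longrightarrow> (x, x) \<in> W" and WP: "\<And>p. p \<in> W \<Longrightarrow> P p"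
      by blast
    have "\<exists>O' D. openin X O' \<and> x \<in> O' \<and> eventually D \<U> \<and>
        (\<forall>a\<in>O'. \<forall>b. D (a, b) \<longrightarrow> (a, b) \<in> W)" if x: "x \<in> topspace X" for x
    proof -
      obtain A B where AB: "openin X A" "openin X B" "x \<in> A" "x \<in> B" "A \<times> B \<subseteq> W"
        using W diag[OF x] by (force simp: openin_prod_topology_alt)
      define N where "N = A \<inter> B"
      have N: "openin X N" "x \<in> N" "N \<times> N \<subseteq> W"
        using AB by (auto simp: N_def)
      have "eventually (\<lambda>(x', y). x' = x \<longrightarrow> y \<in> N) \<U>"
        using U N by (auto simp: compatible_uniformity_def)
      then obtain D where D: "eventually D \<U>"
        and DD: "\<And>a b c. D (a, b) \<Longrightarrow> D (b, c) \<Longrightarrow> a = x \<longrightarrow> c \<in> N"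
        using trans by (metis (mono_tags, lifting) case_prod_conv)
      obtain O' where O': "openin X O'" "x \<in> O'" "\<And>y. y \<in> O' \<Longrightarrow> D (x, y)"
        using compatible_uniformity_nhd[OF U x D] by blast
      have "(a, b) \<in> W" if a: "a \<in> O'" and b: "D (a, b)" for a b
      proof -
        have "a \<in> N" using DD[OF O'(3)[OF a]] refl[OF D] a O'(1) openin_subset by blast
        moreover have "b \<in> N" using DD[OF O'(3)[OF a] b] by blast
        ultimately show ?thesis using N by blast
      qed
      then show ?thesis using O' D by blast
    qed
    then obtain N D where ND: "\<And>x. x \<in> topspace X \<Longrightarrow> openin X (N x) \<and> x \<in> N x \<and>
        eventually (D x) \<U> \<and> (\<forall>a\<in>N x. \<forall>b. D x (a, b) \<longrightarrow> (a, b) \<in> W)"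
      by metis
    obtain F where F: "finite F" "F \<subseteq> topspace X" "topspace X \<subseteq> (\<Union>x\<in>F. N x)"
    proof -
      have "\<And>U. U \<in> N ` topspace X \<Longrightarrow> openin X U" "topspace X \<subseteq> \<Union>(N ` topspace X)"
        using ND by auto
      then have "\<exists>\<F>. finite \<F> \<and> \<F> \<subseteq> N ` topspace X \<and> topspace X \<subseteq> \<Union>\<F>"
        using X unfolding compact_space_alt by presburger
      then show ?thesis using that by (metis finite_subset_image)
    qed
    have "eventually (\<lambda>p. \<forall>x\<in>F. D x p) \<U>"
      using F ND by (intro eventually_ball_finite) auto
    then show "eventually P \<U>"
      using sub
    proof eventually_elim
      case (elim p)
      then obtain x where "x \<in> F" "fst p \<in> N x" using F by auto
      then have "p \<in> W" using ND F elim by (metis prod.collapse subsetD)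
      then show ?case by (rule WP)
    qed
  }
qed

lemma compatible_uniformity_exists:
  assumes X: "compact_space X" and H: "Hausdorff_space X"
  shows "\<exists>\<U>. compatible_uniformity X \<U>"
proof -
  define B where
    "B = {W. openin (prod_topology X X) W \<and> (\<forall>x\<in>topspace X. (x, x) \<in> W)}"
  define \<U> where "\<U> = (INF W\<in>B. principal W)"
  have ev: "eventually P \<U> \<longleftrightarrow> (\<exists>W\<in>B. \<forall>p\<in>W. P p)" for P
    unfolding \<U>_def
  proof (subst eventually_INF_base)
    show "B \<noteq> {}"
      using openin_topspace[of "prod_topology X X"] by (auto simp: B_def)
    show "\<exists>x\<in>B. principal x \<le> inf (principal a) (principal b)" if "a \<in> B" "b \<in> B" for a b
      using that by (intro bexI[of _ "a \<inter> b"]) (auto simp: B_def)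
  qed (simp add: eventually_principal)
  have BX: "W \<subseteq> topspace X \<times> topspace X" if "W \<in> B" for W
    using that openin_subset by (force simp: B_def)
  have "is_uniformity (topspace X) \<U>"
    unfolding is_uniformity_def
  proof (intro conjI allI impI ballI)
    have "topspace X \<times> topspace X \<in> B"
      using openin_topspace[of "prod_topology X X"] by (auto simp: B_def)
    then show "\<U> \<le> principal (topspace X \<times> topspace X)"
      unfolding le_principal ev by blast
  next
    fix E x assume "eventually E \<U>" "x \<in> topspace X"
    then show "E (x, x)" by (auto simp: ev B_def)
  next
    fix E assume "eventually E \<U>"
    then obtain W where W: "W \<in> B" "\<forall>p\<in>W. E p" by (auto simp: ev)
    have "openin (prod_topology X X) {p \<in> topspace (prod_topology X X). prod.swap p \<in> W}"
      using W(1) by (intro openin_continuous_map_preimage[where Y = "prod_topology X X"])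
        (auto simp: B_def prod.swap_def intro: continuous_map_pairedI continuous_map_fst continuous_map_snd)
    then have "{p \<in> topspace (prod_topology X X). prod.swap p \<in> W} \<in> B"
      using W(1) by (auto simp: B_def)
    then show "eventually (\<lambda>(x, y). E (y, x)) \<U>"
      unfolding ev using W(2) by (rule_tac bexI) auto
  next
    fix E assume "eventually E \<U>"
    then obtain W where W: "W \<in> B" "\<forall>p\<in>W. E p" by (auto simp: ev)
    have reg: "regular_space X"
      using X H by (simp add: compact_Hausdorff_imp_regular_space)
    have "\<exists>O' C N. openin X O' \<and> closedin X C \<and> openin X N \<and> x \<in> O' \<and> O' \<subseteq> C \<and> C \<subseteq> N \<and> N \<times> N \<subseteq> W"
      if x: "x \<in> topspace X" for x
    proof -
      obtain A B' where AB: "openin X A" "openin X B'" "x \<in> A" "x \<in> B'" "A \<times> B' \<subseteq> W"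
        using W x by (force simp: openin_prod_topology_alt B_def)
      then have N: "openin X (A \<inter> B')" "x \<in> A \<inter> B'" "(A \<inter> B') \<times> (A \<inter> B') \<subseteq> W" by auto
      then obtain O' C where "openin X O'" "closedin X C" "x \<in> O'" "O' \<subseteq> C" "C \<subseteq> A \<inter> B'"
        using reg unfolding neighbourhood_base_of_closedin[symmetric] neighbourhood_base_of by metis
      then show ?thesis using N by blast
    qed
    then obtain O' C N where OCN: "\<And>x. x \<in> topspace X \<Longrightarrow> openin X (O' x) \<and> closedin X (C x) \<and>
        openin X (N x) \<and> x \<in> O' x \<and> O' x \<subseteq> C x \<and> C x \<subseteq> N x \<and> N x \<times> N x \<subseteq> W"
      by metis
    obtain F where F: "finite F" "F \<subseteq> topspace X" "topspace X \<subseteq> (\<Union>x\<in>F. O' x)"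
    proof -
      have "\<And>U. U \<in> O' ` topspace X \<Longrightarrow> openin X U" "topspace X \<subseteq> \<Union>(O' ` topspace X)"
        using OCN by auto
      then have "\<exists>\<F>. finite \<F> \<and> \<F> \<subseteq> O' ` topspace X \<and> topspace X \<subseteq> \<Union>\<F>"
        using X unfolding compact_space_alt by presburger
      then show ?thesis using that by (metis finite_subset_image)
    qed
    define K where "K x = N x \<times> N x \<union> (topspace X - C x) \<times> (topspace X - C x)" for x
    define D where "D = (topspace X \<times> topspace X) \<inter> (\<Inter>x\<in>F. K x)"
    have K: "openin (prod_topology X X) (K x)" if "x \<in> F" for x
    proof -
      have "openin X (N x)" "openin X (topspace X - C x)"
        using OCN[of x] F(2) that by (blast intro: openin_diff openin_topspace)+
      then show ?thesis
        unfolding K_def by (intro openin_Un) (auto simp: openin_prod_Times_iff)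
    qed
    have "openin (prod_topology X X) D"
      using openin_INT[where U = K, OF F(1) K] by (simp add: D_def Int_commute)
    moreover have "(x, x) \<in> D" if "x \<in> topspace X" for x
    proof -
      have "x \<in> N y \<or> x \<notin> C y" if "y \<in> F" for y
        using OCN[of y] F(2) that by blast
      then show ?thesis using that by (auto simp: D_def K_def)
    qed
    ultimately have DB: "D \<in> B" by (simp add: B_def)
    have "E (a, c)" if ab: "(a, b) \<in> D" and bc: "(b, c) \<in> D" for a b c
    proof -
      have "b \<in> topspace X" using ab by (simp add: D_def)
      then obtain x where x: "x \<in> F" "b \<in> O' x" using F by blast
      then have "x \<in> topspace X" using F by blast
      then have bx: "b \<in> C x" "N x \<times> N x \<subseteq> W" using x(2) OCN[of x] by blast+
      have "(a, b) \<in> K x" "(b, c) \<in> K x" using ab bc x(1) unfolding D_def by blast+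
      then have "a \<in> N x" "c \<in> N x" using bx(1) unfolding K_def by blast+
      then have "(a, c) \<in> W" using bx(2) by blast
      then show ?thesis using W by blast
    qed
    then show "\<exists>D. eventually D \<U> \<and> (\<forall>x y z. D (x, y) \<longrightarrow> D (y, z) \<longrightarrow> E (x, z))"
      using DB by (intro exI[of _ "\<lambda>p. p \<in> D"]) (auto simp: ev)
  qed
  moreover have "openin X T \<longleftrightarrow>
      T \<subseteq> topspace X \<and> (\<forall>x\<in>T. eventually (\<lambda>(x', y). x' = x \<longrightarrow> y \<in> T) \<U>)" for T
  proof (intro iffI conjI ballI)
    assume T: "openin X T"
    then show "T \<subseteq> topspace X" by (rule openin_subset)
    fix x assume x: "x \<in> T"
    have "openin X (topspace X - {x})"
      using H x T openin_subset by (intro openin_diff closedin_Hausdorff_singleton) auto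
    then have "T \<times> T \<union> (topspace X - {x}) \<times> topspace X \<in> B"
      using T x unfolding B_def by (auto intro!: openin_Un simp: openin_prod_Times_iff)
    then show "eventually (\<lambda>(x', y). x' = x \<longrightarrow> y \<in> T) \<U>"
      unfolding ev by (rule bexI[rotated]) auto
  next
    assume T: "T \<subseteq> topspace X \<and> (\<forall>x\<in>T. eventually (\<lambda>(x', y). x' = x \<longrightarrow> y \<in> T) \<U>)"
    show "openin X T"
    proof (subst openin_subopen, intro ballI)
      fix x assume x: "x \<in> T"
      then obtain W where W: "W \<in> B" "\<And>y. (x, y) \<in> W \<Longrightarrow> y \<in> T"
        using T unfolding ev by fastforce
      have "openin (prod_topology X X) W" "(x, x) \<in> W"
        using W(1) x T by (auto simp: B_def)
      then obtain A B' where "openin X A" "openin X B'" "x \<in> A" "x \<in> B'" "A \<times> B' \<subseteq> W"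
        by (force simp: openin_prod_topology_alt)
      then show "\<exists>T'. openin X T' \<and> x \<in> T' \<and> T' \<subseteq> T"
        using W(2) by blast
    qed
  qed
  ultimately show ?thesis
    unfolding compatible_uniformity_def by blast
qed

theorem compatible_uniformity_unique:
  assumes "compact_space X" and "Hausdorff_space X"
  shows "\<exists>!\<U>. compatible_uniformity X \<U>"
  using compatible_uniformity_exists[OF assms]
  by (auto simp: filter_eq_iff compatible_uniformity_eventually[OF assms(1)])

corollary eventually_the_uniformity:
  assumes "compact_space X" and "Hausdorff_space X"
  shows "eventually P (the_uniformity X) \<longleftrightarrow>
    (\<exists>W. openin (prod_topology X X) W \<and> (\<forall>x\<in>topspace X. (x, x) \<in> W) \<and> (\<forall>p\<in>W. P p))"
  using compatible_uniformity_eventually[OF assms(1) theI'[OF compatible_uniformity_unique[OF assms]]]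
  by (simp add: the_uniformity_def)

lemma (in flow) flow_restrict_action:
  assumes Y: "subflow G X \<phi> Y"
  shows "flow G (subtopology X Y) (restrict_action \<phi> Y)"
proof -
  interpret gh: group_hom G "BijGroup (topspace X)" \<phi> by (rule group_hom)
  have YX: "Y \<subseteq> topspace X" and inv: "\<And>g y. g \<in> carrier G \<Longrightarrow> y \<in> Y \<Longrightarrow> \<phi> g y \<in> Y"
    using Y closedin_subset[of X Y] unfolding subflow_def by (blast, blast)
  have im: "\<phi> g ` Y = Y" if g: "g \<in> carrier G" for g
  proof
    show "\<phi> g ` Y \<subseteq> Y" using inv g by blast
    show "Y \<subseteq> \<phi> g ` Y"
    proof
      fix y assume y: "y \<in> Y"
      have g': "m_inv G g \<in> carrier G" using g by simp
      have yX: "y \<in> topspace X" using y YX by blast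
      have "\<phi> g (\<phi> (m_inv G g) y) = \<phi> (g \<otimes> m_inv G g) y"
        using composition_rule[OF yX g g'] by simp
      also have "\<dots> = \<phi> \<one> y" using g by simp
      also have "\<dots> = y" using fun_cong[OF id_eq_one, of y] yX by simp
      finally show "y \<in> \<phi> g ` Y" using inv[OF g' y] by (metis image_eqI)
    qed
  qed
  have bij: "restrict (\<phi> g) Y \<in> Bij Y" if "g \<in> carrier G" for g
    using im[OF that] inj_prop[OF that] YX
    by (auto simp: Bij_def bij_betw_def intro: inj_on_subset)
  have top: "topspace (subtopology X Y) = Y" using YX by auto
  have hom: "group_hom G (BijGroup Y) (restrict_action \<phi> Y)"
  proof (intro group_hom.intro group_hom_axioms.intro homI)
    show "group G" using group_hom by (simp add: group_hom_def)
    show "group (BijGroup Y)" by (rule group_BijGroup)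
    show "restrict_action \<phi> Y g \<in> carrier (BijGroup Y)" if "g \<in> carrier G" for g
      using bij[OF that] by (simp add: BijGroup_def restrict_action_def)
    show "restrict_action \<phi> Y (g \<otimes> h) =
        restrict_action \<phi> Y g \<otimes>\<^bsub>BijGroup Y\<^esub> restrict_action \<phi> Y h"
      if "g \<in> carrier G" "h \<in> carrier G" for g h
      using that bij YX inv composition_rule[OF _ that]
      by (auto simp: BijGroup_def restrict_action_def compose_def fun_eq_iff restrict_def)
  qed
  show ?thesis
  proof (intro flow.intro group_action.intro flow_axioms.intro)
    show "group_hom G (BijGroup (topspace (subtopology X Y))) (restrict_action \<phi> Y)"
      using hom by (simp only: top)
    show "compact_space (subtopology X Y)"
      using Y compact by (simp add: subflow_def closedin_compact_space compact_space_subtopology)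
    show "Hausdorff_space (subtopology X Y)"
      using Hausdorff by (rule Hausdorff_space_subtopology)
    fix g assume g: "g \<in> carrier G"
    have "homeomorphic_map (subtopology X Y) (subtopology X Y) (\<phi> g)"
      using homeomorphic_map_subtopologies[OF homeomorphism[OF g], of Y Y] im[OF g] YX
      by (simp add: inf.absorb2)
    then show "homeomorphic_map (subtopology X Y) (subtopology X Y) (restrict_action \<phi> Y g)"
      by (rule homeomorphic_map_eq) (simp add: restrict_action_def)
  qed
qed

end

theory Submission
  imports Defs
begin

text \<open>
  Tameness enters through one combinatorial obstruction, lemma \<open>no_independent_tree\<close>: for a
  continuous function \<open>f\<close> no sequence of translates \<open>f \<circ> g\<^sub>n\<close> is independent, that is, no binary
  tree of nonempty sets is split at level \<open>n\<close> by \<open>f \<circ> g\<^sub>n\<close> into a part with values at most \<open>a\<close>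
  and a part with values at least \<open>b\<close>, where \<open>a < b\<close>. An ultrafilter limit \<open>q\<close> of such \<open>g\<^sub>n\<close>
  belongs to the enveloping semigroup, but \<open>f \<circ> q\<close> oscillates by \<open>b - a\<close> on every relatively open
  piece of a suitable closed set, so \<open>q\<close> is not fragmented. The theorem then follows from two
  facts, each of which is proved by growing a forbidden tree out of a measure.

  \<^emph>\<open>Supports of ergodic measures are minimal.\<close> If nodes are sets of positive measure, the
  obstruction says that convergence \<open>g \<rightarrow> p\<close> in the enveloping semigroup is uniform, in the
  one-sided sense of lemma \<open>tame_limit_almost_uniform\<close>, on closed sets of almost full measure. Hence \<open>p\<close>
  respects an invariant measure \<open>\<mu>\<close>: if \<open>T\<close> is open, then \<open>{x. p x \<in> T}\<close> has inner measure at
  least \<open>\<mu> T\<close>. Let \<open>\<mu>\<close> be ergodic and let \<open>Z\<close> be a proper subflow of its support. By ergodicity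
  almost every orbit comes arbitrarily close to \<open>Z\<close>, and by the previous remark the same is true
  of the orbit of \<open>r x\<close> for almost every \<open>x\<close>, where \<open>r\<close> lies in a minimal closed invariant set of
  maps. For such \<open>r\<close> the point \<open>r x\<close> can be recovered from every point of its orbit closure, so
  that \<open>r x\<close> lies in every closed invariant set that its orbit approaches. But with positive
  measure \<open>r x\<close> is far from \<open>Z\<close>. Since \<open>G\<close> may be uncountable and \<open>X\<close> nonmetrizable, the
  argument is run with a countable submonoid of \<open>G\<close> that already witnesses the recurrence.

  \<^emph>\<open>A minimal subflow \<open>Y\<close> carries at most one invariant measure.\<close> Suppose that \<open>\<mu>\<close> and \<open>\<nu>\<close>
  give a continuous function \<open>f\<close> different integrals. The element of least \<open>L\<^sup>2\<close>-norm in the closed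
  convex hull of the translates of \<open>f\<close> is an invariant function \<open>\<psi>\<close> which is small on a set of
  positive \<open>\<mu>\<close>-measure and large on a set of positive \<open>\<nu>\<close>-measure. By minimality these invariant
  sets charge every open set that meets \<open>Y\<close>. Therefore convex combinations of translates of \<open>f\<close>
  oscillate by a fixed amount on every such open set, and so do the translates of \<open>f\<close> themselves
  with probability bounded below. A limit of the coefficients is a finitely additive probability
  on \<open>G\<close> for which every open set meeting \<open>Y\<close> is split by a set of translates of mass at least
  some \<open>k > 0\<close>. Passing to open sets for which this mass can hardly decrease any more makes
  it possible to split all nodes of a level by a common translate, and a forbidden tree results.

  The rest is a comparison of measures on \<open>Y\<close> with measures on \<open>X\<close> that are concentrated on \<open>Y\<close>.
  An invariant measure \<open>\<mu>\<close> with \<open>\<mu> Y = 1\<close> is ergodic, because the parts of a convex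
  decomposition are concentrated on \<open>Y\<close> as well and hence coincide with \<open>\<mu>\<close>.
\<close>

section \<open>Ultrafilters and minimal closed sets\<close>

definition ultrafilter :: "'a filter \<Rightarrow> bool" where
  "ultrafilter U \<longleftrightarrow> U \<noteq> bot \<and> (\<forall>P. eventually P U \<or> eventually (\<lambda>x. \<not> P x) U)"

lemma ultrafilter_below:
  assumes "F \<noteq> bot"
  obtains U where "U \<le> F" "ultrafilter U"
proof -
  define A where "A = {U. U \<le> F \<and> U \<noteq> bot}"
  have "\<exists>m\<in>A. \<forall>a\<in>A. a \<le> m \<longrightarrow> a = m"
  proof (rule predicate_Zorn[where P = "\<lambda>x y. y \<le> x"])
    show "partial_order_on A (relation_of (\<lambda>x y. y \<le> x) A)"
      by (rule partial_order_on_relation_ofI) auto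
    fix C assume C: "C \<in> Chains (relation_of (\<lambda>x y. y \<le> x) A)"
    then have CA: "C \<subseteq> A" and ch: "\<And>x y. x \<in> C \<Longrightarrow> y \<in> C \<Longrightarrow> x \<le> y \<or> y \<le> x"
      by (auto simp: Chains_def relation_of_def)
    have fin: "\<exists>x\<in>insert F C. \<forall>y\<in>Y. x \<le> y" if "finite Y" "Y \<subseteq> C" for Y
      using that
    proof (induction Y)
      case empty then show ?case by auto
    next
      case (insert y Y)
      then obtain x where x: "x \<in> insert F C" "\<forall>y\<in>Y. x \<le> y" by auto
      have "y \<le> F" using insert.prems CA by (auto simp: A_def)
      then have xy: "x \<le> y \<or> y \<le> x"
        using x(1) ch[of x y] insert.prems by blast
      show ?case
      proof (cases "x \<le> y")
        case True
        then show ?thesis using x by auto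
      next
        case False
        then have "y \<le> z" if "z \<in> Y" for z using xy x(2) that order_trans by blast
        then show ?thesis using insert.prems by auto
      qed
    qed
    have "Inf (insert F C) \<noteq> bot"
    proof (rule Inf_filter_not_bot)
      fix Y assume Y: "Y \<subseteq> insert F C" "finite Y"
      obtain x where x: "x \<in> insert F C" "\<forall>y\<in>Y - {F}. x \<le> y"
        using fin[of "Y - {F}"] Y by auto
      have "x \<noteq> bot" "x \<le> F" using x(1) CA assms by (auto simp: A_def)
      moreover have "x \<le> Inf Y" using x \<open>x \<le> F\<close> by (intro Inf_greatest) auto
      ultimately show "Inf Y \<noteq> bot" by (metis bot.extremum_uniqueI)
    qed
    then show "\<exists>u\<in>A. \<forall>a\<in>C. u \<le> a"
      unfolding A_def by (intro bexI[of _ "Inf (insert F C)"]) (auto intro: le_infI2 Inf_lower)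
  qed
  then obtain U where U: "U \<le> F" "U \<noteq> bot" and min: "\<And>V. V \<le> F \<Longrightarrow> V \<noteq> bot \<Longrightarrow> V \<le> U \<Longrightarrow> V = U"
    unfolding A_def by blast
  have "eventually P U" if "\<not> eventually (\<lambda>x. \<not> P x) U" for P
  proof -
    have "inf U (principal {x. P x}) = U"
    proof (rule min)
      show "inf U (principal {x. P x}) \<noteq> bot"
        using that by (simp add: trivial_limit_def eventually_inf_principal)
    qed (use U in \<open>auto intro: le_infI1 order_trans\<close>)
    moreover have "eventually P (inf U (principal {x. P x}))"
      by (simp add: eventually_inf_principal)
    ultimately show ?thesis by simp
  qed
  then show ?thesis using that U by (auto simp: ultrafilter_def)
qed

lemma ultrafilter_not_iff: "ultrafilter U \<Longrightarrow> eventually (\<lambda>x. \<not> P x) U \<longleftrightarrow> \<not> eventually P U"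
  using eventually_conj[of "\<lambda>x. \<not> P x" U P] by (auto simp: ultrafilter_def trivial_limit_def)

lemma ultrafilter_limitin_compact:
  assumes U: "ultrafilter U" and X: "compact_space X" and f: "eventually (\<lambda>i. f i \<in> topspace X) U"
  obtains l where "limitin X f l U"
proof (rule ccontr)
  assume "\<not> thesis"
  then have "\<not> limitin X f l U" for l using that by blast
  then have "\<exists>N. openin X N \<and> l \<in> N \<and> eventually (\<lambda>i. f i \<notin> N) U" if "l \<in> topspace X" for l
    using that ultrafilter_not_iff[OF U] by (auto simp: limitin_def)
  then obtain N where N: "\<And>l. l \<in> topspace X \<Longrightarrow> openin X (N l) \<and> l \<in> N l \<and> eventually (\<lambda>i. f i \<notin> N l) U"
    by metis
  have "\<And>V. V \<in> N ` topspace X \<Longrightarrow> openin X V" "topspace X \<subseteq> \<Union>(N ` topspace X)"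
    using N by auto
  then have "\<exists>\<F>. finite \<F> \<and> \<F> \<subseteq> N ` topspace X \<and> topspace X \<subseteq> \<Union>\<F>"
    using X unfolding compact_space_alt by presburger
  then obtain F where F: "finite F" "F \<subseteq> topspace X" "topspace X \<subseteq> \<Union>(N ` F)"
    by (metis finite_subset_image)
  have "eventually (\<lambda>i. \<forall>l\<in>F. f i \<notin> N l) U"
    using F N by (intro eventually_ball_finite) auto
  then have "eventually (\<lambda>i. False) U"
    using f by eventually_elim (use F in auto)
  then show False using U by (simp add: ultrafilter_def trivial_limit_def)
qed

lemma ultrafilter_tendsto_bounded:
  fixes f :: "'i \<Rightarrow> real"
  assumes U: "ultrafilter U" and f: "eventually (\<lambda>i. f i \<in> {a..b}) U"
  obtains l where "(f \<longlongrightarrow> l) U"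
proof -
  have "compact_space (top_of_set {a..b})"
    by (simp add: compact_space_subtopology compactin_euclidean_iff)
  then obtain l where "limitin (top_of_set {a..b}) f l U"
    using ultrafilter_limitin_compact[OF U, of "top_of_set {a..b}" f] f by auto
  then show ?thesis using that by (auto simp: limitin_subtopology)
qed

lemma subset_Zorn_minimal:
  assumes ne: "\<A> \<noteq> {}"
    and ch: "\<And>\<C>. \<C> \<noteq> {} \<Longrightarrow> \<C> \<subseteq> \<A> \<Longrightarrow> (\<And>C D. C \<in> \<C> \<Longrightarrow> D \<in> \<C> \<Longrightarrow> C \<subseteq> D \<or> D \<subseteq> C) \<Longrightarrow> \<Inter>\<C> \<in> \<A>"
  obtains M where "M \<in> \<A>" "\<And>N. N \<in> \<A> \<Longrightarrow> N \<subseteq> M \<Longrightarrow> N = M"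
proof -
  have "\<exists>M\<in>uminus ` \<A>. \<forall>X\<in>uminus ` \<A>. M \<subseteq> X \<longrightarrow> X = M"
  proof (rule subset_Zorn_nonempty)
    show "uminus ` \<A> \<noteq> {}" using ne by auto
    fix \<C> assume C: "\<C> \<noteq> {}" "subset.chain (uminus ` \<A>) \<C>"
    have "\<Inter>(uminus ` \<C>) \<in> \<A>"
    proof (rule ch)
      show "uminus ` \<C> \<subseteq> \<A>" using C by (force simp: subset.chain_def)
      show "C \<subseteq> D \<or> D \<subseteq> C" if "C \<in> uminus ` \<C>" "D \<in> uminus ` \<C>" for C D
      proof -
        have "- C \<in> \<C>" "- D \<in> \<C>" using that by auto
        then have "- C \<subseteq> - D \<or> - D \<subseteq> - C"
          using C(2) unfolding subset_chain_def by blast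
        then show ?thesis by auto
      qed
    qed (use C in auto)
    moreover have "\<Union>\<C> = - \<Inter>(uminus ` \<C>)" by auto
    ultimately show "\<Union>\<C> \<in> uminus ` \<A>" by blast
  qed
  then obtain M where "M \<in> \<A>" "\<And>N. N \<in> \<A> \<Longrightarrow> - M \<subseteq> - N \<Longrightarrow> - N = - M" by auto
  then show ?thesis using that by auto
qed

lemma compact_chain_Inter_nonempty:
  assumes X: "compact_space X" and ne: "\<C> \<noteq> {}" and cl: "\<And>C. C \<in> \<C> \<Longrightarrow> closedin X C \<and> C \<noteq> {}"
    and ch: "\<And>C D. C \<in> \<C> \<Longrightarrow> D \<in> \<C> \<Longrightarrow> C \<subseteq> D \<or> D \<subseteq> C"
  shows "\<Inter>\<C> \<noteq> {}"
proof -
  have fin: "\<exists>C\<in>\<C>. \<forall>D\<in>\<F>. C \<subseteq> D" if "finite \<F>" "\<F> \<subseteq> \<C>" for \<F>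
    using that
  proof (induction \<F>)
    case empty then show ?case using ne by auto
  next
    case (insert D \<F>)
    then obtain C where "C \<in> \<C>" "\<forall>D\<in>\<F>. C \<subseteq> D" by auto
    moreover have "C \<subseteq> D \<or> D \<subseteq> C" using ch[of C D] insert.prems \<open>C \<in> \<C>\<close> by auto
    ultimately show ?case using insert.prems by blast
  qed
  have "\<Inter>\<F> \<noteq> {}" if F: "finite \<F>" "\<F> \<subseteq> \<C>" for \<F>
  proof -
    obtain C where "C \<in> \<C>" "\<forall>D\<in>\<F>. C \<subseteq> D" using fin[OF F] by blast
    then have "C \<subseteq> \<Inter>\<F>" "C \<noteq> {}" using cl by auto
    then show ?thesis by auto
  qed
  then show ?thesis
    by (intro compact_space_fip[THEN iffD1, OF X, rule_format]) (use cl in auto)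
qed

section \<open>Tameness excludes independent trees\<close>

context flow
begin

lemma G_group: "group G"
  using group_hom by (simp add: group_hom_def)

lemma act_in [simp]: "g \<in> carrier G \<Longrightarrow> x \<in> topspace X \<Longrightarrow> \<phi> g x \<in> topspace X"
  using element_image by blast

lemma continuous_act: "g \<in> carrier G \<Longrightarrow> continuous_map X X (\<phi> g)"
  using homeomorphism homeomorphic_imp_continuous_map by blast

lemma act_extensional: "g \<in> carrier G \<Longrightarrow> \<phi> g \<in> extensional (topspace X)"
  using bij_prop0 by (auto simp: Bij_def)

lemma act_in_self_maps: "g \<in> carrier G \<Longrightarrow> \<phi> g \<in> topspace (product_topology (\<lambda>_. X) (topspace X))"
  using act_extensional by (auto simp: PiE_iff)

lemma compact_self_maps: "compact_space (product_topology (\<lambda>_. X) (topspace X))"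
  using compact by (simp add: compact_space_product_topology)

lemma ultralimit_in_enveloping_semigroup:
  assumes U: "ultrafilter U" and g: "eventually (\<lambda>i. g i \<in> carrier G) U"
  obtains q where "q \<in> enveloping_semigroup G X \<phi>"
    and "\<And>x. x \<in> topspace X \<Longrightarrow> limitin X (\<lambda>i. \<phi> (g i) x) (q x) U"
proof -
  let ?P = "product_topology (\<lambda>_. X) (topspace X)"
  have ev: "eventually (\<lambda>i. \<phi> (g i) \<in> topspace ?P) U"
    using g by (rule eventually_mono) (rule act_in_self_maps)
  obtain q where q: "limitin ?P (\<lambda>i. \<phi> (g i)) q U"
    by (rule ultrafilter_limitin_compact[OF U compact_self_maps ev])
  have "q \<in> enveloping_semigroup G X \<phi>"
    unfolding enveloping_semigroup_def in_closure_of
  proof (intro conjI allI impI)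
    show "q \<in> topspace ?P" using q by (rule limitin_topspace)
    fix T assume T: "q \<in> T \<and> openin ?P T"
    then have "eventually (\<lambda>i. \<phi> (g i) \<in> T) U" using q by (auto simp: limitin_def)
    then have "eventually (\<lambda>i. g i \<in> carrier G \<and> \<phi> (g i) \<in> T) U" using g by eventually_elim auto
    then have "\<exists>i. g i \<in> carrier G \<and> \<phi> (g i) \<in> T"
      using U by (auto simp: ultrafilter_def dest: eventually_happens')
    then show "\<exists>y. y \<in> \<phi> ` carrier G \<and> y \<in> T" by blast
  qed
  then show ?thesis using that q by (auto simp: limitin_componentwise)
qed

lemma limitin_continuous_tendsto:
  fixes f :: "'a \<Rightarrow> real"
  assumes "continuous_map X euclideanreal f" "limitin X h l U"
  shows "((\<lambda>i. f (h i)) \<longlongrightarrow> f l) U"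
  using continuous_map_limit[OF assms] by (simp add: o_def)

text \<open>The tree may be replaced by its closure. Among the closed sets that meet every node there is a
  minimal one, \<open>C\<close>. If \<open>U\<close> is nonempty and relatively open in \<open>C\<close>, then \<open>C - U\<close> misses some node
  \<open>t\<close>, so \<open>U\<close> contains \<open>C \<inter> B t\<close>, and by compactness it contains points on the two branches that
  turn only left, respectively only right, after \<open>t\<close>. A limit \<open>q\<close> of the \<open>g\<^sub>n\<close> sends these two
  points to values of \<open>f\<close> that are at most \<open>a\<close> and at least \<open>b\<close>: the map \<open>q\<close> is not fragmented.
  Nodes are lists of turns with the most recent turn at the head.\<close>

lemma no_independent_tree:
  assumes tame: "tame G X \<phi>" and f: "continuous_map X euclideanreal f" and ab: "a < b"
    and g: "\<And>n::nat. g n \<in> carrier G"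
    and ne: "\<And>s. A s \<noteq> {}" and sub: "\<And>s. A s \<subseteq> topspace X" and dec: "\<And>c s. A (c # s) \<subseteq> A s"
    and low: "\<And>s x. x \<in> A (False # s) \<Longrightarrow> f (\<phi> (g (length s)) x) \<le> a"
    and high: "\<And>s x. x \<in> A (True # s) \<Longrightarrow> f (\<phi> (g (length s)) x) \<ge> b"
  shows False
proof -
  have fg: "continuous_map X euclideanreal (\<lambda>x. f (\<phi> (g n) x))" for n
    using continuous_map_compose[OF continuous_act[OF g] f] by (simp add: o_def)
  define B where "B s = X closure_of A s" for s
  have Bcl: "closedin X (B s)" for s by (simp add: B_def)
  have Bdec: "B (c # s) \<subseteq> B s" for c s by (simp add: B_def closure_of_mono dec)
  have Blow: "f (\<phi> (g (length s)) x) \<le> a" if "x \<in> B (False # s)" for s x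
  proof -
    have "closedin X {x \<in> topspace X. f (\<phi> (g (length s)) x) \<in> {..a}}"
      by (rule closedin_continuous_map_preimage[OF fg]) simp
    then have "B (False # s) \<subseteq> {x \<in> topspace X. f (\<phi> (g (length s)) x) \<in> {..a}}"
      unfolding B_def by (intro closure_of_minimal) (use low sub in auto)
    then show ?thesis using that by auto
  qed
  have Bhigh: "f (\<phi> (g (length s)) x) \<ge> b" if "x \<in> B (True # s)" for s x
  proof -
    have "closedin X {x \<in> topspace X. f (\<phi> (g (length s)) x) \<in> {b..}}"
      by (rule closedin_continuous_map_preimage[OF fg]) simp
    then have "B (True # s) \<subseteq> {x \<in> topspace X. f (\<phi> (g (length s)) x) \<in> {b..}}"
      unfolding B_def by (intro closure_of_minimal) (use high sub in auto)
    then show ?thesis using that by auto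
  qed
  define full where "full C \<longleftrightarrow> closedin X C \<and> (\<forall>s. C \<inter> B s \<noteq> {})" for C
  have "full (topspace X)"
    unfolding full_def
  proof (intro conjI allI)
    show "topspace X \<inter> B s \<noteq> {}" for s
      using ne[of s] sub[of s] closure_of_subset[OF sub, of s] by (auto simp: B_def)
  qed simp
  have "\<exists>C. full C \<and> (\<forall>D. full D \<longrightarrow> D \<subseteq> C \<longrightarrow> D = C)"
  proof (rule subset_Zorn_minimal[of "Collect full"])
    show "Collect full \<noteq> {}" using \<open>full (topspace X)\<close> by blast
  next
    fix \<C> assume \<C>: "\<C> \<noteq> {}" "\<C> \<subseteq> Collect full"
      and ch: "\<And>C D. C \<in> \<C> \<Longrightarrow> D \<in> \<C> \<Longrightarrow> C \<subseteq> D \<or> D \<subseteq> C"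
    have "\<Inter>\<C> \<inter> B s \<noteq> {}" for s
    proof -
      have "\<Inter>((\<lambda>C. C \<inter> B s) ` \<C>) \<noteq> {}"
      proof (rule compact_chain_Inter_nonempty[OF compact])
        show "(\<lambda>C. C \<inter> B s) ` \<C> \<noteq> {}" using \<C>(1) by blast
        show "closedin X D \<and> D \<noteq> {}" if "D \<in> (\<lambda>C. C \<inter> B s) ` \<C>" for D
          using that \<C>(2) Bcl[of s] by (fastforce simp: full_def intro: closedin_Int)
        show "C \<subseteq> D \<or> D \<subseteq> C" if CD: "C \<in> (\<lambda>C. C \<inter> B s) ` \<C>" "D \<in> (\<lambda>C. C \<inter> B s) ` \<C>" for C D
        proof -
          obtain C' where "C' \<in> \<C>" "C = C' \<inter> B s" using CD(1) by blast
          moreover obtain D' where "D' \<in> \<C>" "D = D' \<inter> B s" using CD(2) by blast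
          ultimately show ?thesis using ch[of C' D'] by blast
        qed
      qed
      then show ?thesis using \<C>(1) by auto
    qed
    moreover have "closedin X (\<Inter>\<C>)"
      using \<C> by (intro closedin_Inter) (auto simp: full_def)
    ultimately show "\<Inter>\<C> \<in> Collect full" by (simp add: full_def)
  next
    fix M assume "M \<in> Collect full" "\<And>N. N \<in> Collect full \<Longrightarrow> N \<subseteq> M \<Longrightarrow> N = M"
    then show ?thesis by blast
  qed
  then obtain C where C: "full C" and min: "\<And>D. full D \<Longrightarrow> D \<subseteq> C \<Longrightarrow> D = C"
    by blast
  obtain U where U: "U \<le> sequentially" "ultrafilter U"
    using ultrafilter_below[OF sequentially_bot] .
  obtain q where q: "q \<in> enveloping_semigroup G X \<phi>"
    and lim: "\<And>x. x \<in> topspace X \<Longrightarrow> limitin X (\<lambda>i. \<phi> (g i) x) (q x) U"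
    using ultralimit_in_enveloping_semigroup[OF U(2), of g] g by auto
  have Ubot: "U \<noteq> bot" using U(2) by (simp add: ultrafilter_def)
  have CX: "C \<noteq> {}" "C \<subseteq> topspace X" "closedin X C" using C closedin_subset by (auto simp: full_def)
  \<comment> \<open>The entourage in which fragmentation is tested.\<close>
  have ent: "eventually (\<lambda>(x, y). \<bar>f x - f y\<bar> < b - a) (the_uniformity X)"
    unfolding eventually_the_uniformity[OF compact Hausdorff]
  proof (intro exI conjI)
    have "continuous_map (prod_topology X X) euclideanreal (\<lambda>p. \<bar>f (fst p) - f (snd p)\<bar>)"
      using f by (intro continuous_intros continuous_map_compose[OF continuous_map_fst f, unfolded o_def]
          continuous_map_compose[OF continuous_map_snd f, unfolded o_def])
    then show "openin (prod_topology X X) {p \<in> topspace (prod_topology X X). \<bar>f (fst p) - f (snd p)\<bar> \<in> {..<b - a}}"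
      by (rule openin_continuous_map_preimage) simp
  qed (use ab in auto)
  have "fragmented X (the_uniformity X) q" using tame q by (simp add: tame_def)
  from this[unfolded fragmented_def, rule_format, OF conjI[OF CX(1) conjI[OF CX(2) ent]]]
  obtain O' where O': "openin (subtopology X C) O'" "O' \<noteq> {}"
    "\<And>x y. x \<in> O' \<Longrightarrow> y \<in> O' \<Longrightarrow> \<bar>f (q x) - f (q y)\<bar> < b - a"
    by auto
  have O'C: "O' \<subseteq> C" using openin_subset[OF O'(1)] by auto
  obtain T where T: "openin X T" "O' = T \<inter> C" using O'(1) by (auto simp: openin_subtopology)
  have "closedin X (C - O')"
  proof -
    have "C - O' = C - T" using T(2) by auto
    then show ?thesis using CX(3) T(1) by (simp add: closedin_diff)
  qed
  then have "\<not> full (C - O') \<Longrightarrow> \<exists>t. C \<inter> B t \<subseteq> O'" by (auto simp: full_def)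
  moreover have "\<not> full (C - O')" using min[of "C - O'"] O'(2) O'C by auto
  ultimately obtain t where t: "C \<inter> B t \<subseteq> O'" by blast
  \<comment> \<open>The branch above \<open>t\<close> with all later turns equal to \<open>c\<close>.\<close>
  have branch: "\<exists>z\<in>O'. \<forall>k. z \<in> B (replicate k c @ t)" for c
  proof -
    have "decseq (\<lambda>k. C \<inter> B (replicate k c @ t))"
      using Bdec by (auto simp: decseq_Suc_iff)
    then have "(\<Inter>k. C \<inter> B (replicate k c @ t)) \<noteq> {}"
      using C Bcl by (intro compact_space_imp_nest[OF compact]) (auto simp: full_def)
    then obtain z where z: "\<And>k. z \<in> C \<inter> B (replicate k c @ t)" by blast
    then show ?thesis using t z[of 0] by (intro bexI[of _ z]) auto
  qed
  obtain z where z: "z \<in> O'" "\<And>k. z \<in> B (replicate k False @ t)" using branch by blast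
  obtain z' where z': "z' \<in> O'" "\<And>k. z' \<in> B (replicate k True @ t)" using branch by blast
  have zX: "z \<in> topspace X" "z' \<in> topspace X" using z z' O'C CX by auto
  have ev: "eventually (\<lambda>n. length t \<le> n) U"
    using U(1) eventually_ge_at_top by (rule filter_leD)
  have "f (q z) \<le> a"
  proof (rule tendsto_upperbound[OF limitin_continuous_tendsto[OF f lim[OF zX(1)]] _ Ubot])
    show "eventually (\<lambda>n. f (\<phi> (g n) z) \<le> a) U"
      using ev
    proof eventually_elim
      case (elim n)
      show ?case using Blow[of z "replicate (n - length t) False @ t"] z(2)[of "Suc (n - length t)"] elim by simp
    qed
  qed
  moreover have "f (q z') \<ge> b"
  proof (rule tendsto_lowerbound[OF limitin_continuous_tendsto[OF f lim[OF zX(2)]] _ Ubot])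
    show "eventually (\<lambda>n. f (\<phi> (g n) z') \<ge> b) U"
      using ev
    proof eventually_elim
      case (elim n)
      show ?case using Bhigh[of z' "replicate (n - length t) True @ t"] z'(2)[of "Suc (n - length t)"] elim by simp
    qed
  qed
  ultimately show False using O'(3)[OF z(1) z'(1)] ab by auto
qed

end

section \<open>Regular Borel probability measures\<close>

lemma space_borel_of [simp]: "space (borel_of X) = topspace X"
  unfolding borel_of_def by (rule space_measure_of) (auto dest: openin_subset)

lemma sets_borel_of: "sets (borel_of X) = sigma_sets (topspace X) {U. openin X U}"
  unfolding borel_of_def by (rule sets_measure_of) (auto dest: openin_subset)

lemma openin_in_sets_borel_of: "openin X U \<Longrightarrow> U \<in> sets (borel_of X)"
  by (simp add: sets_borel_of)

lemma closedin_in_sets_borel_of: 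
  assumes "closedin X C"
  shows "C \<in> sets (borel_of X)"
proof -
  have "openin X (topspace X - C)" using assms by (simp add: closedin_def)
  then have "space (borel_of X) - (topspace X - C) \<in> sets (borel_of X)"
    by (intro sets.compl_sets openin_in_sets_borel_of)
  moreover have "topspace X - (topspace X - C) = C" using closedin_subset[OF assms] by blast
  ultimately show ?thesis by simp
qed

lemma continuous_map_measurable_borel_of:
  assumes f: "continuous_map X Y f"
  shows "f \<in> measurable (borel_of X) (borel_of Y)"
proof (rule measurable_sigma_sets)
  show "sets (borel_of Y) = sigma_sets (topspace Y) {U. openin Y U}" by (rule sets_borel_of)
  show "{U. openin Y U} \<subseteq> Pow (topspace Y)" by (auto dest: openin_subset)
  show "f \<in> space (borel_of X) \<rightarrow> topspace Y" using f by (auto simp: continuous_map_def)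
  fix U assume "U \<in> {U. openin Y U}"
  then have "openin X {x \<in> topspace X. f x \<in> U}" using f by (auto simp: continuous_map_def)
  moreover have "f -` U \<inter> space (borel_of X) = {x \<in> topspace X. f x \<in> U}" by auto
  ultimately show "f -` U \<inter> space (borel_of X) \<in> sets (borel_of X)"
    by (simp add: openin_in_sets_borel_of)
qed

lemma continuous_map_borel_measurable:
  fixes f :: "'a \<Rightarrow> real"
  assumes f: "continuous_map X euclideanreal f"
  shows "f \<in> borel_measurable (borel_of X)"
proof (rule borel_measurableI)
  fix S :: "real set" assume "open S"
  then have "openin X {x \<in> topspace X. f x \<in> S}"
    using f by (intro openin_continuous_map_preimage[OF f]) simp
  moreover have "f -` S \<inter> space (borel_of X) = {x \<in> topspace X. f x \<in> S}" by auto
  ultimately show "f -` S \<inter> space (borel_of X) \<in> sets (borel_of X)"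
    by (simp add: openin_in_sets_borel_of)
qed

locale regular_prob = prob_space M for X :: "'a topology" and M :: "'a measure" +
  assumes compact_X: "compact_space X" and Hausdorff_X: "Hausdorff_space X"
    and regular: "regular_borel_measure X M"
begin

lemma sets_M: "sets M = sets (borel_of X)"
  using regular by (simp add: regular_borel_measure_def)

lemma space_M [simp]: "space M = topspace X"
  using sets_eq_imp_space_eq[OF sets_M] by simp

lemma open_sets: "openin X U \<Longrightarrow> U \<in> sets M"
  by (simp add: sets_M openin_in_sets_borel_of)

lemma closed_sets: "closedin X U \<Longrightarrow> U \<in> sets M"
  by (simp add: sets_M closedin_in_sets_borel_of)

lemma continuous_measurable:
  fixes f :: "'a \<Rightarrow> real"
  shows "continuous_map X euclideanreal f \<Longrightarrow> f \<in> borel_measurable M"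
  using continuous_map_borel_measurable measurable_cong_sets[OF sets_M refl] by blast

lemma inner_regular:
  assumes A: "A \<in> sets M" and e: "0 < e"
  obtains K where "closedin X K" "K \<subseteq> A" "measure M A - e < measure M K"
proof (cases "measure M A - e < 0")
  case True
  show ?thesis by (rule that[of "{}"]) (use True in auto)
next
  case False
  have "ennreal (measure M A - e) < emeasure M A"
    using False e by (simp add: emeasure_eq_measure ennreal_less_iff)
  also have "emeasure M A = (SUP K\<in>{K. compactin X K \<and> K \<subseteq> A}. emeasure M K)"
    using regular A unfolding regular_borel_measure_def by blast
  finally obtain K where K: "compactin X K" "K \<subseteq> A" "ennreal (measure M A - e) < emeasure M K"
    by (auto simp: less_SUP_iff)
  have "closedin X K" using K(1) Hausdorff_X by (rule_tac compactin_imp_closedin)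
  moreover have "measure M A - e < measure M K"
    using K(3) False by (simp add: emeasure_eq_measure ennreal_less_iff)
  ultimately show ?thesis using that K by blast
qed

lemma outer_regular:
  assumes A: "A \<in> sets M" and e: "0 < e"
  obtains U where "openin X U" "A \<subseteq> U" "measure M U < measure M A + e"
proof -
  have "(INF U\<in>{U. openin X U \<and> A \<subseteq> U}. emeasure M U) = emeasure M A"
    using regular A unfolding regular_borel_measure_def by metis
  also have "\<dots> < ennreal (measure M A + e)"
    using e by (simp add: emeasure_eq_measure ennreal_less_iff)
  finally obtain U where "openin X U" "A \<subseteq> U" "emeasure M U < ennreal (measure M A + e)"
    by (auto simp: INF_less_iff)
  then show ?thesis using that by (simp add: emeasure_eq_measure ennreal_less_iff)
qed

text \<open>Although the family may be uncountable, inner regularity reduces the claim to compact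
  sets, which are covered by finitely many of the open sets.\<close>

lemma null_Union_open:
  assumes A: "A \<in> sets M" and \<U>: "\<And>U. U \<in> \<U> \<Longrightarrow> openin X U \<and> measure M (A \<inter> U) = 0"
  shows "measure M (A \<inter> \<Union>\<U>) = 0"
proof (rule ccontr)
  assume "measure M (A \<inter> \<Union>\<U>) \<noteq> 0"
  then have pos: "0 < measure M (A \<inter> \<Union>\<U>)" by (simp add: zero_less_measure_iff)
  have o: "openin X (\<Union>\<U>)" using \<U> by blast
  have "A \<inter> \<Union>\<U> \<in> sets M" using A open_sets[OF o] by blast
  then obtain K where K: "closedin X K" "K \<subseteq> A \<inter> \<Union>\<U>"
    "measure M (A \<inter> \<Union>\<U>) - measure M (A \<inter> \<Union>\<U>) < measure M K"
    using pos by (rule inner_regular)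
  have "compactin X K" using K(1) compact_X by (simp add: closedin_compact_space)
  then have "\<exists>\<F>. finite \<F> \<and> \<F> \<subseteq> \<U> \<and> K \<subseteq> \<Union>\<F>"
    by (rule compactinD) (use \<U> K(2) in auto)
  then obtain \<F> where F: "finite \<F>" "\<F> \<subseteq> \<U>" "K \<subseteq> \<Union>\<F>" by auto
  have FM: "A \<inter> U \<in> sets M" if U: "U \<in> \<F>" for U
  proof -
    have "openin X U" using U F(2) \<U> by auto
    then show ?thesis using A open_sets by auto
  qed
  have "measure M K \<le> measure M (\<Union>U\<in>\<F>. A \<inter> U)"
    using F K FM by (intro finite_measure_mono sets.finite_UN) auto
  also have "\<dots> \<le> (\<Sum>U\<in>\<F>. measure M (A \<inter> U))"
    using F FM by (intro finite_measure_subadditive_finite) auto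
  also have "\<dots> = 0" using F \<U> by (intro sum.neutral) auto
  finally show False using K by simp
qed

text \<open>Removing from \<open>A\<close> all open null pieces does not change its measure. On the remaining set \<open>B\<close>
  a nonempty relatively open set is never null, so an inequality between continuous
  functions that holds almost everywhere on \<open>B\<close> holds everywhere on \<open>B\<close>.\<close>

lemma closed_support:
  assumes A: "closedin X A"
  obtains B where "closedin X B" "B \<subseteq> A" "measure M B = measure M A"
    "\<And>U. openin X U \<Longrightarrow> U \<inter> B \<noteq> {} \<Longrightarrow> 0 < measure M (B \<inter> U)"
proof -
  define \<U> where "\<U> = {U. openin X U \<and> measure M (A \<inter> U) = 0}"
  have o: "openin X (\<Union>\<U>)" by (auto simp: \<U>_def)
  have null: "measure M (A \<inter> \<Union>\<U>) = 0"
    by (rule null_Union_open) (auto simp: \<U>_def closed_sets[OF A])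
  have AM: "A \<in> sets M" "\<Union>\<U> \<in> sets M" using closed_sets[OF A] open_sets[OF o] by auto
  have diff: "measure M (C - \<Union>\<U>) = measure M C" if C: "C \<in> sets M" "C \<subseteq> A" for C
  proof -
    have "measure M (C \<inter> \<Union>\<U>) \<le> measure M (A \<inter> \<Union>\<U>)"
      using AM C by (intro finite_measure_mono) auto
    then have "measure M (C \<inter> \<Union>\<U>) = 0" using null by (simp add: measure_le_0_iff)
    then show ?thesis using finite_measure_Diff'[of C "\<Union>\<U>"] AM C by simp
  qed
  show ?thesis
  proof (rule that[of "A - \<Union>\<U>"])
    show "closedin X (A - \<Union>\<U>)" using A o by (rule closedin_diff)
    show "measure M (A - \<Union>\<U>) = measure M A" using AM by (intro diff) auto
    fix U assume U: "openin X U" "U \<inter> (A - \<Union>\<U>) \<noteq> {}"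
    have "U \<notin> \<U>"
    proof
      assume "U \<in> \<U>"
      then have "U \<subseteq> \<Union>\<U>" by (rule Union_upper)
      then show False using U(2) by auto
    qed
    then have "measure M (A \<inter> U) \<noteq> 0" using U(1) by (simp add: \<U>_def)
    moreover have "measure M (A \<inter> U - \<Union>\<U>) = measure M (A \<inter> U)"
      by (rule diff) (use AM(1) open_sets[OF U(1)] in auto)
    moreover have "(A - \<Union>\<U>) \<inter> U = A \<inter> U - \<Union>\<U>" by auto
    ultimately show "0 < measure M ((A - \<Union>\<U>) \<inter> U)"
      by (simp only: zero_less_measure_iff not_False_eq_True)
  qed auto
qed

lemma Urysohn:
  assumes "closedin X S" "closedin X T" "S \<inter> T = {}"
  obtains f :: "'a \<Rightarrow> real" where "continuous_map X euclideanreal f"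
    "\<And>x. x \<in> topspace X \<Longrightarrow> f x \<in> {0..1}" "\<And>x. x \<in> S \<Longrightarrow> f x = 0" "\<And>x. x \<in> T \<Longrightarrow> f x = 1"
proof -
  have "normal_space X"
    using compact_X Hausdorff_X by (intro compact_Hausdorff_or_regular_imp_normal_space) auto
  then obtain f where f: "continuous_map X (top_of_set {0..1::real}) f" "f ` S \<subseteq> {0}" "f ` T \<subseteq> {1}"
    using Urysohn_lemma[of X S T 0 1] assms by (auto simp: disjnt_def)
  then show ?thesis using that[of f] by (auto simp: continuous_map_in_subtopology image_subset_iff Pi_iff)
qed

end

text \<open>For a finite measure on a compact space, outer regularity at \<open>A\<close> is inner regularity at the
  complement of \<open>A\<close>.\<close>

lemma regular_borel_measureI:
  assumes fin: "finite_measure M" and X: "compact_space X" "Hausdorff_space X"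
    and sets: "sets M = sets (borel_of X)"
    and inner: "\<And>A e. A \<in> sets M \<Longrightarrow> 0 < e \<Longrightarrow> \<exists>K. closedin X K \<and> K \<subseteq> A \<and> measure M A - e < measure M K"
  shows "regular_borel_measure X M"
proof -
  interpret finite_measure M by (rule fin)
  have space: "space M = topspace X" using sets_eq_imp_space_eq[OF sets] by simp
  have clM: "closedin X K \<Longrightarrow> K \<in> sets M" for K by (simp add: sets closedin_in_sets_borel_of)
  have opM: "openin X K \<Longrightarrow> K \<in> sets M" for K by (simp add: sets openin_in_sets_borel_of)
  have "emeasure M A = (SUP K\<in>{K. compactin X K \<and> K \<subseteq> A}. emeasure M K)" if A: "A \<in> sets M" for A
  proof (rule antisym)
    show "emeasure M A \<le> (SUP K\<in>{K. compactin X K \<and> K \<subseteq> A}. emeasure M K)"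
    proof (rule ennreal_le_epsilon)
      fix e :: real assume "0 < e"
      then obtain K where K: "closedin X K" "K \<subseteq> A" "measure M A - e < measure M K"
        using inner[OF A] by blast
      have "emeasure M A \<le> emeasure M K + ennreal e"
        using K(3) \<open>0 < e\<close> by (simp add: emeasure_eq_measure flip: ennreal_plus)
      also have "emeasure M K \<le> (SUP K\<in>{K. compactin X K \<and> K \<subseteq> A}. emeasure M K)"
        using K X by (intro SUP_upper) (auto simp: closedin_compact_space)
      finally show "emeasure M A \<le> (SUP K\<in>{K. compactin X K \<and> K \<subseteq> A}. emeasure M K) + ennreal e"
        by (simp add: add_right_mono)
    qed
    show "(SUP K\<in>{K. compactin X K \<and> K \<subseteq> A}. emeasure M K) \<le> emeasure M A"
      using A by (intro SUP_least) (auto intro: emeasure_mono)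
  qed
  moreover have "emeasure M A = (INF U\<in>{U. openin X U \<and> A \<subseteq> U}. emeasure M U)" if A: "A \<in> sets M" for A
  proof (rule antisym)
    show "emeasure M A \<le> (INF U\<in>{U. openin X U \<and> A \<subseteq> U}. emeasure M U)"
      using opM by (intro INF_greatest) (auto intro: emeasure_mono)
    show "(INF U\<in>{U. openin X U \<and> A \<subseteq> U}. emeasure M U) \<le> emeasure M A"
    proof (rule ennreal_le_epsilon)
      fix e :: real assume e: "0 < e"
      have AX: "A \<subseteq> topspace X" using sets.sets_into_space[OF A] space by simp
      have "topspace X - A \<in> sets M" using A space by (metis sets.compl_sets)
      then obtain K where K: "closedin X K" "K \<subseteq> topspace X - A" "measure M (topspace X - A) - e < measure M K"
        using inner e by blast
      have U: "openin X (topspace X - K)" using K(1) by blast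
      have "measure M (topspace X - K) \<le> measure M A + e"
        using finite_measure_compl[OF clM[OF K(1)]] finite_measure_compl[OF A] K(3) by (simp add: space)
      then have "emeasure M (topspace X - K) \<le> emeasure M A + ennreal e"
        using e by (simp add: emeasure_eq_measure flip: ennreal_plus)
      moreover have "(INF U\<in>{U. openin X U \<and> A \<subseteq> U}. emeasure M U) \<le> emeasure M (topspace X - K)"
        using U K(2) AX by (intro INF_lower) auto
      ultimately show "(INF U\<in>{U. openin X U \<and> A \<subseteq> U}. emeasure M U) \<le> emeasure M A + ennreal e"
        by (rule order_trans[rotated])
    qed
  qed
  ultimately show ?thesis using sets by (simp add: regular_borel_measure_def)
qed

lemma regular_prob_le:
  assumes M: "regular_prob X M" and N: "regular_prob X N"
    and eq: "\<And>f. continuous_map X euclideanreal f \<Longrightarrow> (\<And>x. x \<in> topspace X \<Longrightarrow> f x \<in> {0..1}) \<Longrightarrow>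
      (\<integral>x. f x \<partial>M) = (\<integral>x. f x \<partial>N)"
    and A: "A \<in> sets M"
  shows "measure M A \<le> measure N A"
proof -
  interpret M: regular_prob X M by (rule M)
  interpret N: regular_prob X N by (rule N)
  show ?thesis
  proof (rule field_le_epsilon)
    fix e :: real assume e: "0 < e"
    have AN: "A \<in> sets N" using A M.sets_M N.sets_M by simp
    obtain K where K: "closedin X K" "K \<subseteq> A" "measure M A - e / 2 < measure M K"
      using M.inner_regular[OF A, of "e / 2"] e by auto
    obtain U where U: "openin X U" "A \<subseteq> U" "measure N U < measure N A + e / 2"
      using N.outer_regular[OF AN, of "e / 2"] e by auto
    obtain f :: "'a \<Rightarrow> real" where f: "continuous_map X euclideanreal f"
      "\<And>x. x \<in> topspace X \<Longrightarrow> f x \<in> {0..1}" "\<And>x. x \<in> topspace X - U \<Longrightarrow> f x = 0" "\<And>x. x \<in> K \<Longrightarrow> f x = 1"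
      using M.Urysohn[of "topspace X - U" K] U K by auto
    have "measure M K = (\<integral>x. indicator K x \<partial>M)"
      using closedin_subset[OF K(1)] by (simp add: Int_absorb2)
    also have "\<dots> \<le> (\<integral>x. f x \<partial>M)"
    proof (rule integral_mono)
      show "integrable M (indicator K :: 'a \<Rightarrow> real)"
        using M.closed_sets[OF K(1)] by (intro integrable_real_indicator) (simp_all add: M.emeasure_eq_measure)
      show "integrable M f"
        using f(2) by (intro M.integrable_const_bound[where B = 1] M.continuous_measurable f) auto
    qed (use f in \<open>auto simp: indicator_def\<close>)
    also have "\<dots> = (\<integral>x. f x \<partial>N)" using f by (intro eq) auto
    also have "\<dots> \<le> (\<integral>x. indicator U x \<partial>N)"
    proof (rule integral_mono)
      show "integrable N (indicator U :: 'a \<Rightarrow> real)"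
        using N.open_sets[OF U(1)] by (intro integrable_real_indicator) (simp_all add: N.emeasure_eq_measure)
      show "integrable N f"
        using f(2) by (intro N.integrable_const_bound[where B = 1] N.continuous_measurable f) auto
    qed (use f in \<open>auto simp: indicator_def\<close>)
    also have "\<dots> = measure N U"
      using openin_subset[OF U(1)] by (simp add: Int_absorb2)
    finally show "measure M A \<le> measure N A + e" using K U by linarith
  qed
qed

lemma regular_prob_eqI:
  assumes M: "regular_prob X M" and N: "regular_prob X N"
    and eq: "\<And>f. continuous_map X euclideanreal f \<Longrightarrow> (\<And>x. x \<in> topspace X \<Longrightarrow> f x \<in> {0..1}) \<Longrightarrow>
      (\<integral>x. f x \<partial>M) = (\<integral>x. f x \<partial>N)"
  shows "M = N"
proof -
  interpret M: regular_prob X M by (rule M)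
  interpret N: regular_prob X N by (rule N)
  show ?thesis
  proof (rule measure_eqI)
    show s: "sets M = sets N" using M.sets_M N.sets_M by simp
    fix A assume A: "A \<in> sets M"
    have "measure M A = measure N A"
      using regular_prob_le[OF M N eq A] regular_prob_le[OF N M eq[symmetric]] A s by (intro antisym) auto
    then show "emeasure M A = emeasure N A" by (simp add: M.emeasure_eq_measure N.emeasure_eq_measure)
  qed
qed

section \<open>Tame limits and invariant measures\<close>

text \<open>A countable union of members of \<open>\<C>\<close> attains the supremum of the measures of members; if this
  supremum were less than one, a member inside the complement could be added.\<close>

lemma (in regular_prob) exhaustion:
  assumes cl: "\<And>C. C \<in> \<C> \<Longrightarrow> closedin X C" and empty: "{} \<in> \<C>"
    and Un: "\<And>C D. C \<in> \<C> \<Longrightarrow> D \<in> \<C> \<Longrightarrow> C \<union> D \<in> \<C>"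
    and dense: "\<And>A. closedin X A \<Longrightarrow> 0 < measure M A \<Longrightarrow> \<exists>B\<in>\<C>. B \<subseteq> A \<and> 0 < measure M B"
    and e: "0 < e"
  obtains C where "C \<in> \<C>" "1 - e < measure M C"
proof (rule ccontr)
  note * = that
  assume "\<not> thesis"
  then have small: "measure M C \<le> 1 - e" if "C \<in> \<C>" for C using that * by force
  have CM: "C \<in> sets M" if "C \<in> \<C>" for C using closed_sets cl that by blast
  have bdd: "bdd_above (measure M ` \<C>)" by (auto intro!: bdd_aboveI[of _ 1])
  define S where "S = (SUP C\<in>\<C>. measure M C)"
  have le_S: "measure M C \<le> S" if "C \<in> \<C>" for C
    unfolding S_def using that bdd by (intro cSUP_upper)
  have S: "S \<le> 1 - e" unfolding S_def using small empty by (intro cSUP_least) auto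
  have "\<exists>C\<in>\<C>. S - 1 / real (Suc n) < measure M C" for n
  proof -
    have "S - 1 / real (Suc n) < (SUP C\<in>\<C>. measure M C)" by (simp add: S_def)
    then show ?thesis using less_cSUP_iff[OF _ bdd, of "S - 1 / real (Suc n)"] empty by auto
  qed
  then obtain C where C: "\<And>n. C n \<in> \<C>" "\<And>n. S - 1 / real (Suc n) < measure M (C n)"
    by metis
  define D where "D n = (\<Union>i\<le>n. C i)" for n
  have D: "D n \<in> \<C>" for n
  proof (induction n)
    case 0 then show ?case using C(1)[of 0] by (simp add: D_def)
  next
    case (Suc n)
    have "D (Suc n) = C (Suc n) \<union> D n" by (simp add: D_def atMost_Suc)
    then show ?case using Un[OF C(1)[of "Suc n"] Suc] by simp
  qed
  have incD: "incseq D" unfolding D_def by (intro monoI UN_mono) auto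
  have "(\<lambda>n. measure M (D n)) \<longlonglongrightarrow> measure M (\<Union>n. D n)"
    using D CM incD by (intro finite_Lim_measure_incseq) auto
  then have "measure M (\<Union>n. D n) \<le> 1 - e"
    by (rule LIMSEQ_le_const2) (use small D in auto)
  moreover have DM: "(\<Union>n. D n) \<in> sets M" using D CM by auto
  ultimately have pos: "0 < measure M (space M - (\<Union>n. D n))"
    using prob_compl[OF DM] e by simp
  have "space M - (\<Union>n. D n) \<in> sets M" using DM by (rule sets.compl_sets)
  then obtain A where A: "closedin X A" "A \<subseteq> space M - (\<Union>n. D n)"
    "measure M (space M - (\<Union>n. D n)) - measure M (space M - (\<Union>n. D n)) < measure M A"
    using pos by (rule inner_regular)
  have "0 < measure M A" using A(3) by simp
  then obtain B where B: "B \<in> \<C>" "B \<subseteq> A" "0 < measure M B" using dense[OF A(1)] by blast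
  obtain n where n: "inverse (real (Suc n)) < measure M B" using reals_Archimedean[OF B(3)] by blast
  have "C n \<subseteq> (\<Union>n. D n)" by (auto simp: D_def)
  then have "C n \<inter> B = {}" using B(2) A(2) by blast
  then have "measure M (C n \<union> B) = measure M (C n) + measure M B"
    using CM C B by (intro finite_measure_Union) auto
  moreover have "measure M (C n \<union> B) \<le> S" using le_S Un C B by blast
  ultimately show False using C(2)[of n] n by (simp add: inverse_eq_divide)
qed

context flow
begin

text \<open>The forbidden tree is usually built level by level. Here \<open>P n c\<close> is the invariant of the
  construction: it speaks about the nodes \<open>c s\<close> with \<open>length s = n\<close>.\<close>

lemma no_independent_splitting:
  fixes P :: "nat \<Rightarrow> (bool list \<Rightarrow> 'a set) \<Rightarrow> bool"
  assumes tame: "tame G X \<phi>" and f: "continuous_map X euclideanreal f" and ab: "a < b"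
    and start: "P 0 c\<^sub>0"
    and ne: "\<And>n c s. P n c \<Longrightarrow> length s = n \<Longrightarrow> c s \<noteq> {} \<and> c s \<subseteq> topspace X"
    and split: "\<And>n c. P n c \<Longrightarrow> \<exists>g\<in>carrier G. \<exists>c'. P (Suc n) c' \<and> (\<forall>s. length s = n \<longrightarrow>
       c' (False # s) \<subseteq> {x \<in> c s. f (\<phi> g x) \<le> a} \<and> c' (True # s) \<subseteq> {x \<in> c s. f (\<phi> g x) \<ge> b})"
  shows False
proof -
  define Q where "Q n c c' g \<longleftrightarrow> g \<in> carrier G \<and> (\<forall>s. length s = n \<longrightarrow>
    c' (False # s) \<subseteq> {x \<in> c s. f (\<phi> g x) \<le> a} \<and> c' (True # s) \<subseteq> {x \<in> c s. f (\<phi> g x) \<ge> b})"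
    for n :: nat and c c' :: "bool list \<Rightarrow> 'a set" and g
  have "\<exists>C. \<forall>n. P n (C n) \<and> (\<exists>g. Q n (C n) (C (Suc n)) g)"
  proof (rule dependent_nat_choice)
    show "\<exists>c. P 0 c" using start by blast
    show "\<exists>c'. P (Suc n) c' \<and> (\<exists>g. Q n c c' g)" if "P n c" for c n
      using split[OF that] unfolding Q_def by blast
  qed
  then obtain C g where PC: "\<And>n. P n (C n)" and QC: "\<And>n. Q n (C n) (C (Suc n)) (g n)"
    by metis
  have step: "C (Suc (length s)) (False # s) \<subseteq> {x \<in> C (length s) s. f (\<phi> (g (length s)) x) \<le> a}"
    "C (Suc (length s)) (True # s) \<subseteq> {x \<in> C (length s) s. f (\<phi> (g (length s)) x) \<ge> b}" for s
    using QC[of "length s"] by (auto simp: Q_def)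
  show False
  proof (rule no_independent_tree[OF tame f ab, of g "\<lambda>s. C (length s) s"])
    show "g n \<in> carrier G" for n using QC[of n] by (simp add: Q_def)
    show "C (length s) s \<noteq> {}" "C (length s) s \<subseteq> topspace X" for s using ne[OF PC refl] by auto
    show "C (length (c # s)) (c # s) \<subseteq> C (length s) s" for c s
      using step[of s] by (cases c) auto
    show "f (\<phi> (g (length s)) x) \<le> a" if "x \<in> C (length (False # s)) (False # s)" for s x
      using step[of s] that by auto
    show "f (\<phi> (g (length s)) x) \<ge> b" if "x \<in> C (length (True # s)) (True # s)" for s x
      using step[of s] that by auto
  qed
qed

lemma continuous_translate:
  fixes f :: "'a \<Rightarrow> real"
  assumes "continuous_map X euclideanreal f" "g \<in> carrier G"
  shows "continuous_map X euclideanreal (\<lambda>x. f (\<phi> g x))"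
  using continuous_map_compose[OF continuous_act[OF assms(2)] assms(1)] by (simp add: o_def)

lemma finite_bool_lists: "finite {s::bool list. length s = n}"
  using finite_lists_length_eq[of "UNIV :: bool set" n] by simp

text \<open>Otherwise every closed subset of \<open>A\<close> with positive measure is split into two parts of positive
  measure by \<open>U\<close>-almost every translate of \<open>f\<close>. As \<open>U\<close> is an ultrafilter, finitely many such
  sets are split by a common translate, and so an independent tree exists.\<close>

lemma one_sided_oscillation:
  assumes tame: "tame G X \<phi>" and M: "regular_prob X M"
    and f: "continuous_map X euclideanreal f" and ab: "a < b"
    and U: "ultrafilter U" and UG: "eventually (\<lambda>g. g \<in> carrier G) U"
    and A: "closedin X A" "0 < measure M A"
  obtains B where "closedin X B" "B \<subseteq> A" "0 < measure M B"
    "eventually (\<lambda>g. \<forall>x\<in>B. f (\<phi> g x) \<ge> a) U \<or> eventually (\<lambda>g. \<forall>x\<in>B. f (\<phi> g x) \<le> b) U"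
proof -
  interpret M: regular_prob X M by (rule M)
  define lo where "lo g = {x \<in> topspace X. f (\<phi> g x) \<in> {..<a}}" for g
  define hi where "hi g = {x \<in> topspace X. f (\<phi> g x) \<in> {b<..}}" for g
  have lohi: "openin X (lo g)" "openin X (hi g)" if "g \<in> carrier G" for g
    unfolding lo_def hi_def by (rule openin_continuous_map_preimage[OF continuous_translate[OF f that]]; simp)+
  have "\<exists>B. closedin X B \<and> B \<subseteq> A \<and> 0 < measure M B \<and>
      (eventually (\<lambda>g. measure M (B \<inter> lo g) = 0) U \<or> eventually (\<lambda>g. measure M (B \<inter> hi g) = 0) U)"
  proof (rule ccontr)
    assume neg: "\<not> ?thesis"
    have both: "eventually (\<lambda>g. 0 < measure M (B \<inter> lo g) \<and> 0 < measure M (B \<inter> hi g)) U"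
      if B: "closedin X B" "B \<subseteq> A" "0 < measure M B" for B
    proof -
      have "\<not> eventually (\<lambda>g. measure M (B \<inter> lo g) = 0) U" "\<not> eventually (\<lambda>g. measure M (B \<inter> hi g) = 0) U"
        using neg B by auto
      then have "eventually (\<lambda>g. measure M (B \<inter> lo g) \<noteq> 0) U" "eventually (\<lambda>g. measure M (B \<inter> hi g) \<noteq> 0) U"
        by (simp_all add: ultrafilter_not_iff[OF U])
      then show ?thesis by eventually_elim (simp add: zero_less_measure_iff)
    qed
    define P where "P n c \<longleftrightarrow> (\<forall>s. length s = n \<longrightarrow> closedin X (c s) \<and> c s \<subseteq> A \<and> 0 < measure M (c s))"
      for n and c :: "bool list \<Rightarrow> 'a set"
    show False
    proof (rule no_independent_splitting[OF tame f ab, of P "\<lambda>_. A"])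
      show "P 0 (\<lambda>_. A)" using A by (simp add: P_def)
      show "c s \<noteq> {} \<and> c s \<subseteq> topspace X" if "P n c" "length s = n" for n c s
        using that closedin_subset[of X "c s"] by (auto simp: P_def)
      fix n c assume P: "P n c"
      have "eventually (\<lambda>g. \<forall>s\<in>{s. length s = n}. 0 < measure M (c s \<inter> lo g) \<and> 0 < measure M (c s \<inter> hi g)) U"
        using P by (intro eventually_ball_finite[OF finite_bool_lists] ballI both) (auto simp: P_def)
      then have "eventually (\<lambda>g. g \<in> carrier G \<and> (\<forall>s\<in>{s. length s = n}. 0 < measure M (c s \<inter> lo g) \<and> 0 < measure M (c s \<inter> hi g))) U"
        using UG by eventually_elim auto
      then obtain g where g: "g \<in> carrier G"
        and pos: "\<And>s. length s = n \<Longrightarrow> 0 < measure M (c s \<inter> lo g) \<and> 0 < measure M (c s \<inter> hi g)"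
        using U by (auto simp: ultrafilter_def dest!: eventually_happens')
      define c' where "c' s = c (tl s) \<inter> {x \<in> topspace X. f (\<phi> g x) \<in> (if hd s then {b..} else {..a})}" for s
      have cl: "closedin X {x \<in> topspace X. f (\<phi> g x) \<in> (if d then {b..} else {..a})}" for d
        by (rule closedin_continuous_map_preimage[OF continuous_translate[OF f g]]) simp
      have "P (Suc n) c'"
        unfolding P_def
      proof (intro allI impI)
        fix s :: "bool list" assume "length s = Suc n"
        then obtain d t where s: "s = d # t" "length t = n" by (cases s) auto
        have c: "closedin X (c t)" "c t \<subseteq> A" using P s by (auto simp: P_def)
        have cl': "closedin X (c' s)" unfolding c'_def s list.sel using c(1) cl by (rule closedin_Int)
        have "c t \<inter> (if d then hi g else lo g) \<subseteq> c' s" by (auto simp: c'_def s lo_def hi_def)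
        then have "measure M (c t \<inter> (if d then hi g else lo g)) \<le> measure M (c' s)"
          using M.closed_sets[OF cl'] by (rule M.finite_measure_mono)
        then have "0 < measure M (c' s)" using pos[OF s(2)] by (cases d) auto
        then show "closedin X (c' s) \<and> c' s \<subseteq> A \<and> 0 < measure M (c' s)"
          using cl' c by (auto simp: c'_def s)
      qed
      then show "\<exists>g\<in>carrier G. \<exists>c'. P (Suc n) c' \<and> (\<forall>s. length s = n \<longrightarrow>
       c' (False # s) \<subseteq> {x \<in> c s. f (\<phi> g x) \<le> a} \<and> c' (True # s) \<subseteq> {x \<in> c s. f (\<phi> g x) \<ge> b})"
        by (intro bexI[OF _ g] exI[of _ c']) (auto simp: c'_def)
    qed
  qed
  then obtain B where B: "closedin X B" "B \<subseteq> A" "0 < measure M B"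
    "eventually (\<lambda>g. measure M (B \<inter> lo g) = 0) U \<or> eventually (\<lambda>g. measure M (B \<inter> hi g) = 0) U" by blast
  \<comment> \<open>The alternative for \<open>B\<close> holds up to null sets that depend on \<open>g\<close>; on its support these
    null sets are empty.\<close>
  obtain B' where B': "closedin X B'" "B' \<subseteq> B" "measure M B' = measure M B"
    and charge: "\<And>V. openin X V \<Longrightarrow> V \<inter> B' \<noteq> {} \<Longrightarrow> 0 < measure M (B' \<inter> V)"
    by (rule M.closed_support[OF B(1)]) auto
  have null: "B' \<inter> V = {}" if V: "openin X V" "measure M (B \<inter> V) = 0" for V
  proof (rule ccontr)
    assume "B' \<inter> V \<noteq> {}"
    then have "0 < measure M (B' \<inter> V)" using charge[OF V(1)] by (simp add: Int_commute)
    also have "\<dots> \<le> measure M (B \<inter> V)"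
      using B' M.closed_sets[OF B(1)] M.open_sets[OF V(1)] by (intro M.finite_measure_mono) auto
    finally show False using V by simp
  qed
  have B'X: "B' \<subseteq> topspace X" using B'(1) by (rule closedin_subset)
  have "eventually (\<lambda>g. \<forall>x\<in>B'. f (\<phi> g x) \<ge> a) U" if "eventually (\<lambda>g. measure M (B \<inter> lo g) = 0) U"
    using that UG
  proof eventually_elim
    case (elim g)
    then have "B' \<inter> lo g = {}" by (intro null lohi)
    then show ?case using B'X by (auto simp: lo_def not_less)
  qed
  moreover have "eventually (\<lambda>g. \<forall>x\<in>B'. f (\<phi> g x) \<le> b) U" if "eventually (\<lambda>g. measure M (B \<inter> hi g) = 0) U"
    using that UG
  proof eventually_elim
    case (elim g)
    then have "B' \<inter> hi g = {}" by (intro null lohi)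
    then show ?case using B'X by (auto simp: hi_def not_less)
  qed
  ultimately show ?thesis using that[of B'] B B' by auto
qed

text \<open>A version of Egorov's theorem for ultrafilters. On the sets of the first kind in
  \<open>one_sided_oscillation\<close> the premise \<open>f (\<phi> g x) < a\<close> eventually fails, and on those of the second
  kind the conclusion \<open>f (p x) \<le> b\<close> is inherited from \<open>f (\<phi> g x) \<le> b\<close> by pointwise convergence.
  By exhaustion finitely many of these sets have almost full measure.\<close>

lemma tame_limit_almost_uniform:
  assumes tame: "tame G X \<phi>" and M: "regular_prob X M"
    and f: "continuous_map X euclideanreal f" and ab: "a < b"
    and U: "ultrafilter U" and UG: "eventually (\<lambda>g. g \<in> carrier G) U"
    and lim: "\<And>x. x \<in> topspace X \<Longrightarrow> limitin X (\<lambda>g. \<phi> g x) (p x) U"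
    and e: "0 < e"
  obtains K where "closedin X K" "1 - e < measure M K"
    "eventually (\<lambda>g. \<forall>x\<in>K. f (\<phi> g x) < a \<longrightarrow> f (p x) \<le> b) U"
proof -
  interpret M: regular_prob X M by (rule M)
  define L where "L B \<longleftrightarrow> closedin X B \<and> eventually (\<lambda>g. \<forall>x\<in>B. f (\<phi> g x) \<ge> a) U" for B
  define H where "H B \<longleftrightarrow> closedin X B \<and> eventually (\<lambda>g. \<forall>x\<in>B. f (\<phi> g x) \<le> b) U" for B
  have LUn: "L (B \<union> C)" if "L B" "L C" for B C
    using that unfolding L_def by (auto elim: eventually_elim2)
  have HUn: "H (B \<union> C)" if "H B" "H C" for B C
    using that unfolding H_def by (auto elim: eventually_elim2)
  have LH0: "L {}" "H {}" by (auto simp: L_def H_def)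
  define \<C> where "\<C> = {B \<union> C |B C. L B \<and> H C}"
  obtain K where K: "K \<in> \<C>" "1 - e < measure M K"
  proof (rule M.exhaustion[of \<C> e])
    show "closedin X C" if "C \<in> \<C>" for C using that by (auto simp: \<C>_def L_def H_def)
    show "{} \<in> \<C>" using LH0 by (auto simp: \<C>_def)
    show "C \<union> D \<in> \<C>" if CD: "C \<in> \<C>" "D \<in> \<C>" for C D
    proof -
      obtain B1 B2 where 1: "C = B1 \<union> B2" "L B1" "H B2" using CD(1) by (auto simp: \<C>_def)
      obtain D1 D2 where 2: "D = D1 \<union> D2" "L D1" "H D2" using CD(2) by (auto simp: \<C>_def)
      have "C \<union> D = (B1 \<union> D1) \<union> (B2 \<union> D2)" using 1 2 by auto
      then show ?thesis using LUn[OF 1(2) 2(2)] HUn[OF 1(3) 2(3)] unfolding \<C>_def by blast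
    qed
    show "\<exists>B\<in>\<C>. B \<subseteq> A \<and> 0 < measure M B" if A: "closedin X A" "0 < measure M A" for A
    proof -
      obtain B where B: "closedin X B" "B \<subseteq> A" "0 < measure M B"
        "eventually (\<lambda>g. \<forall>x\<in>B. f (\<phi> g x) \<ge> a) U \<or> eventually (\<lambda>g. \<forall>x\<in>B. f (\<phi> g x) \<le> b) U"
        using one_sided_oscillation[OF tame M f ab U UG A] by auto
      then have "L B \<or> H B" by (auto simp: L_def H_def)
      then have "B \<in> \<C>" using LH0 unfolding \<C>_def by (metis (mono_tags, lifting) CollectI Un_empty_left Un_empty_right)
      then show ?thesis using B by blast
    qed
  qed (use e in auto)
  obtain B C where BC: "K = B \<union> C" "L B" "H C" using K(1) by (auto simp: \<C>_def)
  have Ubot: "U \<noteq> bot" using U by (simp add: ultrafilter_def)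
  have pC: "f (p x) \<le> b" if x: "x \<in> C" for x
  proof -
    have xX: "x \<in> topspace X" using BC(3) x closedin_subset by (auto simp: H_def)
    show ?thesis
    proof (rule tendsto_upperbound[OF limitin_continuous_tendsto[OF f lim[OF xX]] _ Ubot])
      show "eventually (\<lambda>g. f (\<phi> g x) \<le> b) U"
        using BC(3) x by (auto simp: H_def elim: eventually_mono)
    qed
  qed
  show ?thesis
  proof (rule that[of K])
    show "closedin X K" using BC by (auto simp: L_def H_def)
    have "eventually (\<lambda>g. \<forall>x\<in>B. f (\<phi> g x) \<ge> a) U" using BC by (simp add: L_def)
    then show "eventually (\<lambda>g. \<forall>x\<in>K. f (\<phi> g x) < a \<longrightarrow> f (p x) \<le> b) U"
      by (rule eventually_mono) (use pC BC(1) in force)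
  qed (use K in auto)
qed

lemma enveloping_semigroup_ultralimit:
  assumes p: "p \<in> enveloping_semigroup G X \<phi>"
  obtains U where "ultrafilter U" "eventually (\<lambda>g. g \<in> carrier G) U"
    "\<And>x. x \<in> topspace X \<Longrightarrow> limitin X (\<lambda>g. \<phi> g x) (p x) U"
proof -
  let ?P = "product_topology (\<lambda>_. X) (topspace X)"
  define F where "F = inf (filtercomap \<phi> (nhdsin ?P p)) (principal (carrier G))"
  have pP: "p \<in> topspace ?P" using p by (simp add: enveloping_semigroup_def in_closure_of)
  have cl: "\<exists>g\<in>carrier G. \<phi> g \<in> T" if "openin ?P T" "p \<in> T" for T
    using p that unfolding enveloping_semigroup_def in_closure_of by blast
  have evF: "eventually Q F \<longleftrightarrow> (\<exists>T. openin ?P T \<and> p \<in> T \<and> (\<forall>g\<in>carrier G. \<phi> g \<in> T \<longrightarrow> Q g))" for Q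
  proof -
    have "eventually Q F \<longleftrightarrow> (\<exists>R. eventually R (nhdsin ?P p) \<and> (\<forall>g. R (\<phi> g) \<longrightarrow> g \<in> carrier G \<longrightarrow> Q g))"
      by (simp only: F_def eventually_inf_principal eventually_filtercomap)
    also have "\<dots> \<longleftrightarrow> (\<exists>T. openin ?P T \<and> p \<in> T \<and> (\<forall>g\<in>carrier G. \<phi> g \<in> T \<longrightarrow> Q g))"
      (is "?L \<longleftrightarrow> ?R")
    proof
      assume ?L then show ?R using pP by (auto simp: eventually_nhdsin)
    next
      assume ?R
      then obtain T where T: "openin ?P T" "p \<in> T" "\<forall>g\<in>carrier G. \<phi> g \<in> T \<longrightarrow> Q g" by auto
      have "eventually (\<lambda>r. r \<in> T) (nhdsin ?P p)" using T pP by (auto simp: eventually_nhdsin)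
      then show ?L using T(3) by (intro exI[of _ "\<lambda>r. r \<in> T"]) auto
    qed
    finally show ?thesis .
  qed
  have "F \<noteq> bot"
    unfolding trivial_limit_def evF using cl by blast
  then obtain U where U: "U \<le> F" "ultrafilter U" by (rule ultrafilter_below)
  have lim: "limitin ?P \<phi> p U"
    unfolding limitin_def
  proof (intro conjI allI impI pP)
    fix T assume "openin ?P T \<and> p \<in> T"
    then have "eventually (\<lambda>g. \<phi> g \<in> T) F" unfolding evF by blast
    then show "eventually (\<lambda>g. \<phi> g \<in> T) U" by (rule filter_leD[OF U(1)])
  qed
  show ?thesis
  proof (rule that[OF U(2)])
    have "eventually (\<lambda>g. g \<in> carrier G) F" by (simp add: F_def eventually_inf_principal)
    then show "eventually (\<lambda>g. g \<in> carrier G) U" by (rule filter_leD[OF U(1)])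
    show "limitin X (\<lambda>g. \<phi> g x) (p x) U" if "x \<in> topspace X" for x
      using lim that by (auto simp: limitin_componentwise)
  qed
qed

lemma Prob_regular_prob: "M \<in> Prob G X \<phi> \<Longrightarrow> regular_prob X M"
  using compact Hausdorff
  by (auto simp: Prob_def regular_prob_def regular_prob_axioms_def)

lemma act_measurable:
  assumes "M \<in> Prob G X \<phi>" "g \<in> carrier G"
  shows "\<phi> g \<in> measurable M M"
proof -
  interpret M: regular_prob X M using assms(1) by (rule Prob_regular_prob)
  show ?thesis
    using continuous_map_measurable_borel_of[OF continuous_act[OF assms(2)]]
      measurable_cong_sets[OF M.sets_M M.sets_M] by blast
qed

lemma measure_preimage_act:
  assumes M: "M \<in> Prob G X \<phi>" and g: "g \<in> carrier G" and A: "A \<in> sets M"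
  shows "measure M {x \<in> topspace X. \<phi> g x \<in> A} = measure M A"
proof -
  interpret M: regular_prob X M using M by (rule Prob_regular_prob)
  have "distr M M (\<phi> g) = M" using M g by (simp add: Prob_def)
  moreover have "measure (distr M M (\<phi> g)) A = measure M (\<phi> g -` A \<inter> space M)"
    by (rule measure_distr[OF act_measurable[OF M g] A])
  moreover have "\<phi> g -` A \<inter> space M = {x \<in> topspace X. \<phi> g x \<in> A}" by auto
  ultimately show ?thesis by (simp only:)
qed

text \<open>If \<open>f\<close> vanishes on a large compact subset \<open>K\<close> of \<open>T\<close> and equals one outside \<open>T\<close>, then for \<open>g\<close> near
  \<open>p\<close> the preimage of \<open>K\<close> under \<open>g\<close>, which has the measure of \<open>K\<close>, is mapped into \<open>T\<close> by \<open>p\<close> up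
  to a small set. The preimage of \<open>T\<close> under \<open>p\<close> need not be Borel.\<close>

lemma enveloping_semigroup_preimage_open:
  assumes tame: "tame G X \<phi>" and M: "M \<in> Prob G X \<phi>"
    and p: "p \<in> enveloping_semigroup G X \<phi>" and T: "openin X T" and e: "0 < e"
  obtains K where "closedin X K" "\<And>x. x \<in> K \<Longrightarrow> p x \<in> T" "measure M T - e < measure M K"
proof -
  interpret M: regular_prob X M using M by (rule Prob_regular_prob)
  obtain K where K: "closedin X K" "K \<subseteq> T" "measure M T - e / 2 < measure M K"
    using M.inner_regular[OF M.open_sets[OF T], of "e / 2"] e by auto
  obtain f :: "'a \<Rightarrow> real" where f: "continuous_map X euclideanreal f"
    "\<And>x. x \<in> K \<Longrightarrow> f x = 0" "\<And>x. x \<in> topspace X - T \<Longrightarrow> f x = 1"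
    by (rule M.Urysohn[of K "topspace X - T"]) (use K T in auto)
  obtain U where U: "ultrafilter U" "eventually (\<lambda>g. g \<in> carrier G) U"
    and lim: "\<And>x. x \<in> topspace X \<Longrightarrow> limitin X (\<lambda>g. \<phi> g x) (p x) U"
    using enveloping_semigroup_ultralimit[OF p] by blast
  have e2: "0 < e / 2" using e by simp
  obtain C where C: "closedin X C" "1 - e / 2 < measure M C"
    and ev: "eventually (\<lambda>g. \<forall>x\<in>C. f (\<phi> g x) < 1/3 \<longrightarrow> f (p x) \<le> 2/3) U"
    using tame_limit_almost_uniform[OF tame M.regular_prob_axioms f(1) _ U lim e2, of "1/3" "2/3"] by auto
  from ev U(2) have "eventually (\<lambda>g. g \<in> carrier G \<and> (\<forall>x\<in>C. f (\<phi> g x) < 1/3 \<longrightarrow> f (p x) \<le> 2/3)) U"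
    by eventually_elim auto
  then obtain g where g: "g \<in> carrier G" and C3: "\<And>x. x \<in> C \<Longrightarrow> f (\<phi> g x) < 1/3 \<Longrightarrow> f (p x) \<le> 2/3"
    using U(1) by (auto simp: ultrafilter_def dest!: eventually_happens')
  define H where "H = {x \<in> topspace X. \<phi> g x \<in> K}"
  have H: "closedin X H" unfolding H_def
    by (rule closedin_continuous_map_preimage[OF continuous_act[OF g] K(1)])
  have mH: "measure M H = measure M K"
    unfolding H_def by (rule measure_preimage_act[OF M g M.closed_sets[OF K(1)]])
  show ?thesis
  proof (rule that[of "C \<inter> H"])
    show "closedin X (C \<inter> H)" using C H by blast
    show "p x \<in> T" if "x \<in> C \<inter> H" for x
    proof -
      have "f (p x) \<le> 2/3" using C3[of x] that f(2) by (auto simp: H_def)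
      moreover have "p x \<in> topspace X"
        using lim[of x] that by (auto simp: H_def dest: limitin_topspace)
      ultimately show ?thesis using f(3)[of "p x"] by auto
    qed
    have CM: "C \<in> sets M" "H \<in> sets M" using C H M.closed_sets by auto
    have "measure M (C \<union> H) = measure M C + measure M H - measure M (C \<inter> H)"
      using M.finite_measure_Union'[of C H] M.finite_measure_Diff'[of H C] CM by (simp add: Int_commute)
    then show "measure M T - e < measure M (C \<inter> H)"
      using M.prob_le_1[of "C \<union> H"] C(2) K(3) mH by linarith
  qed
qed

end

section \<open>Supports of ergodic measures are minimal\<close>

lemma (in prob_space) AE_witness:
  assumes "AE x in M. Q x" "A \<in> events" "0 < prob A"
  obtains x where "x \<in> A" "Q x"
proof (rule ccontr)
  assume "\<not> thesis"
  then have "\<And>x. Q x \<Longrightarrow> x \<notin> A" using that by blast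
  then have "AE x in M. x \<notin> A" using assms(1) by auto
  then have "prob A = 0" using prob_eq_0[OF assms(2)] by simp
  then show False using assms(3) by simp
qed

context regular_prob
begin

lemma countable_subcover:
  assumes U: "\<And>i. i \<in> I \<Longrightarrow> openin X (U i)" and full: "measure M (\<Union>i\<in>I. U i) = 1"
  obtains D where "countable D" "D \<subseteq> I" "measure M (\<Union>i\<in>D. U i) = 1"
proof -
  have o: "openin X (\<Union>i\<in>I. U i)" using U by blast
  have "\<exists>F. finite F \<and> F \<subseteq> I \<and> 1 - 1 / real (Suc n) < measure M (\<Union>i\<in>F. U i)" for n
  proof -
    have pos: "0 < 1 / real (Suc n)" by simp
    obtain K where K: "closedin X K" "K \<subseteq> (\<Union>i\<in>I. U i)"
      "measure M (\<Union>i\<in>I. U i) - 1 / real (Suc n) < measure M K"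
      by (rule inner_regular[OF open_sets[OF o] pos])
    have "compactin X K" using K(1) compact_X by (simp add: closedin_compact_space)
    then have "\<exists>\<F>. finite \<F> \<and> \<F> \<subseteq> U ` I \<and> K \<subseteq> \<Union>\<F>"
      by (rule compactinD) (use U K(2) in auto)
    then obtain F where F: "finite F" "F \<subseteq> I" "K \<subseteq> (\<Union>i\<in>F. U i)"
      by (metis finite_subset_image)
    have "openin X (\<Union>i\<in>F. U i)" using F U by blast
    then have "measure M K \<le> measure M (\<Union>i\<in>F. U i)"
      using F(3) open_sets by (intro finite_measure_mono) auto
    then show ?thesis using F K(3) full by auto
  qed
  then obtain F where F: "\<And>n. finite (F n)" "\<And>n. F n \<subseteq> I"
    "\<And>n. 1 - 1 / real (Suc n) < measure M (\<Union>i\<in>F n. U i)" by metis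
  define D where "D = (\<Union>n. F n)"
  have D: "countable D" "D \<subseteq> I" using F unfolding D_def by (auto intro: countable_finite)
  have oD: "openin X (\<Union>i\<in>D. U i)" using D U by blast
  have "1 - measure M (\<Union>i\<in>D. U i) \<le> 0"
  proof (rule field_le_epsilon)
    fix e :: real assume "0 < e"
    then obtain n where n: "inverse (real (Suc n)) < e" using reals_Archimedean by blast
    have "measure M (\<Union>i\<in>F n. U i) \<le> measure M (\<Union>i\<in>D. U i)"
      using open_sets[OF oD] by (intro finite_measure_mono) (auto simp: D_def)
    then show "1 - measure M (\<Union>i\<in>D. U i) \<le> 0 + e" using F(3)[of n] n by (simp add: inverse_eq_divide)
  qed
  then have "measure M (\<Union>i\<in>D. U i) = 1" using prob_le_1[of "\<Union>i\<in>D. U i"] by linarith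
  then show ?thesis using that D by blast
qed

lemma supp_iff: "x \<in> supp X M \<longleftrightarrow> x \<in> topspace X \<and> (\<forall>U. openin X U \<and> x \<in> U \<longrightarrow> 0 < measure M U)"
  by (simp add: supp_def emeasure_eq_measure)

lemma supp_eq: "supp X M = topspace X - \<Union>{U. openin X U \<and> measure M U = 0}"
  by (auto simp: supp_iff zero_less_measure_iff)

lemma closedin_supp: "closedin X (supp X M)"
  unfolding supp_eq by (intro closedin_diff closedin_topspace openin_Union) auto

lemma measure_supp: "measure M (supp X M) = 1"
proof -
  let ?\<U> = "{U. openin X U \<and> measure M U = 0}"
  have o: "openin X (\<Union>?\<U>)" by (intro openin_Union) auto
  have "measure M (space M \<inter> \<Union>?\<U>) = 0"
    by (rule null_Union_open) (auto simp: Int_absorb1 open_sets dest: openin_subset)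
  moreover have "space M \<inter> \<Union>?\<U> = \<Union>?\<U>" using openin_subset[OF o] by auto
  ultimately have "measure M (\<Union>?\<U>) = 0" by (simp only:)
  then have "measure M (space M - \<Union>?\<U>) = 1" using prob_compl[OF open_sets[OF o]] by simp
  then show ?thesis by (simp add: supp_eq)
qed

end

context flow
begin

lemma act_one [simp]: "x \<in> topspace X \<Longrightarrow> \<phi> \<one> x = x"
  using fun_cong[OF id_eq_one, of x] by simp

lemma act_mult: "x \<in> topspace X \<Longrightarrow> g \<in> carrier G \<Longrightarrow> h \<in> carrier G \<Longrightarrow> \<phi> g (\<phi> h x) = \<phi> (g \<otimes> h) x"
  using composition_rule by simp

lemma subflow_orbit_closure:
  assumes x: "x \<in> topspace X"
  shows "subflow G X \<phi> (X closure_of orbit G \<phi> x)"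
proof -
  interpret group G by (rule G_group)
  have sub: "orbit G \<phi> x \<subseteq> topspace X" using x by (auto simp: orbit_def)
  have "x \<in> orbit G \<phi> x" using x by (rule orbit_refl)
  then have ne: "X closure_of orbit G \<phi> x \<noteq> {}" using closure_of_subset[OF sub] by auto
  have "\<phi> g ` (X closure_of orbit G \<phi> x) \<subseteq> X closure_of orbit G \<phi> x" if g: "g \<in> carrier G" for g
  proof -
    have "\<phi> g ` orbit G \<phi> x \<subseteq> orbit G \<phi> x"
      using g x by (auto simp: orbit_def act_mult)
    then have "X closure_of (\<phi> g ` orbit G \<phi> x) \<subseteq> X closure_of orbit G \<phi> x"
      by (rule closure_of_mono)
    then show ?thesis
      using continuous_map_image_closure_subset[OF continuous_act[OF g], of "orbit G \<phi> x"] by auto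
  qed
  then show ?thesis using ne by (simp add: subflow_def)
qed

lemma subflow_subset: "subflow G X \<phi> Y \<Longrightarrow> Y \<subseteq> topspace X"
  by (auto simp: subflow_def dest: closedin_subset)

lemma subflow_act: "subflow G X \<phi> Y \<Longrightarrow> g \<in> carrier G \<Longrightarrow> y \<in> Y \<Longrightarrow> \<phi> g y \<in> Y"
  by (auto simp: subflow_def)

lemma minimal_subflow_iff:
  "minimal_subflow G X \<phi> Y \<longleftrightarrow> subflow G X \<phi> Y \<and> (\<forall>Z. subflow G X \<phi> Z \<and> Z \<subseteq> Y \<longrightarrow> Z = Y)"
proof (cases "subflow G X \<phi> Y")
  case Y: True
  have YX: "Y \<subseteq> topspace X" using Y by (rule subflow_subset)
  have Ycl: "closedin X Y" using Y by (simp add: subflow_def)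
  have orb: "orbit G (restrict_action \<phi> Y) x = orbit G \<phi> x" if "x \<in> Y" for x
    using that by (auto simp: orbit_def restrict_action_def)
  have orbY: "orbit G \<phi> x \<subseteq> Y" if "x \<in> Y" for x
    using that subflow_act[OF Y] by (auto simp: orbit_def)
  have cl: "subtopology X Y closure_of orbit G (restrict_action \<phi> Y) x = X closure_of orbit G \<phi> x" if x: "x \<in> Y" for x
  proof -
    have "X closure_of orbit G \<phi> x \<subseteq> Y" using closure_of_minimal[OF orbY[OF x] Ycl] .
    then show ?thesis using orbY[OF x] by (auto simp: orb[OF x] closure_of_subtopology Int_absorb1)
  qed
  have "minimal_flow G (subtopology X Y) (restrict_action \<phi> Y) \<longleftrightarrow> (\<forall>x\<in>Y. X closure_of orbit G \<phi> x = Y)"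
    using YX cl by (auto simp: minimal_flow_def Int_absorb1)
  also have "\<dots> \<longleftrightarrow> (\<forall>Z. subflow G X \<phi> Z \<and> Z \<subseteq> Y \<longrightarrow> Z = Y)"
  proof (intro iffI allI impI ballI)
    fix Z assume *: "\<forall>x\<in>Y. X closure_of orbit G \<phi> x = Y" and Z: "subflow G X \<phi> Z \<and> Z \<subseteq> Y"
    then obtain z where z: "z \<in> Z" by (auto simp: subflow_def)
    have "orbit G \<phi> z \<subseteq> Z" using z subflow_act[of Z] Z by (auto simp: orbit_def)
    then have "X closure_of orbit G \<phi> z \<subseteq> Z" using Z by (intro closure_of_minimal) (auto simp: subflow_def)
    then show "Z = Y" using * z Z by auto
  next
    fix x assume *: "\<forall>Z. subflow G X \<phi> Z \<and> Z \<subseteq> Y \<longrightarrow> Z = Y" and x: "x \<in> Y"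
    show "X closure_of orbit G \<phi> x = Y"
      using * subflow_orbit_closure[of x] closure_of_minimal[OF orbY[OF x] Ycl] x YX by blast
  qed
  finally show ?thesis using Y by (simp add: minimal_subflow_def)
qed (simp add: minimal_subflow_def)

lemma uniform_measure_in_Prob:
  assumes M: "M \<in> Prob G X \<phi>" and A: "A \<in> sets M" "0 < measure M A"
    and inv: "\<And>g. g \<in> carrier G \<Longrightarrow> {x \<in> topspace X. \<phi> g x \<in> A} = A"
  shows "uniform_measure M A \<in> Prob G X \<phi>"
proof -
  interpret M: regular_prob X M using M by (rule Prob_regular_prob)
  have eA: "emeasure M A \<noteq> 0" "emeasure M A \<noteq> \<infinity>" using A(2) by (simp_all add: M.emeasure_eq_measure)
  let ?N = "uniform_measure M A"
  have N: "prob_space ?N" using eA by (rule prob_space_uniform_measure)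
  interpret N: prob_space ?N by (rule N)
  have mN: "measure ?N B = measure M (A \<inter> B) / measure M A" if "B \<in> sets M" for B
    using eA that by (rule measure_uniform_measure)
  have "regular_borel_measure X ?N"
  proof (rule regular_borel_measureI[OF N.finite_measure_axioms compact Hausdorff])
    show "sets ?N = sets (borel_of X)" by (simp add: M.sets_M)
    fix B and e :: real assume B: "B \<in> sets ?N" and e: "0 < e"
    have BM: "B \<in> sets M" using B by simp
    have "0 < e * measure M A" using e A by simp
    then obtain K where K: "closedin X K" "K \<subseteq> A \<inter> B" "measure M (A \<inter> B) - e * measure M A < measure M K"
      using M.inner_regular[of "A \<inter> B"] A BM by blast
    have "measure ?N K = measure M K / measure M A"
      using mN[OF M.closed_sets[OF K(1)]] K(2) by (simp add: Int_absorb1)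
    moreover have "(measure M (A \<inter> B) - e * measure M A) / measure M A < measure M K / measure M A"
      using K(3) A(2) by (rule divide_strict_right_mono)
    then have "measure M (A \<inter> B) / measure M A - e < measure M K / measure M A"
      using A(2) by (simp add: diff_divide_distrib)
    ultimately show "\<exists>K. closedin X K \<and> K \<subseteq> B \<and> measure ?N B - e < measure ?N K"
      using K mN[OF BM] by (intro exI[of _ K]) auto
  qed
  moreover have "distr ?N ?N (\<phi> g) = ?N" if g: "g \<in> carrier G" for g
  proof (rule measure_eqI)
    fix B assume "B \<in> sets (distr ?N ?N (\<phi> g))"
    then have B: "B \<in> sets M" by simp
    have meas: "\<phi> g \<in> measurable M M" using M g by (rule act_measurable)
    have pre: "\<phi> g -` B \<inter> space M \<in> sets M" using meas B by (rule measurable_sets)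
    have meas': "\<phi> g \<in> measurable ?N ?N"
      using meas measurable_cong_sets[of ?N M ?N M] by simp
    have "measure (distr ?N ?N (\<phi> g)) B = measure ?N (\<phi> g -` B \<inter> space ?N)"
      using B by (intro measure_distr meas') simp
    also have "\<dots> = measure M (A \<inter> (\<phi> g -` B \<inter> space M)) / measure M A"
      using mN[OF pre] by simp
    also have "A \<inter> (\<phi> g -` B \<inter> space M) = {x \<in> topspace X. \<phi> g x \<in> A \<inter> B}"
      using inv[OF g] by auto
    also have "measure M {x \<in> topspace X. \<phi> g x \<in> A \<inter> B} = measure M (A \<inter> B)"
      using A B by (intro measure_preimage_act[OF M g]) auto
    also have "\<dots> / measure M A = measure ?N B" using mN[OF B] by simp
    finally show "emeasure (distr ?N ?N (\<phi> g)) B = emeasure ?N B"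
      using N.prob_space_distr[OF meas'] by (simp add: N.emeasure_eq_measure finite_measure.emeasure_eq_measure prob_space.finite_measure)
  qed simp
  ultimately show ?thesis using N by (simp add: Prob_def)
qed

text \<open>An invariant set of intermediate measure would present \<open>M\<close> as a proper convex combination of
  its two conditional measures.\<close>

lemma ergodic_invariant_set:
  assumes M: "M \<in> Erg G X \<phi>" and A: "A \<in> sets M" "0 < measure M A"
    and inv: "\<And>g. g \<in> carrier G \<Longrightarrow> {x \<in> topspace X. \<phi> g x \<in> A} = A"
  shows "measure M A = 1"
proof (rule ccontr)
  assume ne: "measure M A \<noteq> 1"
  have MP: "M \<in> Prob G X \<phi>" using M by (simp add: Erg_def)
  interpret M: regular_prob X M using MP by (rule Prob_regular_prob)
  let ?B = "topspace X - A"
  have lt: "measure M A < 1" using ne M.prob_le_1[of A] by linarith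
  have B: "?B \<in> sets M" "measure M ?B = 1 - measure M A"
    using A(1) sets.compl_sets[OF A(1)] M.prob_compl[OF A(1)] by simp_all
  have invB: "{x \<in> topspace X. \<phi> g x \<in> ?B} = ?B" if "g \<in> carrier G" for g
  proof (rule Set.set_eqI)
    fix x
    have "x \<in> topspace X \<Longrightarrow> \<phi> g x \<in> A \<longleftrightarrow> x \<in> A" using inv[OF that] by blast
    moreover have "x \<in> topspace X \<Longrightarrow> \<phi> g x \<in> topspace X" using that by (rule act_in)
    ultimately show "x \<in> {x \<in> topspace X. \<phi> g x \<in> ?B} \<longleftrightarrow> x \<in> ?B" by blast
  qed
  have eA: "emeasure M A \<noteq> 0" "emeasure M A \<noteq> \<infinity>" "emeasure M ?B \<noteq> 0" "emeasure M ?B \<noteq> \<infinity>"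
    using A(2) B(2) lt by (simp_all add: M.emeasure_eq_measure)
  let ?M1 = "uniform_measure M A" and ?M2 = "uniform_measure M ?B"
  have m1: "measure ?M1 C = measure M (A \<inter> C) / measure M A" if "C \<in> sets M" for C
    using eA(1,2) that by (rule measure_uniform_measure)
  have m2: "measure ?M2 C = measure M (?B \<inter> C) / measure M ?B" if "C \<in> sets M" for C
    using eA(3,4) that by (rule measure_uniform_measure)
  have "?M1 \<in> Prob G X \<phi>" by (rule uniform_measure_in_Prob[OF MP A inv])
  moreover have "?M2 \<in> Prob G X \<phi>"
    by (rule uniform_measure_in_Prob[OF MP B(1) _ invB]) (use B lt in auto)
  moreover have "?M1 \<noteq> ?M2"
  proof
    assume "?M1 = ?M2"
    then have "measure ?M1 A = measure ?M2 A" by simp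
    moreover have "?B \<inter> A = {}" by auto
    ultimately show False using m1[OF A(1)] m2[OF A(1)] A(2) by simp
  qed
  moreover have "measure M C = (1 - (1 - measure M A)) * measure ?M1 C + (1 - measure M A) * measure ?M2 C"
    if "C \<in> sets (borel_of X)" for C
  proof -
    have C: "C \<in> sets M" using that by (simp add: M.sets_M)
    have "C = (A \<inter> C) \<union> (?B \<inter> C)" using sets.sets_into_space[OF C] by auto
    moreover have "measure M ((A \<inter> C) \<union> (?B \<inter> C)) = measure M (A \<inter> C) + measure M (?B \<inter> C)"
      using A B C by (intro M.finite_measure_Union) auto
    ultimately have "measure M C = measure M (A \<inter> C) + measure M (?B \<inter> C)" by simp
    then show ?thesis using m1[OF C] m2[OF C] B(2) A(2) lt by simp
  qed
  moreover have "0 < 1 - measure M A" "1 - measure M A < 1" using A(2) lt by auto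
  ultimately show False using M unfolding Erg_def by blast
qed

lemma subflow_supp:
  assumes M: "M \<in> Prob G X \<phi>"
  shows "subflow G X \<phi> (supp X M)"
proof -
  interpret M: regular_prob X M using M by (rule Prob_regular_prob)
  have "supp X M \<noteq> {}" using M.measure_supp by auto
  moreover have "\<phi> g x \<in> supp X M" if g: "g \<in> carrier G" and x: "x \<in> supp X M" for g x
    unfolding M.supp_iff
  proof (intro conjI allI impI)
    show "\<phi> g x \<in> topspace X" using x g by (simp add: M.supp_iff)
    fix U assume U: "openin X U \<and> \<phi> g x \<in> U"
    have "openin X {y \<in> topspace X. \<phi> g y \<in> U}"
      using continuous_act[OF g] U by (auto simp: continuous_map_def)
    then have "0 < measure M {y \<in> topspace X. \<phi> g y \<in> U}"
      using x U by (auto simp: M.supp_iff)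
    then show "0 < measure M U"
      using measure_preimage_act[OF M g M.open_sets] U by simp
  qed
  ultimately show ?thesis using M.closedin_supp by (auto simp: subflow_def)
qed

lemma AE_enveloping_semigroup_preimage_open:
  assumes tame: "tame G X \<phi>" and M: "M \<in> Prob G X \<phi>"
    and p: "p \<in> enveloping_semigroup G X \<phi>" and T: "openin X T" "measure M T = 1"
  shows "AE x in M. p x \<in> T"
proof -
  interpret M: regular_prob X M using M by (rule Prob_regular_prob)
  have "\<exists>K. closedin X K \<and> (\<forall>x\<in>K. p x \<in> T) \<and> measure M T - inverse (real (Suc n)) < measure M K" for n
    by (rule enveloping_semigroup_preimage_open[OF tame M p T(1), of "inverse (real (Suc n))"]) auto
  then obtain K where K: "\<And>n. closedin X (K n)" "\<And>n x. x \<in> K n \<Longrightarrow> p x \<in> T"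
    "\<And>n. measure M T - inverse (real (Suc n)) < measure M (K n)" by metis
  have KM: "(\<Union>n. K n) \<in> sets M" using K(1) M.closed_sets by auto
  have "1 - measure M (\<Union>n. K n) \<le> 0"
  proof (rule field_le_epsilon)
    fix e :: real assume "0 < e"
    then obtain n where n: "inverse (real (Suc n)) < e" using reals_Archimedean by blast
    have "measure M (K n) \<le> measure M (\<Union>n. K n)" using KM by (intro M.finite_measure_mono) auto
    then show "1 - measure M (\<Union>n. K n) \<le> 0 + e" using K(3)[of n] n T by simp
  qed
  then have "measure M (\<Union>n. K n) = 1" using M.prob_le_1[of "\<Union>n. K n"] by linarith
  then have "AE x in M. x \<in> (\<Union>n. K n)" by (rule M.AE_prob_1)
  then show ?thesis by eventually_elim (use K(2) in auto)
qed

text \<open>A Loewenheim-Skolem argument: \<open>D F n\<close> is the countable set of group elements needed to witness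
  some property of the finite set \<open>F\<close>, and \<open>H\<close> contains all witnesses for its own finite subsets.\<close>

lemma countable_closure:
  assumes D: "\<And>F n::nat. finite F \<Longrightarrow> F \<subseteq> carrier G \<Longrightarrow> countable (D F n) \<and> D F n \<subseteq> carrier G"
  obtains H where "countable H" "H \<subseteq> carrier G" "\<one> \<in> H" "\<And>g h. g \<in> H \<Longrightarrow> h \<in> H \<Longrightarrow> g \<otimes> h \<in> H"
    "\<And>F n. finite F \<Longrightarrow> F \<subseteq> H \<Longrightarrow> D F n \<subseteq> H"
proof -
  interpret group G by (rule G_group)
  define st where "st S = S \<union> (\<lambda>(g, h). g \<otimes> h) ` (S \<times> S) \<union> (\<Union>F\<in>{F. finite F \<and> F \<subseteq> S}. \<Union>n. D F n)" for S
  define H where "H k = (st ^^ k) {\<one>}" for k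
  have HS: "H (Suc k) = st (H k)" for k by (simp add: H_def)
  have H: "countable (H k) \<and> H k \<subseteq> carrier G" for k
  proof (induction k)
    case 0 then show ?case by (simp add: H_def)
  next
    case (Suc k)
    have DD: "countable (D F n) \<and> D F n \<subseteq> carrier G" if "finite F" "F \<subseteq> H k" for F n
      using D[of F n] that Suc by auto
    have "countable (\<Union>F\<in>{F. finite F \<and> F \<subseteq> H k}. \<Union>n. D F n)"
      using DD Suc by (intro countable_UN countable_Collect_finite_subset) auto
    moreover have "(\<Union>F\<in>{F. finite F \<and> F \<subseteq> H k}. \<Union>n. D F n) \<subseteq> carrier G" using DD by blast
    moreover have "(\<lambda>(g, h). g \<otimes> h) ` (H k \<times> H k) \<subseteq> carrier G" using Suc by auto
    ultimately show ?case using Suc unfolding HS st_def by auto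
  qed
  have inc: "H k \<subseteq> H (Suc k)" for k by (auto simp: HS st_def)
  have mono: "H k \<subseteq> H l" if "k \<le> l" for k l
    using lift_Suc_mono_le[of H k l] inc that by blast
  have fin: "\<exists>k. F \<subseteq> H k" if "finite F" "F \<subseteq> (\<Union>k. H k)" for F
    using that
  proof (induction F)
    case (insert x F)
    then obtain k l where "F \<subseteq> H k" "x \<in> H l" by auto
    then have "insert x F \<subseteq> H (max k l)" using mono[of k "max k l"] mono[of l "max k l"] by auto
    then show ?case by blast
  qed auto
  show ?thesis
  proof (rule that[of "\<Union>k. H k"])
    show "countable (\<Union>k. H k)" using H by auto
    show "(\<Union>k. H k) \<subseteq> carrier G" using H by auto
    have "\<one> \<in> H 0" by (simp add: H_def)
    then show "\<one> \<in> (\<Union>k. H k)" by blast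
    show "g \<otimes> h \<in> (\<Union>k. H k)" if gh: "g \<in> (\<Union>k. H k)" "h \<in> (\<Union>k. H k)" for g h
    proof -
      obtain k where "{g, h} \<subseteq> H k" using fin[of "{g, h}"] gh by auto
      then have "g \<otimes> h \<in> H (Suc k)" by (auto simp: HS st_def)
      then show ?thesis by blast
    qed
    show "D F n \<subseteq> (\<Union>k. H k)" if F: "finite F" "F \<subseteq> (\<Union>k. H k)" for F n
    proof -
      obtain k where "F \<subseteq> H k" using fin[OF F] by blast
      then have "D F n \<subseteq> H (Suc k)" using F(1) by (auto simp: HS st_def)
      then show ?thesis by blast
    qed
  qed
qed

lemma continuous_postcompose:
  assumes h: "h \<in> carrier G"
  shows "continuous_map (product_topology (\<lambda>_. X) (topspace X)) (product_topology (\<lambda>_. X) (topspace X))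
    (\<lambda>q. compose (topspace X) (\<phi> h) q)"
  unfolding continuous_map_componentwise
proof (intro conjI ballI)
  let ?P = "product_topology (\<lambda>_. X) (topspace X)"
  show "(\<lambda>q. compose (topspace X) (\<phi> h) q) ` topspace ?P \<subseteq> extensional (topspace X)"
    by (auto simp: compose_def)
  fix x assume x: "x \<in> topspace X"
  have "continuous_map ?P X (\<lambda>q. \<phi> h (q x))"
    using continuous_map_compose[OF continuous_map_product_projection[OF x, of "\<lambda>_. X"] continuous_act[OF h]]
    by (simp add: o_def)
  then show "continuous_map ?P X (\<lambda>q. compose (topspace X) (\<phi> h) q x)"
    using x by (simp add: compose_def)
qed

lemma postcompose_enveloping_semigroup:
  assumes q: "q \<in> enveloping_semigroup G X \<phi>" and h: "h \<in> carrier G"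
  shows "compose (topspace X) (\<phi> h) q \<in> enveloping_semigroup G X \<phi>"
proof -
  interpret group G by (rule G_group)
  let ?P = "product_topology (\<lambda>_. X) (topspace X)"
  have "(\<lambda>q. compose (topspace X) (\<phi> h) q) ` (\<phi> ` carrier G) \<subseteq> \<phi> ` carrier G"
  proof safe
    fix g assume g: "g \<in> carrier G"
    have "compose (topspace X) (\<phi> h) (\<phi> g) = \<phi> (h \<otimes> g)"
    proof (rule extensionalityI)
      show "\<phi> (h \<otimes> g) \<in> extensional (topspace X)" using g h by (intro act_extensional) simp
    qed (use g h in \<open>simp_all add: compose_def act_mult\<close>)
    then show "compose (topspace X) (\<phi> h) (\<phi> g) \<in> \<phi> ` carrier G" using g h by auto
  qed
  then have "?P closure_of ((\<lambda>q. compose (topspace X) (\<phi> h) q) ` (\<phi> ` carrier G)) \<subseteq> ?P closure_of (\<phi> ` carrier G)"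
    by (rule closure_of_mono)
  then show ?thesis
    using continuous_map_image_closure_subset[OF continuous_postcompose[OF h], of "\<phi> ` carrier G"] q
    unfolding enveloping_semigroup_def by auto
qed

text \<open>Let \<open>f\<close> vanish on a proper subflow \<open>Z\<close> of the support and be one at some point of the support. For
  finite \<open>F\<close>, the set \<open>W F n\<close> is a neighbourhood of \<open>Z\<close> on which \<open>f \<circ> h\<close> is small for \<open>h \<in> F\<close>, and by
  ergodicity the translates of \<open>W F n\<close> cover almost everything. A countable submonoid \<open>H\<close> is large
  enough to provide these translates, so that for almost every \<open>x\<close> the \<open>H\<close>-orbit of \<open>r x\<close> enters all
  \<open>W F n\<close> with \<open>F \<subseteq> H\<close>. Here \<open>r\<close> belongs to a minimal closed \<open>H\<close>-invariant subset \<open>R\<close> of the enveloping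
  semigroup. By compactness some \<open>q \<in> R\<close> satisfies \<open>f (h (q x)) \<le> 0\<close> for all \<open>h \<in> H\<close>. The set of such
  \<open>q\<close> is closed and invariant, hence equal to \<open>R\<close>, and therefore \<open>f (r x) \<le> 0\<close>. This contradicts that
  \<open>f (r x) > 1/2\<close> on a set of positive measure.\<close>

theorem minimal_subflow_supp_ergodic:
  assumes tame: "tame G X \<phi>" and M: "M \<in> Erg G X \<phi>"
  shows "minimal_subflow G X \<phi> (supp X M)"
proof (rule ccontr)
  interpret group G by (rule G_group)
  assume "\<not> minimal_subflow G X \<phi> (supp X M)"
  have MP: "M \<in> Prob G X \<phi>" using M by (simp add: Erg_def)
  interpret M: regular_prob X M using MP by (rule Prob_regular_prob)
  let ?P = "product_topology (\<lambda>_. X) (topspace X)"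
  obtain Z where Z: "subflow G X \<phi> Z" "Z \<subseteq> supp X M" "Z \<noteq> supp X M"
    using \<open>\<not> minimal_subflow G X \<phi> (supp X M)\<close> subflow_supp[OF MP] by (auto simp: minimal_subflow_iff)
  obtain z where z: "z \<in> Z" using Z(1) by (auto simp: subflow_def)
  obtain x1 where x1: "x1 \<in> supp X M" "x1 \<notin> Z" using Z by blast
  have "supp X M \<subseteq> topspace X" using M.closedin_supp by (rule closedin_subset)
  then have zX: "z \<in> topspace X" and x1X: "x1 \<in> topspace X" using z Z(2) x1(1) by blast+
  have Zcl: "closedin X Z" using Z by (simp add: subflow_def)
  have x1cl: "closedin X {x1}" using x1X Hausdorff by (rule_tac closedin_Hausdorff_singleton)
  obtain f :: "'a \<Rightarrow> real" where f: "continuous_map X euclideanreal f"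
    and f0: "\<And>x. x \<in> Z \<Longrightarrow> f x = 0" and f1: "\<And>x. x \<in> {x1} \<Longrightarrow> f x = 1"
  proof (rule M.Urysohn[OF Zcl x1cl])
    show "Z \<inter> {x1} = {}" using x1(2) by blast
  qed blast
  define T where "T = {x \<in> topspace X. f x \<in> {1/2<..}}"
  have T: "openin X T" unfolding T_def by (rule openin_continuous_map_preimage[OF f]) simp
  have "x1 \<in> T" using f1 x1X by (simp add: T_def)
  then have Tpos: "0 < measure M T" using x1 T by (auto simp: M.supp_iff)
  \<comment> \<open>The factor \<open>topspace X\<close> makes \<open>W {} n\<close> the whole space.\<close>
  define W where "W F n = topspace X \<inter> (\<Inter>h\<in>F. {x \<in> topspace X. f (\<phi> h x) \<in> {..<inverse (real (Suc n))}})" for F n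
  have W: "openin X (W F n)" if "finite F" "F \<subseteq> carrier G" for F n
  proof (cases "F = {}")
    case False
    have "openin X {x \<in> topspace X. f (\<phi> h x) \<in> {..<inverse (real (Suc n))}}" if "h \<in> F" for h
      using that \<open>F \<subseteq> carrier G\<close>
      by (intro openin_continuous_map_preimage[OF continuous_translate[OF f]]) auto
    then have "openin X (\<Inter>h\<in>F. {x \<in> topspace X. f (\<phi> h x) \<in> {..<inverse (real (Suc n))}})"
      using \<open>finite F\<close> False by (intro openin_Inter) blast+
    then show ?thesis unfolding W_def by (intro openin_Int openin_topspace)
  qed (simp add: W_def)
  define V where "V F n g = {x \<in> topspace X. \<phi> g x \<in> W F n}" for F n g
  have V: "openin X (V F n g)" if "finite F" "F \<subseteq> carrier G" "g \<in> carrier G" for F n g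
    unfolding V_def by (rule openin_continuous_map_preimage[OF continuous_act[OF that(3)] W[OF that(1,2)]])
  have full: "measure M (\<Union>g\<in>carrier G. V F n g) = 1" if F: "finite F" "F \<subseteq> carrier G" for F n
  proof (rule ergodic_invariant_set[OF M])
    have o: "openin X (\<Union>g\<in>carrier G. V F n g)" using V[OF F] by blast
    then show VM: "(\<Union>g\<in>carrier G. V F n g) \<in> sets M" by (rule M.open_sets)
    have "z \<in> V F n \<one>"
      using z zX f0 subflow_act[OF Z(1)] F by (auto simp: V_def W_def)
    then have "z \<in> (\<Union>g\<in>carrier G. V F n g)" by blast
    then show "0 < measure M (\<Union>g\<in>carrier G. V F n g)"
      using o z Z(2) M.supp_iff[of z] by blast
    show "{x \<in> topspace X. \<phi> g x \<in> (\<Union>g\<in>carrier G. V F n g)} = (\<Union>g\<in>carrier G. V F n g)" if g: "g \<in> carrier G" for g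
    proof (intro Set.set_eqI iffI)
      fix x assume "x \<in> {x \<in> topspace X. \<phi> g x \<in> (\<Union>g\<in>carrier G. V F n g)}"
      then obtain h where "x \<in> topspace X" "h \<in> carrier G" "\<phi> h (\<phi> g x) \<in> W F n" by (auto simp: V_def)
      then have "x \<in> V F n (h \<otimes> g)" using g by (simp add: V_def act_mult)
      then show "x \<in> (\<Union>g\<in>carrier G. V F n g)" using g \<open>h \<in> carrier G\<close> by blast
    next
      fix x assume "x \<in> (\<Union>g\<in>carrier G. V F n g)"
      then obtain h where h: "x \<in> topspace X" "h \<in> carrier G" "\<phi> h x \<in> W F n" by (auto simp: V_def)
      have "\<phi> (h \<otimes> inv g) (\<phi> g x) = \<phi> h x" using h g by (simp add: act_mult m_assoc)
      then have "\<phi> g x \<in> V F n (h \<otimes> inv g)" using h g by (simp add: V_def)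
      moreover have "h \<otimes> inv g \<in> carrier G" using h g by simp
      ultimately have "\<phi> g x \<in> (\<Union>g\<in>carrier G. V F n g)" by (rule_tac UN_I)
      then show "x \<in> {x \<in> topspace X. \<phi> g x \<in> (\<Union>g\<in>carrier G. V F n g)}" using h(1) by simp
    qed
  qed
  have "\<exists>D. countable D \<and> D \<subseteq> carrier G \<and> measure M (\<Union>g\<in>D. V F n g) = 1" if F: "finite F" "F \<subseteq> carrier G" for F n
    by (rule M.countable_subcover[OF V[OF F] full[OF F]]) auto
  then obtain D where D: "\<And>F n. finite F \<Longrightarrow> F \<subseteq> carrier G \<Longrightarrow>
      countable (D F n) \<and> D F n \<subseteq> carrier G \<and> measure M (\<Union>g\<in>D F n. V F n g) = 1"
    by metis
  obtain H where H: "countable H" "H \<subseteq> carrier G" "\<one> \<in> H" "\<And>g h. g \<in> H \<Longrightarrow> h \<in> H \<Longrightarrow> g \<otimes> h \<in> H"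
    and DH: "\<And>F n. finite F \<Longrightarrow> F \<subseteq> H \<Longrightarrow> D F n \<subseteq> H"
    by (rule countable_closure[of D]) (use D in auto)
  define \<A> where "\<A> = {C. closedin ?P C \<and> C \<noteq> {} \<and> C \<subseteq> enveloping_semigroup G X \<phi> \<and>
      (\<forall>h\<in>H. \<forall>q\<in>C. compose (topspace X) (\<phi> h) q \<in> C)}"
  have "\<exists>R\<in>\<A>. \<forall>C\<in>\<A>. C \<subseteq> R \<longrightarrow> C = R"
  proof (rule subset_Zorn_minimal[of \<A>])
    have sub: "\<phi> ` carrier G \<subseteq> topspace ?P" using act_in_self_maps by auto
    have "\<phi> \<one> \<in> enveloping_semigroup G X \<phi>"
      using closure_of_subset[OF sub] unfolding enveloping_semigroup_def by auto
    then have "enveloping_semigroup G X \<phi> \<in> \<A>"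
      using H(2) postcompose_enveloping_semigroup by (auto simp: \<A>_def enveloping_semigroup_def)
    then show "\<A> \<noteq> {}" by blast
  next
    fix \<C> assume \<C>: "\<C> \<noteq> {}" "\<C> \<subseteq> \<A>" and ch: "\<And>C D. C \<in> \<C> \<Longrightarrow> D \<in> \<C> \<Longrightarrow> C \<subseteq> D \<or> D \<subseteq> C"
    have "\<Inter>\<C> \<noteq> {}"
      by (rule compact_chain_Inter_nonempty[OF compact_self_maps \<C>(1) _ ch]) (use \<C>(2) in \<open>auto simp: \<A>_def\<close>)
    moreover have "closedin ?P (\<Inter>\<C>)" using \<C> by (intro closedin_Inter) (auto simp: \<A>_def)
    moreover have "\<Inter>\<C> \<subseteq> enveloping_semigroup G X \<phi>" using \<C> by (auto simp: \<A>_def)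
    moreover have "\<forall>h\<in>H. \<forall>q\<in>\<Inter>\<C>. compose (topspace X) (\<phi> h) q \<in> \<Inter>\<C>" using \<C>(2) by (auto simp: \<A>_def)
    ultimately show "\<Inter>\<C> \<in> \<A>" by (simp add: \<A>_def)
  next
    fix R assume "R \<in> \<A>" "\<And>N. N \<in> \<A> \<Longrightarrow> N \<subseteq> R \<Longrightarrow> N = R"
    then show ?thesis by blast
  qed
  then obtain R where R: "R \<in> \<A>" and Rmin: "\<And>C. C \<in> \<A> \<Longrightarrow> C \<subseteq> R \<Longrightarrow> C = R" by blast
  have Rcl: "closedin ?P R" and RE: "R \<subseteq> enveloping_semigroup G X \<phi>"
    and RH: "\<And>h q. h \<in> H \<Longrightarrow> q \<in> R \<Longrightarrow> compose (topspace X) (\<phi> h) q \<in> R"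
    using R by (auto simp: \<A>_def)
  obtain r where r: "r \<in> R" using R by (auto simp: \<A>_def)
  have rE: "r \<in> enveloping_semigroup G X \<phi>" using r RE by blast
  have "AE x in M. \<forall>F\<in>{F. finite F \<and> F \<subseteq> H}. \<forall>n\<in>UNIV. r x \<in> (\<Union>g\<in>D F n. V F n g)"
  proof (intro AE_ball_countable[THEN iffD2] ballI countable_Collect_finite_subset H(1))
    fix F and n :: nat assume "F \<in> {F. finite F \<and> F \<subseteq> H}"
    then have F: "finite F" "F \<subseteq> carrier G" using H by auto
    have "openin X (\<Union>g\<in>D F n. V F n g)" using V[OF F] D[OF F] by blast
    then show "AE x in M. r x \<in> (\<Union>g\<in>D F n. V F n g)"
      using D[OF F] by (intro AE_enveloping_semigroup_preimage_open[OF tame MP rE]) auto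
  qed simp
  moreover obtain K where K: "closedin X K" "\<And>x. x \<in> K \<Longrightarrow> r x \<in> T" "measure M T - measure M T < measure M K"
    by (rule enveloping_semigroup_preimage_open[OF tame MP rE T Tpos]) blast
  ultimately obtain x where x: "x \<in> K"
    and rx: "\<And>F n. finite F \<Longrightarrow> F \<subseteq> H \<Longrightarrow> r x \<in> (\<Union>g\<in>D F n. V F n g)"
    using M.AE_witness[OF _ M.closed_sets[OF K(1)]] by (metis (mono_tags, lifting) UNIV_I diff_self mem_Collect_eq)
  have xX: "x \<in> topspace X" using x closedin_subset[OF K(1)] by blast
  have qxX: "q x \<in> topspace X" if "q \<in> R" for q
    using closedin_subset[OF Rcl] that xX by (auto simp: PiE_iff)
  define e where "e = from_nat_into H"
  have e: "range e = H" unfolding e_def using H by (intro range_from_nat_into) auto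
  have evc: "continuous_map ?P euclideanreal (\<lambda>q. f (\<phi> h (q x)))" if "h \<in> carrier G" for h
    using continuous_map_compose[OF continuous_map_product_projection[OF xX, of "\<lambda>_. X"] continuous_translate[OF f that]]
    by (simp add: o_def)
  define Q where "Q c I = R \<inter> (\<Inter>h\<in>I. {q \<in> topspace ?P. f (\<phi> h (q x)) \<in> {..c}})" for c I
  have Q: "closedin ?P (Q c I)" if I: "I \<noteq> {}" "I \<subseteq> H" for c I
  proof -
    have "closedin ?P {q \<in> topspace ?P. f (\<phi> h (q x)) \<in> {..c}}" if "h \<in> I" for h
      by (rule closedin_continuous_map_preimage[OF evc]) (use that I H(2) in auto)
    then have "closedin ?P (\<Inter>h\<in>I. {q \<in> topspace ?P. f (\<phi> h (q x)) \<in> {..c}})"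
      using I(1) by (intro closedin_Inter) blast+
    then show ?thesis unfolding Q_def by (intro closedin_Int Rcl)
  qed
  have Qiff: "q \<in> Q c I \<longleftrightarrow> q \<in> R \<and> (\<forall>h\<in>I. f (\<phi> h (q x)) \<le> c)" for q c I
    using closedin_subset[OF Rcl] by (auto simp: Q_def)
  have Qmono: "Q c I \<subseteq> Q c' I'" if "c \<le> c'" "I' \<subseteq> I" for c c' I I'
  proof
    fix q assume "q \<in> Q c I"
    then have "q \<in> R" "\<And>h. h \<in> I' \<Longrightarrow> f (\<phi> h (q x)) \<le> c" using that(2) by (auto simp: Qiff)
    then show "q \<in> Q c' I'" using order_trans[OF _ that(1)] by (auto simp: Qiff)
  qed
  \<comment> \<open>These sets decrease to the set \<open>Q 0 H\<close>, because \<open>e\<close> enumerates \<open>H\<close>.\<close>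
  define C where "C n = Q (inverse (real (Suc n))) (e ` {..n})" for n
  have eH: "e ` {..n} \<subseteq> H" for n using e by auto
  have Cne: "C n \<noteq> {}" for n
  proof -
    obtain g where g: "g \<in> D (e ` {..n}) n" "r x \<in> V (e ` {..n}) n g"
      using rx[of "e ` {..n}" n] eH by auto
    have gH: "g \<in> H" using DH[of "e ` {..n}" n] eH g by auto
    have "compose (topspace X) (\<phi> g) r \<in> C n"
      using RH[OF gH r] g(2) xX by (auto simp: C_def Qiff V_def W_def compose_def intro: less_imp_le)
    then show ?thesis by blast
  qed
  have "decseq C"
    unfolding decseq_Suc_iff C_def
  proof (intro allI Qmono)
    fix n
    show "inverse (real (Suc (Suc n))) \<le> inverse (real (Suc n))" by (simp add: field_simps)
  qed auto
  then have "(\<Inter>n. C n) \<noteq> {}"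
  proof (intro compact_space_imp_nest[OF compact_self_maps])
    show "closedin ?P (C n)" for n unfolding C_def using eH by (intro Q) auto
  qed (use Cne in auto)
  then obtain q where q: "\<And>n. q \<in> C n" by blast
  have "f (\<phi> h (q x)) \<le> 0" if "h \<in> H" for h
  proof (rule field_le_epsilon)
    fix d :: real assume "0 < d"
    then obtain n where n: "inverse (real (Suc n)) < d" using reals_Archimedean by blast
    have "h \<in> range e" using that e by simp
    then obtain i where i: "h = e i" by blast
    have "f (\<phi> h (q x)) \<le> inverse (real (Suc (max i n)))"
      using q[of "max i n"] i by (auto simp: C_def Qiff)
    also have "\<dots> \<le> inverse (real (Suc n))" by (simp add: field_simps)
    finally show "f (\<phi> h (q x)) \<le> 0 + d" using n by simp
  qed
  then have qQ: "q \<in> Q 0 H" using q[of 0] by (auto simp: C_def Qiff)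
  have "Q 0 H \<in> \<A>"
    unfolding \<A>_def
  proof (intro CollectI conjI ballI)
    show "closedin ?P (Q 0 H)" using H(3) by (intro Q) auto
    show "Q 0 H \<noteq> {}" using qQ by blast
    show "Q 0 H \<subseteq> enveloping_semigroup G X \<phi>" using RE by (auto simp: Qiff)
    fix h q assume hq: "h \<in> H" "q \<in> Q 0 H"
    then have qR: "q \<in> R" by (simp add: Qiff)
    have "f (\<phi> h' (\<phi> h (q x))) \<le> 0" if h': "h' \<in> H" for h'
    proof -
      have "\<phi> h' (\<phi> h (q x)) = \<phi> (h' \<otimes> h) (q x)"
        using qxX[OF qR] hq(1) h' H(2) by (auto intro: act_mult)
      then show ?thesis using hq H(4)[OF h' hq(1)] by (simp add: Qiff)
    qed
    then show "compose (topspace X) (\<phi> h) q \<in> Q 0 H"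
      using RH[OF hq(1) qR] xX by (simp add: Qiff compose_def)
  qed
  moreover have "Q 0 H \<subseteq> R" unfolding Q_def by (rule Int_lower1)
  ultimately have "Q 0 H = R" by (rule Rmin)
  then have "r \<in> Q 0 H" using r by simp
  then have "f (\<phi> \<one> (r x)) \<le> 0" using H(3) unfolding Qiff by blast
  then have "f (r x) \<le> 0" using qxX[OF r] by simp
  moreover have "1/2 < f (r x)" using K(2)[OF x] by (simp add: T_def)
  ultimately show False by simp
qed

end

section \<open>Averages of translates\<close>

text \<open>The averages are the dyadic convex combinations of translates of \<open>f\<close>; closure under midpoints is
  all that the least norm argument needs. Along with the average \<open>h\<close> the relation records
  the finitely additive probability \<open>w\<close> on \<open>C\<close> given by its coefficients.\<close>

inductive translate_average ::
    "'g set \<Rightarrow> ('g \<Rightarrow> 'a \<Rightarrow> 'a) \<Rightarrow> ('a \<Rightarrow> real) \<Rightarrow> ('a \<Rightarrow> real) \<Rightarrow> ('g set \<Rightarrow> real) \<Rightarrow> bool"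
  for C \<phi> f where
  translate: "g \<in> C \<Longrightarrow> translate_average C \<phi> f (\<lambda>x. f (\<phi> g x)) (indicator {S. g \<in> S})"
| midpoint: "translate_average C \<phi> f h w \<Longrightarrow> translate_average C \<phi> f h' w' \<Longrightarrow>
    translate_average C \<phi> f (\<lambda>x. (h x + h' x) / 2) (\<lambda>S. (w S + w' S) / 2)"

lemma translate_average_weight:
  assumes "translate_average C \<phi> f h w"
  shows "0 \<le> w S" "w S \<le> 1" "w S = w (S \<inter> T) + w (S - T)" "S \<inter> C = {} \<Longrightarrow> w S = 0"
proof -
  have "(\<forall>S. 0 \<le> w S \<and> w S \<le> 1 \<and> (S \<inter> C = {} \<longrightarrow> w S = 0)) \<and> (\<forall>S T. w S = w (S \<inter> T) + w (S - T))"
    using assms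
  proof induction
    case (translate g)
    then show ?case by (auto simp: indicator_def)
  next
    case (midpoint h w h' w')
    have "(w S + w' S) / 2 = (w (S \<inter> T) + w' (S \<inter> T)) / 2 + (w (S - T) + w' (S - T)) / 2" for S T
      using midpoint.IH(1)[THEN conjunct2, rule_format, of S T]
        midpoint.IH(2)[THEN conjunct2, rule_format, of S T] by (simp add: field_simps)
    moreover have "0 \<le> (w S + w' S) / 2 \<and> (w S + w' S) / 2 \<le> 1 \<and> (S \<inter> C = {} \<longrightarrow> (w S + w' S) / 2 = 0)" for S
      using midpoint.IH(1)[THEN conjunct1, rule_format, of S]
        midpoint.IH(2)[THEN conjunct1, rule_format, of S] by auto
    ultimately show ?case by auto
  qed
  then show "0 \<le> w S" "w S \<le> 1" "w S = w (S \<inter> T) + w (S - T)" "S \<inter> C = {} \<Longrightarrow> w S = 0"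
    by blast+
qed

context flow
begin

abbreviation "average \<equiv> translate_average (carrier G) \<phi>"

lemma average_continuous:
  assumes f: "continuous_map X euclideanreal f" and h: "average f h w"
  shows "continuous_map X euclideanreal h"
  using h
proof induction
  case (translate g)
  then show ?case by (rule continuous_translate[OF f])
next
  case (midpoint h w h' w')
  then show ?case by (intro continuous_intros) auto
qed

lemma average_range:
  assumes f: "\<And>x. x \<in> topspace X \<Longrightarrow> f x \<in> {0..1}" and h: "average f h w" and x: "x \<in> topspace X"
  shows "h x \<in> {0..1}"
  using h
proof induction
  case (translate g)
  then show ?case using f x by simp
qed auto

lemma average_translate:
  assumes h: "average f h w" and g: "g \<in> carrier G"
  obtains h' w' where "average f h' w'" "\<And>x. x \<in> topspace X \<Longrightarrow> h' x = h (\<phi> g x)"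
proof -
  interpret group G by (rule G_group)
  have "\<exists>h' w'. average f h' w' \<and> (\<forall>x\<in>topspace X. h' x = h (\<phi> g x))"
    using h
  proof induction
    case (translate a)
    then have "average f (\<lambda>x. f (\<phi> (a \<otimes> g) x)) (indicator {S. a \<otimes> g \<in> S})"
      using g by (intro translate_average.translate) simp
    moreover have "\<forall>x\<in>topspace X. f (\<phi> (a \<otimes> g) x) = f (\<phi> a (\<phi> g x))"
      using translate g by (simp add: act_mult)
    ultimately show ?case by blast
  next
    case (midpoint h w h' w')
    then obtain k v k' v' where "average f k v" "\<forall>x\<in>topspace X. k x = h (\<phi> g x)"
      "average f k' v'" "\<forall>x\<in>topspace X. k' x = h' (\<phi> g x)" by blast
    then have "average f (\<lambda>x. (k x + k' x) / 2) (\<lambda>S. (v S + v' S) / 2)"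
      "\<forall>x\<in>topspace X. (k x + k' x) / 2 = (h (\<phi> g x) + h' (\<phi> g x)) / 2"
      by (auto intro: translate_average.midpoint)
    then show ?case by blast
  qed
  then show ?thesis using that by blast
qed

lemma integral_act:
  fixes u :: "'a \<Rightarrow> real"
  assumes M: "M \<in> Prob G X \<phi>" and g: "g \<in> carrier G" and u: "u \<in> borel_measurable M"
  shows "(\<integral>x. u (\<phi> g x) \<partial>M) = (\<integral>x. u x \<partial>M)"
  using integral_distr[OF act_measurable[OF M g] u] M g by (simp add: Prob_def)

lemma integral_average:
  assumes M: "M \<in> Prob G X \<phi>" and f: "continuous_map X euclideanreal f"
    and f01: "\<And>x. x \<in> topspace X \<Longrightarrow> f x \<in> {0..1}" and h: "average f h w"
  shows "(\<integral>x. h x \<partial>M) = (\<integral>x. f x \<partial>M)"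
  using h
proof induction
  interpret M: regular_prob X M using M by (rule Prob_regular_prob)
  case (translate g)
  then show ?case by (intro integral_act[OF M] M.continuous_measurable f)
next
  interpret M: regular_prob X M using M by (rule Prob_regular_prob)
  have int: "integrable M h" if "average f h w" for h w
    using average_range[OF f01 that] average_continuous[OF f that]
    by (intro M.integrable_const_bound[where B = 1] M.continuous_measurable) auto
  case (midpoint h w h' w')
  then show ?case using int by simp
qed

end

text \<open>A substitute for the Cauchy-Schwarz inequality: integrate \<open>\<bar>u\<bar> \<le> u\<^sup>2 / (2 * d) + d / 2\<close>.\<close>

lemma (in prob_space) L1_le_L2:
  fixes u :: "'a \<Rightarrow> real"
  assumes u: "integrable M u" "integrable M (\<lambda>x. (u x)\<^sup>2)" and d: "0 < d" and le: "(\<integral>x. (u x)\<^sup>2 \<partial>M) \<le> d\<^sup>2"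
  shows "(\<integral>x. \<bar>u x\<bar> \<partial>M) \<le> d"
proof -
  have pt: "\<bar>t\<bar> \<le> t\<^sup>2 / (2 * d) + d / 2" for t :: real
  proof -
    have "0 \<le> (\<bar>t\<bar> - d)\<^sup>2" by simp
    then have "2 * \<bar>t\<bar> * d \<le> t\<^sup>2 + d\<^sup>2" by (simp add: power2_diff)
    then show ?thesis using d by (simp add: field_simps power2_eq_square)
  qed
  have "(\<integral>x. \<bar>u x\<bar> \<partial>M) \<le> (\<integral>x. (u x)\<^sup>2 / (2 * d) + d / 2 \<partial>M)"
    using u by (intro integral_mono pt) auto
  also have "\<dots> = (\<integral>x. (u x)\<^sup>2 \<partial>M) / (2 * d) + d / 2"
    using u by (simp add: prob_space)
  also have "\<dots> \<le> d\<^sup>2 / (2 * d) + d / 2" using le d by (simp add: divide_right_mono)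
  also have "\<dots> = d" using d by (simp add: power2_eq_square)
  finally show ?thesis .
qed

lemma (in prob_space) L1_Cauchy_limit:
  fixes s :: "nat \<Rightarrow> 'a \<Rightarrow> real"
  assumes meas: "\<And>n. s n \<in> borel_measurable M" and s01: "\<And>n x. x \<in> space M \<Longrightarrow> s n x \<in> {0..1}"
    and conv: "AE x in M. convergent (\<lambda>n. s n x)"
  defines "l \<equiv> \<lambda>x. lim (\<lambda>n. s n x)"
  shows "integrable M l" "(\<lambda>n. \<integral>x. \<bar>s n x - l x\<bar> \<partial>M) \<longlonglongrightarrow> 0"
proof -
  have lm [measurable]: "l \<in> borel_measurable M"
    unfolding l_def using meas by (rule borel_measurable_lim_metric)
  note meas [measurable]
  have ae: "AE x in M. (\<lambda>n. s n x) \<longlonglongrightarrow> l x"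
    using conv unfolding l_def by eventually_elim (simp add: convergent_LIMSEQ_iff)
  have "AE x in M. l x \<in> {0..1}"
    using ae AE_space
  proof eventually_elim
    case (elim x)
    then show ?case using s01[OF elim(2)]
      by (auto intro: LIMSEQ_le_const[OF elim(1)] LIMSEQ_le_const2[OF elim(1)])
  qed
  then have lb: "AE x in M. norm (l x) \<le> 1" by eventually_elim auto
  then show "integrable M l" by (rule integrable_const_bound) simp
  have "(\<lambda>n. \<integral>x. \<bar>s n x - l x\<bar> \<partial>M) \<longlonglongrightarrow> (\<integral>x. 0 \<partial>M)"
  proof (rule integral_dominated_convergence[where w = "\<lambda>_. 2"])
    show "AE x in M. (\<lambda>n. \<bar>s n x - l x\<bar>) \<longlonglongrightarrow> 0"
      using ae
    proof eventually_elim
      case (elim x)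
      then have "(\<lambda>n. s n x - l x) \<longlonglongrightarrow> 0" by (simp add: LIM_zero)
      then show ?case by (rule tendsto_rabs_zero)
    qed
    show "AE x in M. norm \<bar>s n x - l x\<bar> \<le> 2" for n
      using lb AE_space
    proof eventually_elim
      case (elim x)
      then show ?case using s01[OF elim(2), of n] by auto
    qed
  qed auto
  then show "(\<lambda>n. \<integral>x. \<bar>s n x - l x\<bar> \<partial>M) \<longlonglongrightarrow> 0" by simp
qed

context flow
begin

text \<open>The mean ergodic theorem in the form of Alaoglu and Birkhoff: averages whose \<open>L\<^sup>2\<close>-norm approaches
  the infimum \<open>I\<close> form a Cauchy sequence by the parallelogram identity, and the limit is invariant since
  a translate of a nearly minimal average is again a nearly minimal average. Summing the squared norms for \<open>M\<close>
  and \<open>N\<close> yields the same averages and the same limit for both measures.\<close>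

lemma mean_ergodic_averages:
  assumes M: "M \<in> Prob G X \<phi>" and N: "N \<in> Prob G X \<phi>"
    and f: "continuous_map X euclideanreal f" and f01: "\<And>x. x \<in> topspace X \<Longrightarrow> f x \<in> {0..1}"
  obtains h w \<psi> where "\<And>n::nat. average f (h n) (w n)"
    "\<And>P. P \<in> {M, N} \<Longrightarrow> integrable P \<psi>"
    "\<And>P. P \<in> {M, N} \<Longrightarrow> (\<lambda>n. \<integral>x. \<bar>h n x - \<psi> x\<bar> \<partial>P) \<longlonglongrightarrow> 0"
    "\<And>P g. P \<in> {M, N} \<Longrightarrow> g \<in> carrier G \<Longrightarrow> AE x in P. \<psi> (\<phi> g x) = \<psi> x"
proof -
  interpret M: regular_prob X M using M by (rule Prob_regular_prob)
  interpret N: regular_prob X N using N by (rule Prob_regular_prob)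
  interpret group G by (rule G_group)
  have PProb: "P \<in> Prob G X \<phi>" "regular_prob X P" if "P \<in> {M, N}" for P
    using that M N M.regular_prob_axioms N.regular_prob_axioms by auto
  have meas: "h \<in> borel_measurable P" if "average f h w" "P \<in> {M, N}" for h w P
    using average_continuous[OF f that(1)] regular_prob.continuous_measurable[OF PProb(2)[OF that(2)]] by blast
  have rng: "h x \<in> {0..1}" if "average f h w" "x \<in> topspace X" for h w x
    using f01 that by (rule average_range)
  have bint: "integrable P u" if u: "u \<in> borel_measurable P" "\<And>x. x \<in> topspace X \<Longrightarrow> \<bar>u x\<bar> \<le> 1" and P: "P \<in> {M, N}" for P and u :: "'a \<Rightarrow> real"
  proof -
    interpret P: regular_prob X P using P by (rule PProb)
    show ?thesis using u by (intro P.integrable_const_bound[where B = 1]) auto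
  qed
  have int: "integrable P h" "integrable P (\<lambda>x. (h x)\<^sup>2)" if "average f h w" "P \<in> {M, N}" for h w P
    using meas[OF that] rng[OF that(1)] that(2) by (auto intro!: bint simp: power_le_one)
  have intd: "integrable P (\<lambda>x. h x - h' x)" "integrable P (\<lambda>x. (h x - h' x)\<^sup>2)" if "average f h w" "average f h' w'" "P \<in> {M, N}" for h w h' w' P
  proof -
    have b: "\<bar>h x - h' x\<bar> \<le> 1" if x: "x \<in> topspace X" for x
      using rng[OF \<open>average f h w\<close> x] rng[OF \<open>average f h' w'\<close> x] by auto
    have m: "h \<in> borel_measurable P" "h' \<in> borel_measurable P" using meas that by blast+
    show "integrable P (\<lambda>x. h x - h' x)" using m b that(3) by (intro bint) auto
    show "integrable P (\<lambda>x. (h x - h' x)\<^sup>2)"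
      using m b that(3) by (intro bint) (auto simp: abs_square_le_1)
  qed
  define J where "J h = (\<integral>x. (h x)\<^sup>2 \<partial>M) + (\<integral>x. (h x)\<^sup>2 \<partial>N)" for h :: "'a \<Rightarrow> real"
  define I where "I = Inf {J h |h. \<exists>w. average f h w}"
  have bdd: "bdd_below {J h |h. \<exists>w. average f h w}"
    by (rule bdd_belowI[of _ 0]) (auto simp: J_def)
  have I_le: "I \<le> J h" if "average f h w" for h w
    unfolding I_def using that bdd by (intro cInf_lower) auto
  have close: "(\<integral>x. \<bar>h x - h' x\<bar> \<partial>P) \<le> d"
    if h: "average f h w" "average f h' w'" and d: "0 < d" and J: "J h \<le> I + d\<^sup>2 / 4" "J h' \<le> I + d\<^sup>2 / 4" and P: "P \<in> {M, N}"
    for h w h' w' d P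
  proof -
    have par: "(\<integral>x. (h x - h' x)\<^sup>2 \<partial>P) = 2 * (\<integral>x. (h x)\<^sup>2 \<partial>P) + 2 * (\<integral>x. (h' x)\<^sup>2 \<partial>P) - 4 * (\<integral>x. ((h x + h' x) / 2)\<^sup>2 \<partial>P)"
      if P: "P \<in> {M, N}" for P
    proof -
      \<comment> \<open>The parallelogram identity; \<open>(h + h') / 2\<close> is an average, so its norm is at least \<open>I\<close>.\<close>
      have pt: "(h x - h' x)\<^sup>2 = 2 * (h x)\<^sup>2 + 2 * (h' x)\<^sup>2 - 4 * ((h x + h' x) / 2)\<^sup>2" for x
        by (simp add: power2_eq_square field_simps)
      show ?thesis
        unfolding pt using int(2)[OF h(1) P] int(2)[OF h(2) P] int(2)[OF translate_average.midpoint[OF h] P] by simp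
    qed
    have "(\<integral>x. (h x - h' x)\<^sup>2 \<partial>M) + (\<integral>x. (h x - h' x)\<^sup>2 \<partial>N) = 2 * J h + 2 * J h' - 4 * J (\<lambda>x. (h x + h' x) / 2)"
      unfolding J_def using par[of M] par[of N] by simp
    also have "\<dots> \<le> d\<^sup>2" using J I_le[OF translate_average.midpoint[OF h]] by simp
    finally have sum: "(\<integral>x. (h x - h' x)\<^sup>2 \<partial>M) + (\<integral>x. (h x - h' x)\<^sup>2 \<partial>N) \<le> d\<^sup>2" .
    have "0 \<le> (\<integral>x. (h x - h' x)\<^sup>2 \<partial>M)" "0 \<le> (\<integral>x. (h x - h' x)\<^sup>2 \<partial>N)" by simp_all
    then have "(\<integral>x. (h x - h' x)\<^sup>2 \<partial>M) \<le> d\<^sup>2" "(\<integral>x. (h x - h' x)\<^sup>2 \<partial>N) \<le> d\<^sup>2"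
      using sum by linarith+
    then have "(\<integral>x. (h x - h' x)\<^sup>2 \<partial>P) \<le> d\<^sup>2" using P by blast
    then show ?thesis
      using prob_space.L1_le_L2[OF _ intd[OF h P] d] PProb(2)[OF P] by (simp add: regular_prob_def)
  qed
  have one: "\<one> \<in> carrier G" by simp
  have "\<exists>h w. average f h w \<and> J h < I + inverse (real (Suc n))" for n
  proof -
    have ne: "{J h |h. \<exists>w. average f h w} \<noteq> {}" using translate_average.translate[OF one] by blast
    show ?thesis
      using cInf_lessD[OF ne, of "I + inverse (real (Suc n))"] by (auto simp: I_def)
  qed
  then obtain h w where hw: "\<And>n. average f (h n) (w n)" and Jh: "\<And>n. J (h n) < I + inverse (real (Suc n))"
    by metis
  have small: "\<exists>K. \<forall>n\<ge>K. J (h n) \<le> I + d\<^sup>2 / 4" if d: "0 < d" for d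
  proof -
    have "0 < d\<^sup>2 / 4" using d by simp
    then obtain K where K: "inverse (real (Suc K)) < d\<^sup>2 / 4" using reals_Archimedean by blast
    have "J (h n) \<le> I + d\<^sup>2 / 4" if "K \<le> n" for n
    proof -
      have "inverse (real (Suc n)) \<le> inverse (real (Suc K))" using that by (simp add: field_simps)
      then show ?thesis using Jh[of n] K by linarith
    qed
    then show ?thesis by blast
  qed
  have Cauchy: "\<exists>K. \<forall>i\<ge>K. \<forall>j\<ge>K. (\<integral>x. norm (h i x - h j x) \<partial>P) < e" if e: "0 < e" and P: "P \<in> {M, N}" for e P
  proof -
    obtain K where K: "\<And>n. K \<le> n \<Longrightarrow> J (h n) \<le> I + (e / 2)\<^sup>2 / 4" using small[of "e / 2"] e by auto
    have "(\<integral>x. norm (h i x - h j x) \<partial>P) < e" if "K \<le> i" "K \<le> j" for i j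
      using close[OF hw[of i] hw[of j] _ K[OF that(1)] K[OF that(2)] P] e by simp
    then show ?thesis by blast
  qed
  obtain r where r: "strict_mono r" and rM: "AE x in M. Cauchy (\<lambda>i. h (r i) x)"
    using cauchy_L1_AE_cauchy_subseq[of M h] int(1)[OF hw] Cauchy by blast
  have "\<exists>K. \<forall>i\<ge>K. \<forall>j\<ge>K. (\<integral>x. norm (h (r i) x - h (r j) x) \<partial>N) < e" if e: "0 < e" for e
  proof -
    obtain K where K: "\<And>i j. K \<le> i \<Longrightarrow> K \<le> j \<Longrightarrow> (\<integral>x. norm (h i x - h j x) \<partial>N) < e"
      using Cauchy[OF e, of N] by blast
    have "K \<le> r i" if "K \<le> i" for i using seq_suble[OF r, of i] that by linarith
    then show ?thesis using K by blast
  qed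
  then obtain r' where r': "strict_mono r'" and rN: "AE x in N. Cauchy (\<lambda>i. h (r (r' i)) x)"
    using cauchy_L1_AE_cauchy_subseq[of N "\<lambda>i. h (r i)"] int(1)[OF hw] by blast
  define t where "t = r \<circ> r'"
  have t: "strict_mono t" unfolding t_def using r r' by (rule strict_mono_o)
  have rM': "AE x in M. Cauchy (\<lambda>i. h (t i) x)"
    using rM
  proof eventually_elim
    case (elim x)
    then show ?case using Cauchy_subseq_Cauchy[OF elim r'] by (simp add: o_def t_def)
  qed
  have conv: "AE x in P. convergent (\<lambda>i. h (t i) x)" if "P \<in> {M, N}" for P
    using rM' rN that by (auto simp: Cauchy_convergent_iff t_def)
  define \<psi> where "\<psi> x = lim (\<lambda>i. h (t i) x)" for x
  have psi: "integrable P \<psi>" "(\<lambda>n. \<integral>x. \<bar>h (t n) x - \<psi> x\<bar> \<partial>P) \<longlonglongrightarrow> 0" if P: "P \<in> {M, N}" for P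
  proof -
    interpret P: regular_prob X P using P by (rule PProb)
    have rng': "h (t n) x \<in> {0..1}" if "x \<in> space P" for n x
      using rng[OF hw] that by simp
    show "integrable P \<psi>" "(\<lambda>n. \<integral>x. \<bar>h (t n) x - \<psi> x\<bar> \<partial>P) \<longlonglongrightarrow> 0"
      unfolding \<psi>_def using P.L1_Cauchy_limit[OF meas[OF hw P] rng' conv[OF P]] by auto
  qed
  have inv: "AE x in P. \<psi> (\<phi> g x) = \<psi> x" if P: "P \<in> {M, N}" and g: "g \<in> carrier G" for P g
  proof -
    interpret P: regular_prob X P using P by (rule PProb)
    have psim [measurable]: "\<psi> \<in> borel_measurable P" using psi(1)[OF P] by simp
    have am [measurable]: "\<phi> g \<in> measurable P P" by (rule act_measurable[OF PProb(1)[OF P] g])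
    have hm [measurable]: "h n \<in> borel_measurable P" for n by (rule meas[OF hw P])
    have inv_int: "integrable P (\<lambda>x. u (\<phi> g x))" if "integrable P u" for u :: "'a \<Rightarrow> real"
    proof -
      have "integrable (distr P P (\<phi> g)) u" using that PProb(1)[OF P] g by (simp add: Prob_def)
      then show ?thesis using that by (subst (asm) integrable_distr_eq) auto
    qed
    have i1: "integrable P (\<lambda>x. \<bar>h n x - \<psi> x\<bar>)" for n
      using int(1)[OF hw P] psi(1)[OF P] by auto
    have i2: "integrable P (\<lambda>x. \<bar>h n (\<phi> g x) - \<psi> (\<phi> g x)\<bar>)" for n using inv_int[OF i1[of n]] .
    have i3: "integrable P (\<lambda>x. \<bar>h n (\<phi> g x) - h n x\<bar>)" for n
      using inv_int[OF int(1)[OF hw[of n] P]] int(1)[OF hw[of n] P] by auto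
    have i4: "integrable P (\<lambda>x. \<bar>\<psi> (\<phi> g x) - \<psi> x\<bar>)"
      using inv_int[OF psi(1)[OF P]] psi(1)[OF P] by auto
    have "(\<integral>x. \<bar>\<psi> (\<phi> g x) - \<psi> x\<bar> \<partial>P) \<le> 0"
    proof (rule field_le_epsilon)
      fix e :: real assume "0 < e"
      then have e4: "0 < e / 4" by simp
      obtain K where K: "\<And>n. K \<le> n \<Longrightarrow> J (h n) \<le> I + (e / 4)\<^sup>2 / 4" using small[OF e4] by blast
      have "eventually (\<lambda>n. (\<integral>x. \<bar>h (t n) x - \<psi> x\<bar> \<partial>P) < e / 4) sequentially"
        using psi(2)[OF P] e4 by (rule order_tendstoD(2))
      then have "eventually (\<lambda>n. (\<integral>x. \<bar>h (t n) x - \<psi> x\<bar> \<partial>P) < e / 4 \<and> K \<le> n) sequentially"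
        using eventually_ge_at_top by (rule eventually_conj)
      then obtain n where n: "(\<integral>x. \<bar>h (t n) x - \<psi> x\<bar> \<partial>P) < e / 4" "K \<le> n"
        using eventually_happens'[OF sequentially_bot] by blast
      have Kt: "K \<le> t n" using seq_suble[OF t, of n] n(2) by linarith
      obtain h' w' where h': "average f h' w'" "\<And>x. x \<in> topspace X \<Longrightarrow> h' x = h (t n) (\<phi> g x)"
        using average_translate[OF hw[of "t n"] g] by blast
      have "(\<integral>x. (h' x)\<^sup>2 \<partial>Q) = (\<integral>x. (h (t n) x)\<^sup>2 \<partial>Q)" if Q: "Q \<in> {M, N}" for Q
      proof -
        interpret Q: regular_prob X Q using Q by (rule PProb)
        have "(\<integral>x. (h' x)\<^sup>2 \<partial>Q) = (\<integral>x. (h (t n) (\<phi> g x))\<^sup>2 \<partial>Q)"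
          using h'(2) by (intro Bochner_Integration.integral_cong) auto
        also have "\<dots> = (\<integral>x. (h (t n) x)\<^sup>2 \<partial>Q)"
          using meas[OF hw Q] by (intro integral_act[OF PProb(1)[OF Q] g, of "\<lambda>x. (h (t n) x)\<^sup>2"]) simp
        finally show ?thesis .
      qed
      then have "J h' = J (h (t n))" by (simp add: J_def)
      then have "(\<integral>x. \<bar>h' x - h (t n) x\<bar> \<partial>P) \<le> e / 4"
        using K[OF Kt] by (intro close[OF h'(1) hw e4 _ _ P]) auto
      moreover have "(\<integral>x. \<bar>h' x - h (t n) x\<bar> \<partial>P) = (\<integral>x. \<bar>h (t n) (\<phi> g x) - h (t n) x\<bar> \<partial>P)"
        using h'(2) by (intro Bochner_Integration.integral_cong) auto
      moreover have "(\<integral>x. \<bar>h (t n) (\<phi> g x) - \<psi> (\<phi> g x)\<bar> \<partial>P) = (\<integral>x. \<bar>h (t n) x - \<psi> x\<bar> \<partial>P)"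
        by (rule integral_act[OF PProb(1)[OF P] g, of "\<lambda>x. \<bar>h (t n) x - \<psi> x\<bar>"]) simp
      moreover have "(\<integral>x. \<bar>\<psi> (\<phi> g x) - \<psi> x\<bar> \<partial>P) \<le>
        (\<integral>x. \<bar>h (t n) (\<phi> g x) - \<psi> (\<phi> g x)\<bar> + \<bar>h (t n) (\<phi> g x) - h (t n) x\<bar> + \<bar>h (t n) x - \<psi> x\<bar> \<partial>P)"
        using i1 i2 i3 i4 by (intro integral_mono) auto
      ultimately show "(\<integral>x. \<bar>\<psi> (\<phi> g x) - \<psi> x\<bar> \<partial>P) \<le> 0 + e"
        using n(1) e4 i1[of "t n"] i2[of "t n"] i3[of "t n"] by simp
    qed
    then have "(\<integral>x. \<bar>\<psi> (\<phi> g x) - \<psi> x\<bar> \<partial>P) = 0" by (simp add: antisym)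
    then have "AE x in P. \<bar>\<psi> (\<phi> g x) - \<psi> x\<bar> = 0"
      using integral_nonneg_eq_0_iff_AE[OF i4] by simp
    then show ?thesis by eventually_elim simp
  qed
  show ?thesis
    by (rule that[of "\<lambda>n. h (t n)" "\<lambda>n. w (t n)" \<psi>]) (use hw psi inv in auto)
qed

end

section \<open>Unique ergodicity of amenable minimal subflows\<close>

locale finitely_additive =
  fixes w :: "'g set \<Rightarrow> real"
  assumes nonneg: "0 \<le> w S" and split: "w S = w (S \<inter> T) + w (S - T)"
begin

lemma mono: "S \<subseteq> T \<Longrightarrow> w S \<le> w T"
  using split[of T S] nonneg[of "T - S"] by (simp add: Int_absorb1)

lemma diff: "S \<subseteq> T \<Longrightarrow> w (T - S) = w T - w S"
  using split[of T S] by (simp add: Int_absorb1)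

lemma Un_le: "w (S \<union> T) \<le> w S + w T"
  using split[of "S \<union> T" S] mono[of "S \<union> T - S" T] by (auto simp: Int_absorb1)

lemma UN_le: "finite I \<Longrightarrow> w (\<Union>i\<in>I. S i) \<le> (\<Sum>i\<in>I. w (S i))"
proof (induction I rule: finite_induct)
  case empty
  show ?case using split[of "{}" "{}"] by simp
next
  case (insert i I)
  then show ?case using Un_le[of "S i" "\<Union>i\<in>I. S i"] by simp
qed

end

definition mean_on :: "'a measure \<Rightarrow> 'a set \<Rightarrow> ('a \<Rightarrow> real) \<Rightarrow> real" where
  "mean_on M S h = (\<integral>x. indicator S x * h x \<partial>M) / measure M S"

context prob_space
begin

lemma integrable_indicator_mult:
  fixes h :: "'a \<Rightarrow> real"
  shows "S \<in> events \<Longrightarrow> integrable M h \<Longrightarrow> integrable M (\<lambda>x. indicator S x * h x)"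
  using integrable_mult_indicator[of S M h] by simp

lemma mean_on_const:
  assumes "S \<in> events" "0 < prob S"
  shows "(\<integral>x. indicator S x * c \<partial>M) = c * prob S"
  using assms sets.sets_into_space[OF assms(1)] by (simp add: Int_absorb2)

lemma mean_on_le:
  assumes S: "S \<in> events" "0 < prob S" and h: "integrable M h" and le: "\<And>x. x \<in> S \<Longrightarrow> h x \<le> c"
  shows "mean_on M S h \<le> c"
proof -
  have "(\<integral>x. indicator S x * h x \<partial>M) \<le> (\<integral>x. indicator S x * c \<partial>M)"
    using le by (intro integral_mono integrable_indicator_mult S h) (auto simp: indicator_def)
  then have "(\<integral>x. indicator S x * h x \<partial>M) \<le> c * prob S"
    unfolding mean_on_const[OF S] .
  then show ?thesis using S(2) by (simp add: mean_on_def divide_le_eq)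
qed

lemma mean_on_ge:
  assumes S: "S \<in> events" "0 < prob S" and h: "integrable M h" and le: "\<And>x. x \<in> S \<Longrightarrow> c \<le> h x"
  shows "c \<le> mean_on M S h"
proof -
  have "(\<integral>x. indicator S x * c \<partial>M) \<le> (\<integral>x. indicator S x * h x \<partial>M)"
    using le by (intro integral_mono integrable_indicator_mult S h) (auto simp: indicator_def)
  then have "c * prob S \<le> (\<integral>x. indicator S x * h x \<partial>M)"
    unfolding mean_on_const[OF S] .
  then show ?thesis using S(2) by (simp add: mean_on_def le_divide_eq)
qed

lemma mean_on_midpoint:
  assumes "S \<in> events" "integrable M h" "integrable M h'"
  shows "mean_on M S (\<lambda>x. (h x + h' x) / 2) = (mean_on M S h + mean_on M S h') / 2"
proof -
  have "(\<integral>x. indicator S x * ((h x + h' x) / 2) \<partial>M) = (\<integral>x. (indicator S x * h x + indicator S x * h' x) / 2 \<partial>M)"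
    by (intro Bochner_Integration.integral_cong) (auto simp: field_simps)
  also have "\<dots> = ((\<integral>x. indicator S x * h x \<partial>M) + (\<integral>x. indicator S x * h' x \<partial>M)) / 2"
    using assms integrable_indicator_mult by simp
  finally show ?thesis by (simp add: mean_on_def add_divide_distrib)
qed

lemma mean_on_tendsto:
  assumes S: "S \<in> events" and h: "\<And>n. integrable M (h n)" and l: "integrable M l"
    and lim: "(\<lambda>n. \<integral>x. \<bar>h n x - l x\<bar> \<partial>M) \<longlonglongrightarrow> 0"
  shows "(\<lambda>n. mean_on M S (h n)) \<longlonglongrightarrow> mean_on M S l"
proof -
  have "(\<lambda>n. (\<integral>x. indicator S x * h n x \<partial>M) - (\<integral>x. indicator S x * l x \<partial>M)) \<longlonglongrightarrow> 0"
  proof (rule Lim_null_comparison[OF _ lim])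
    have "norm ((\<integral>x. indicator S x * h n x \<partial>M) - (\<integral>x. indicator S x * l x \<partial>M)) \<le> (\<integral>x. \<bar>h n x - l x\<bar> \<partial>M)" for n
    proof -
      have "(\<integral>x. indicator S x * h n x \<partial>M) - (\<integral>x. indicator S x * l x \<partial>M) = (\<integral>x. indicator S x * (h n x - l x) \<partial>M)"
        using integrable_indicator_mult[OF S] h l by (simp add: right_diff_distrib)
      moreover have "norm (\<integral>x. indicator S x * (h n x - l x) \<partial>M) \<le> (\<integral>x. norm (indicator S x * (h n x - l x)) \<partial>M)"
        by (rule integral_norm_bound)
      moreover have "(\<integral>x. norm (indicator S x * (h n x - l x)) \<partial>M) \<le> (\<integral>x. \<bar>h n x - l x\<bar> \<partial>M)"
        using h l integrable_indicator_mult[OF S Bochner_Integration.integrable_diff[OF h l], of n]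
        by (intro integral_mono) (auto simp: indicator_def)
      ultimately show ?thesis by (simp only: order_trans)
    qed
    then show "eventually (\<lambda>n. norm ((\<integral>x. indicator S x * h n x \<partial>M) - (\<integral>x. indicator S x * l x \<partial>M)) \<le> (\<integral>x. \<bar>h n x - l x\<bar> \<partial>M)) sequentially"
      by simp
  qed
  then have "(\<lambda>n. \<integral>x. indicator S x * h n x \<partial>M) \<longlonglongrightarrow> (\<integral>x. indicator S x * l x \<partial>M)"
    by (rule LIM_zero_cancel)
  then show ?thesis unfolding mean_on_def by (cases "measure M S = 0") (auto intro: tendsto_divide)
qed

end

text \<open>Two numbers that differ by more than \<open>d\<close> are separated by two consecutive points of the grid with
  mesh \<open>d / 3\<close>. Only finitely many levels occur, which is what a tree with constant levels requires.\<close>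

lemma gap_level:
  fixes s t d :: real
  assumes d: "0 < d" and s: "0 \<le> s" "s \<le> 1" and gap: "d < t - s" and N: "3 / d + 1 < real N"
  obtains j where "j < N" "s < real j * (d / 3)" "real (Suc j) * (d / 3) < t"
proof -
  define j where "j = nat \<lfloor>3 * s / d\<rfloor> + 1"
  have p: "0 \<le> 3 * s / d" using d s by simp
  have fl: "real (nat \<lfloor>3 * s / d\<rfloor>) \<le> 3 * s / d" "3 * s / d < real (nat \<lfloor>3 * s / d\<rfloor>) + 1"
    using p by linarith+
  have j: "real j \<le> 3 * s / d + 1" "3 * s / d < real j" using fl unfolding j_def of_nat_add of_nat_1 by linarith+
  have "3 * s / d \<le> 3 / d" using d s by (simp add: divide_right_mono)
  then have "real j < real N" using j(1) N by linarith
  moreover have "s < real j * (d / 3)" using j(2) d by (simp add: field_simps)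
  moreover have "real (Suc j) * (d / 3) < t"
  proof -
    have "real (Suc j) * (d / 3) \<le> (3 * s / d + 2) * (d / 3)"
      using j(1) d by (intro mult_right_mono) auto
    also have "\<dots> = s + 2 * d / 3" using d by (simp add: field_simps)
    finally show ?thesis using gap d by linarith
  qed
  ultimately show ?thesis using that by auto
qed

context flow
begin

definition split_set :: "('a \<Rightarrow> real) \<Rightarrow> real \<Rightarrow> real \<Rightarrow> 'a set \<Rightarrow> 'g set" where
  "split_set f a b E = {g \<in> carrier G. (\<exists>x\<in>E. f (\<phi> g x) < a) \<and> (\<exists>y\<in>E. b < f (\<phi> g y))}"

lemma split_set_mono: "E \<subseteq> F \<Longrightarrow> split_set f a b E \<subseteq> split_set f a b F"
  by (auto simp: split_set_def)

text \<open>Although every open subset of \<open>O'\<close> that meets \<open>Y\<close> is split by a set of translates of \<open>w\<close>-mass at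
  least \<open>k\<close>, two such sets of translates need not intersect. The mass decreases as the open
  set shrinks, so one can pass to an open set \<open>V\<close> that is tight: shrinking \<open>V\<close> further loses at
  most \<open>e\<close>. In a tree whose nodes at level \<open>n\<close> are tight for \<open>e n\<close>, the translates splitting
  all nodes of a level have lost at most \<open>2 ^ Suc n * e n\<close> in comparison with the level above. These losses add
  up to less than \<open>k\<close>, so a common translate always exists.\<close>

lemma no_heavy_splitting:
  assumes tame: "tame G X \<phi>" and f: "continuous_map X euclideanreal f" and ab: "a < b"
    and w: "finitely_additive w" and w0: "\<And>S. S \<inter> carrier G = {} \<Longrightarrow> w S = 0"
    and O': "openin X O'" "O' \<inter> Y \<noteq> {}" and k: "0 < k"
    and heavy: "\<And>V. openin X V \<Longrightarrow> V \<subseteq> O' \<Longrightarrow> V \<inter> Y \<noteq> {} \<Longrightarrow> k \<le> w (split_set f a b (V \<inter> Y))"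
  shows False
proof -
  interpret w: finitely_additive w by (rule w)
  define sp where "sp V = split_set f a b (V \<inter> Y)" for V
  have sp_mono: "V \<subseteq> W \<Longrightarrow> sp V \<subseteq> sp W" for V W unfolding sp_def by (intro split_set_mono) auto
  define \<V> where "\<V> = {V. openin X V \<and> V \<subseteq> O' \<and> V \<inter> Y \<noteq> {}}"
  have heavy': "k \<le> w (sp V)" if "V \<in> \<V>" for V using heavy that by (auto simp: \<V>_def sp_def)
  define tight where "tight e V \<longleftrightarrow> V \<in> \<V> \<and> (\<forall>W\<in>\<V>. W \<subseteq> V \<longrightarrow> w (sp V - sp W) \<le> e)" for e V
  have refine: "\<exists>V'\<subseteq>V. tight e V'" if V: "V \<in> \<V>" and e: "0 < e" for V e
  proof -
    let ?I = "{w (sp W) |W. W \<in> \<V> \<and> W \<subseteq> V}"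
    have bdd: "bdd_below ?I" by (rule bdd_belowI[of _ 0]) (auto simp: w.nonneg)
    have ne: "?I \<noteq> {}" using V by auto
    obtain V' where V': "V' \<in> \<V>" "V' \<subseteq> V" "w (sp V') < Inf ?I + e"
      using cInf_lessD[OF ne, of "Inf ?I + e"] e by auto
    have "w (sp V' - sp W) \<le> e" if W: "W \<in> \<V>" "W \<subseteq> V'" for W
    proof -
      have "w (sp W) \<in> ?I" using W V'(2) by blast
      then have "Inf ?I \<le> w (sp W)" using bdd by (rule cInf_lower)
      then show ?thesis using w.diff[OF sp_mono[OF W(2)]] V'(3) by simp
    qed
    then show ?thesis using V' by (auto simp: tight_def)
  qed
  \<comment> \<open>Chosen such that the loss at step \<open>n\<close> is \<open>k / 2 ^ Suc (Suc n)\<close>, which is half of the excess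
    over \<open>k / 2\<close> that the invariant \<open>P\<close> grants at level \<open>n\<close>.\<close>
  define e where "e n = k / (8 * 4 ^ n)" for n :: nat
  have e: "0 < e n" for n using k by (simp add: e_def)
  define P where "P n c \<longleftrightarrow> (\<forall>s. length s = n \<longrightarrow> tight (e n) (c s)) \<and>
      k / 2 + k / 2 ^ Suc n \<le> w (\<Inter>s\<in>{s. length s = n}. sp (c s))" for n and c :: "bool list \<Rightarrow> 'a set"
  obtain V0 where V0: "tight (e 0) V0" using refine[of O' "e 0"] O' e by (auto simp: \<V>_def)
  have V0\<V>: "V0 \<in> \<V>" using V0 by (simp add: tight_def)
  show False
  proof (rule no_independent_splitting[OF tame f ab, of P "\<lambda>_. V0"])
    show "P 0 (\<lambda>_. V0)" using V0 heavy'[OF V0\<V>] by (simp add: P_def)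
    show "c s \<noteq> {} \<and> c s \<subseteq> topspace X" if P: "P n c" "length s = n" for n c s
    proof -
      have "c s \<in> \<V>" using P by (auto simp: P_def tight_def)
      then show ?thesis using openin_subset[of X "c s"] by (auto simp: \<V>_def)
    qed
    fix n c assume P: "P n c"
    have tc: "tight (e n) (c s)" if "length s = n" for s using P that by (auto simp: P_def)
    let ?D = "\<Inter>s\<in>{s. length s = n}. sp (c s)"
    have wD: "k / 2 + k / 2 ^ Suc n \<le> w ?D" using P by (simp add: P_def)
    moreover have "0 < k / 2 + k / 2 ^ Suc n" using k by (simp add: add_pos_pos)
    ultimately have "?D \<inter> carrier G \<noteq> {}" using w0[of ?D] by auto
    then obtain g where g: "g \<in> carrier G" "\<And>s. length s = n \<Longrightarrow> g \<in> sp (c s)" by blast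
    define L where "L d = {x \<in> topspace X. f (\<phi> g x) \<in> (if d then {b<..} else {..<a})}" for d
    have L: "openin X (L d)" for d
      unfolding L_def by (rule openin_continuous_map_preimage[OF continuous_translate[OF f g(1)]]) simp
    have "\<exists>V'\<subseteq>c s \<inter> L d. tight (e (Suc n)) V'" if s: "length s = n" for s d
    proof (rule refine[OF _ e])
      have cs: "c s \<in> \<V>" using tc[OF s] by (simp add: tight_def)
      then have "c s \<subseteq> topspace X" using openin_subset by (auto simp: \<V>_def)
      then have "(c s \<inter> L d) \<inter> Y \<noteq> {}"
        using g(2)[OF s] by (cases d) (auto simp: sp_def split_set_def L_def)
      then show "c s \<inter> L d \<in> \<V>" using cs L by (auto simp: \<V>_def)
    qed
    then obtain V' where V': "\<And>s d. length s = n \<Longrightarrow> V' s d \<subseteq> c s \<inter> L d \<and> tight (e (Suc n)) (V' s d)"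
      by metis
    define c' where "c' s = V' (tl s) (hd s)" for s
    let ?T = "{t::bool list. length t = Suc n}"
    have tc': "tight (e (Suc n)) (c' t)" "c' t \<subseteq> c (tl t)" if "t \<in> ?T" for t
      using V'[of "tl t" "hd t"] that by (auto simp: c'_def)
    have loss: "w (sp (c (tl t)) - sp (c' t)) \<le> e n" if "t \<in> ?T" for t
      using tc[of "tl t"] tc'[OF that] that by (auto simp: tight_def)
    have card: "card ?T = 2 ^ Suc n"
      using card_lists_length_eq[of "UNIV :: bool set" "Suc n"] by simp
    have "w ?D \<le> w ((\<Inter>t\<in>?T. sp (c' t)) \<union> (\<Union>t\<in>?T. sp (c (tl t)) - sp (c' t)))"
      by (rule w.mono) auto
    also have "\<dots> \<le> w (\<Inter>t\<in>?T. sp (c' t)) + w (\<Union>t\<in>?T. sp (c (tl t)) - sp (c' t))"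
      by (rule w.Un_le)
    also have "w (\<Union>t\<in>?T. sp (c (tl t)) - sp (c' t)) \<le> (\<Sum>t\<in>?T. w (sp (c (tl t)) - sp (c' t)))"
      by (rule w.UN_le[OF finite_bool_lists])
    also have "\<dots> \<le> (\<Sum>t\<in>?T. e n)" using loss by (rule sum_mono)
    also have "\<dots> = 2 ^ Suc n * e n" using card by simp
    also have "\<dots> = k / 2 ^ Suc (Suc n)"
    proof -
      have "(4::real) ^ n = 2 ^ n * 2 ^ n" by (simp flip: power_mult_distrib)
      then show ?thesis by (simp add: e_def field_simps)
    qed
    finally have "w ?D \<le> w (\<Inter>t\<in>?T. sp (c' t)) + k / 2 ^ Suc (Suc n)" by simp
    moreover have "k / 2 ^ Suc n = k / 2 ^ Suc (Suc n) + k / 2 ^ Suc (Suc n)" by simp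
    ultimately have "k / 2 + k / 2 ^ Suc (Suc n) \<le> w (\<Inter>t\<in>?T. sp (c' t))" using wD by linarith
    then have "P (Suc n) c'" using tc' by (auto simp: P_def)
    moreover have "c' (False # s) \<subseteq> {x \<in> c s. f (\<phi> g x) \<le> a} \<and> c' (True # s) \<subseteq> {x \<in> c s. f (\<phi> g x) \<ge> b}"
      if "length s = n" for s
      using V'[OF that, of False] V'[OF that, of True] by (auto simp: c'_def L_def)
    ultimately show "\<exists>g\<in>carrier G. \<exists>c'. P (Suc n) c' \<and> (\<forall>s. length s = n \<longrightarrow>
       c' (False # s) \<subseteq> {x \<in> c s. f (\<phi> g x) \<le> a} \<and> c' (True # s) \<subseteq> {x \<in> c s. f (\<phi> g x) \<ge> b})"
      using g(1) by blast
  qed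
qed

text \<open>If \<open>S\<close> were null on \<open>U\<close>, then by invariance also on all translates of \<open>U\<close>, and these cover \<open>Y\<close>.\<close>

lemma invariant_set_charges_open:
  assumes Y: "minimal_subflow G X \<phi> Y" and M: "M \<in> Prob G X \<phi>" and MY: "measure M Y = 1"
    and S: "S \<in> sets M" "0 < measure M S"
    and inv: "\<And>g. g \<in> carrier G \<Longrightarrow> AE x in M. \<phi> g x \<in> S \<longleftrightarrow> x \<in> S"
    and U: "openin X U" "U \<inter> Y \<noteq> {}"
  shows "0 < measure M (S \<inter> (U \<inter> Y))"
proof (rule ccontr)
  interpret M: regular_prob X M using M by (rule Prob_regular_prob)
  have Ysub: "subflow G X \<phi> Y" using Y by (simp add: minimal_subflow_def)
  have YX: "Y \<subseteq> topspace X" using Ysub by (rule subflow_subset)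
  have YM: "Y \<in> sets M" using Ysub by (intro M.closed_sets) (simp add: subflow_def)
  have UM: "U \<in> sets M" using U(1) by (rule M.open_sets)
  have cut: "measure M (A \<inter> Y) = measure M A" if A: "A \<in> sets M" for A
  proof -
    have "measure M (A - Y) \<le> measure M (space M - Y)"
      using sets.sets_into_space[OF A] YM by (intro M.finite_measure_mono sets.compl_sets) auto
    then have "measure M (A - Y) = 0" using M.prob_compl[OF YM] MY by (simp add: measure_le_0_iff)
    then show ?thesis using M.finite_measure_Diff'[OF A YM] by simp
  qed
  assume "\<not> 0 < measure M (S \<inter> (U \<inter> Y))"
  then have "measure M ((S \<inter> U) \<inter> Y) = 0" by (simp add: zero_less_measure_iff Int_assoc)
  then have null: "measure M (S \<inter> U) = 0" using cut[of "S \<inter> U"] S UM by simp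
  let ?V = "\<lambda>g. {x \<in> topspace X. \<phi> g x \<in> U}"
  have V: "openin X (?V g) \<and> measure M (S \<inter> ?V g) = 0" if g: "g \<in> carrier G" for g
  proof
    show V: "openin X (?V g)" by (rule openin_continuous_map_preimage[OF continuous_act[OF g] U(1)])
    have "measure M (S \<inter> ?V g) = measure M {x \<in> topspace X. \<phi> g x \<in> S \<inter> U}"
    proof (rule M.finite_measure_eq_AE)
      show "AE x in M. x \<in> S \<inter> ?V g \<longleftrightarrow> x \<in> {x \<in> topspace X. \<phi> g x \<in> S \<inter> U}"
        using inv[OF g] AE_space by eventually_elim auto
      show "S \<inter> ?V g \<in> sets M" using S V M.open_sets by blast
      have "\<phi> g -` (S \<inter> U) \<inter> space M \<in> sets M"
        using act_measurable[OF M g] S UM by (intro measurable_sets) auto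
      moreover have "\<phi> g -` (S \<inter> U) \<inter> space M = {x \<in> topspace X. \<phi> g x \<in> S \<inter> U}" by auto
      ultimately show "{x \<in> topspace X. \<phi> g x \<in> S \<inter> U} \<in> sets M" by simp
    qed
    also have "\<dots> = measure M (S \<inter> U)" using S UM by (intro measure_preimage_act[OF M g]) auto
    finally show "measure M (S \<inter> ?V g) = 0" using null by simp
  qed
  have cover: "Y \<subseteq> \<Union>(?V ` carrier G)"
  proof
    fix y assume y: "y \<in> Y"
    have yX: "y \<in> topspace X" using y YX by blast
    have sub: "orbit G \<phi> y \<subseteq> Y" using y subflow_act[OF Ysub] by (auto simp: orbit_def)
    have "X closure_of orbit G \<phi> y \<subseteq> Y"
      using sub Ysub by (intro closure_of_minimal) (auto simp: subflow_def)
    then have "X closure_of orbit G \<phi> y = Y"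
      using Y subflow_orbit_closure[OF yX] by (auto simp: minimal_subflow_iff)
    then obtain u where "u \<in> U" "u \<in> X closure_of orbit G \<phi> y" using U(2) by blast
    then obtain v where "v \<in> orbit G \<phi> y" "v \<in> U" using U(1) by (auto simp: in_closure_of)
    then show "y \<in> \<Union>(?V ` carrier G)" using yX by (auto simp: orbit_def)
  qed
  have "measure M (S \<inter> \<Union>(?V ` carrier G)) = 0"
    by (rule M.null_Union_open[OF S(1)]) (use V in blast)
  moreover have "openin X (\<Union>(?V ` carrier G))" using V by (intro openin_Union) blast
  then have "measure M (S \<inter> Y) \<le> measure M (S \<inter> \<Union>(?V ` carrier G))"
    using cover S(1) M.open_sets by (intro M.finite_measure_mono) auto
  ultimately show False using cut[OF S(1)] S(2) by simp
qed

text \<open>Both sides are affine in the average, so it suffices to consider a single translate: either it has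
  a gap larger than \<open>d\<close> on \<open>E\<close>, and is counted by \<open>w\<close>, or its two means differ by at most \<open>d\<close>.\<close>

lemma average_gap:
  assumes M: "regular_prob X M" and N: "regular_prob X N"
    and f: "continuous_map X euclideanreal f" and f01: "\<And>x. x \<in> topspace X \<Longrightarrow> f x \<in> {0..1}"
    and A: "A \<in> sets M" "0 < measure M A" "A \<subseteq> E" and B: "B \<in> sets N" "0 < measure N B" "B \<subseteq> E"
    and d: "0 \<le> d" and E: "E \<subseteq> topspace X" and h: "average f h w"
  shows "mean_on N B h - mean_on M A h \<le> d + w {g \<in> carrier G. \<exists>x\<in>E. \<exists>y\<in>E. d < f (\<phi> g y) - f (\<phi> g x)}"
proof -
  interpret M: regular_prob X M by (rule M)
  interpret N: regular_prob X N by (rule N)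
  have int: "integrable M h" "integrable N h" if "average f h w" for h w
    using average_range[OF f01 that] average_continuous[OF f that]
    by (auto intro!: M.integrable_const_bound[where B = 1] N.integrable_const_bound[where B = 1]
        M.continuous_measurable N.continuous_measurable)
  show ?thesis
    using h
  proof induction
    case (translate g)
    have avg: "average f (\<lambda>x. f (\<phi> g x)) (indicator {S. g \<in> S})"
      using translate by (rule translate_average.translate)
    have rng: "f (\<phi> g x) \<in> {0..1}" if "x \<in> E" for x using f01 translate that E by auto
    show ?case
    proof (cases "\<exists>x\<in>E. \<exists>y\<in>E. d < f (\<phi> g y) - f (\<phi> g x)")
      case True
      have "mean_on N B (\<lambda>x. f (\<phi> g x)) \<le> 1"
        by (rule N.mean_on_le[OF B(1,2) int(2)[OF avg]]) (use rng B(3) in auto)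
      moreover have "0 \<le> mean_on M A (\<lambda>x. f (\<phi> g x))"
        by (rule M.mean_on_ge[OF A(1,2) int(1)[OF avg]]) (use rng A(3) in auto)
      ultimately show ?thesis using True translate d by (simp add: indicator_def)
    next
      case False
      have "f (\<phi> g y) \<le> d + mean_on M A (\<lambda>x. f (\<phi> g x))" if y: "y \<in> B" for y
      proof -
        have "f (\<phi> g y) - d \<le> mean_on M A (\<lambda>x. f (\<phi> g x))"
          by (rule M.mean_on_ge[OF A(1,2) int(1)[OF avg]]) (use False y A(3) B(3) in force)
        then show ?thesis by simp
      qed
      then have "mean_on N B (\<lambda>x. f (\<phi> g x)) \<le> d + mean_on M A (\<lambda>x. f (\<phi> g x))"
        by (rule N.mean_on_le[OF B(1,2) int(2)[OF avg]])
      then show ?thesis using False by (simp add: indicator_def)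
    qed
  next
    case (midpoint h w h' w')
    show ?case
      unfolding M.mean_on_midpoint[OF A(1) int(1)[OF midpoint.hyps(1)] int(1)[OF midpoint.hyps(2)]]
        N.mean_on_midpoint[OF B(1) int(2)[OF midpoint.hyps(1)] int(2)[OF midpoint.hyps(2)]]
      using midpoint.IH by argo
  qed
qed

text \<open>If the integrals differed, the invariant limit \<open>\<psi>\<close> of averages would be less than \<open>a\<close> on a set of
  positive \<open>M\<close>-measure and greater than \<open>b\<close> on a set of positive \<open>N\<close>-measure. Comparing means over these two
  sets within an open set \<open>V\<close> shows that translates with a gap on \<open>V\<close> have mass at least \<open>d\<close>, for every \<open>V\<close>
  meeting \<open>Y\<close>, which \<open>no_heavy_splitting\<close> forbids once the levels of the gap are fixed.\<close>

lemma invariant_integral_le: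
  assumes tame: "tame G X \<phi>" and Y: "minimal_subflow G X \<phi> Y"
    and M: "M \<in> Prob G X \<phi>" and N: "N \<in> Prob G X \<phi>" and MY: "measure M Y = 1" and NY: "measure N Y = 1"
    and f: "continuous_map X euclideanreal f" and f01: "\<And>x. x \<in> topspace X \<Longrightarrow> f x \<in> {0..1}"
  shows "(\<integral>x. f x \<partial>N) \<le> (\<integral>x. f x \<partial>M)"
proof (rule ccontr)
  interpret M: regular_prob X M using M by (rule Prob_regular_prob)
  interpret N: regular_prob X N using N by (rule Prob_regular_prob)
  assume less: "\<not> (\<integral>x. f x \<partial>N) \<le> (\<integral>x. f x \<partial>M)"
  have YX: "Y \<subseteq> topspace X" "closedin X Y" "Y \<noteq> {}"
    using Y subflow_subset by (auto simp: minimal_subflow_def subflow_def)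
  obtain h w \<psi> where h: "\<And>n::nat. average f (h n) (w n)"
    and psi_int: "\<And>P. P \<in> {M, N} \<Longrightarrow> integrable P \<psi>"
    and psi_lim: "\<And>P. P \<in> {M, N} \<Longrightarrow> (\<lambda>n. \<integral>x. \<bar>h n x - \<psi> x\<bar> \<partial>P) \<longlonglongrightarrow> 0"
    and psi_inv: "\<And>P g. P \<in> {M, N} \<Longrightarrow> g \<in> carrier G \<Longrightarrow> AE x in P. \<psi> (\<phi> g x) = \<psi> x"
    by (rule mean_ergodic_averages[OF M N f f01]) auto
  have hint: "integrable P (h n)" if P: "P \<in> {M, N}" for P n
  proof -
    interpret P: regular_prob X P using P M.regular_prob_axioms N.regular_prob_axioms by auto
    show ?thesis
      using average_range[OF f01 h] average_continuous[OF f h]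
      by (intro P.integrable_const_bound[where B = 1] P.continuous_measurable) auto
  qed
  have psi_f: "(\<integral>x. \<psi> x \<partial>P) = (\<integral>x. f x \<partial>P)" if P: "P \<in> {M, N}" for P
  proof -
    have PP: "P \<in> Prob G X \<phi>" using P M N by auto
    have "\<bar>(\<integral>x. f x \<partial>P) - (\<integral>x. \<psi> x \<partial>P)\<bar> \<le> (\<integral>x. \<bar>h n x - \<psi> x\<bar> \<partial>P)" for n
    proof -
      have "(\<integral>x. f x \<partial>P) - (\<integral>x. \<psi> x \<partial>P) = (\<integral>x. h n x - \<psi> x \<partial>P)"
        using integral_average[OF PP f f01 h] hint[OF P] psi_int[OF P] by simp
      then show ?thesis using integral_norm_bound[of P "\<lambda>x. h n x - \<psi> x"] by simp
    qed
    then have "\<bar>(\<integral>x. f x \<partial>P) - (\<integral>x. \<psi> x \<partial>P)\<bar> \<le> 0"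
      by (intro LIMSEQ_le_const[OF psi_lim[OF P]]) auto
    then show ?thesis by simp
  qed
  obtain a where a: "(\<integral>x. \<psi> x \<partial>M) < a" "a < (\<integral>x. \<psi> x \<partial>N)"
    using less psi_f[of M] psi_f[of N] dense[of "\<integral>x. \<psi> x \<partial>M" "\<integral>x. \<psi> x \<partial>N"] by auto
  obtain b where b: "a < b" "b < (\<integral>x. \<psi> x \<partial>N)" using dense[OF a(2)] by blast
  define A where "A = {x \<in> topspace X. \<psi> x < a}"
  define B where "B = {x \<in> topspace X. b < \<psi> x}"
  have [measurable]: "\<psi> \<in> borel_measurable M" "\<psi> \<in> borel_measurable N" using psi_int by auto
  have "{x \<in> space M. \<psi> x < a} \<in> sets M" "{x \<in> space N. b < \<psi> x} \<in> sets N" by measurable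
  then have AM: "A \<in> sets M" and BN: "B \<in> sets N" by (simp_all add: A_def B_def)
  have Apos: "0 < measure M A"
  proof (rule ccontr)
    assume "\<not> 0 < measure M A"
    then have "AE x in M. x \<notin> A" using M.prob_eq_0[OF AM] by (simp add: zero_less_measure_iff)
    then have "AE x in M. a \<le> \<psi> x" using AE_space by eventually_elim (auto simp: A_def)
    then have "a \<le> (\<integral>x. \<psi> x \<partial>M)" by (intro M.integral_ge_const psi_int) auto
    then show False using a by simp
  qed
  have Bpos: "0 < measure N B"
  proof (rule ccontr)
    assume "\<not> 0 < measure N B"
    then have "AE x in N. x \<notin> B" using N.prob_eq_0[OF BN] by (simp add: zero_less_measure_iff)
    then have "AE x in N. \<psi> x \<le> b" using AE_space by eventually_elim (auto simp: B_def)
    then have "(\<integral>x. \<psi> x \<partial>N) \<le> b" by (intro N.integral_le_const psi_int) auto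
    then show False using b by simp
  qed
  have Ainv: "AE x in M. \<phi> g x \<in> A \<longleftrightarrow> x \<in> A" if "g \<in> carrier G" for g
    using psi_inv[OF _ that, of M, simplified] AE_space by eventually_elim (use that in \<open>auto simp: A_def\<close>)
  have Binv: "AE x in N. \<phi> g x \<in> B \<longleftrightarrow> x \<in> B" if "g \<in> carrier G" for g
    using psi_inv[OF _ that, of N, simplified] AE_space by eventually_elim (use that in \<open>auto simp: B_def\<close>)
  define d where "d = (b - a) / 4"
  have d: "0 < d" using b by (simp add: d_def)
  define gap where "gap V = {g \<in> carrier G. \<exists>x\<in>V \<inter> Y. \<exists>y\<in>V \<inter> Y. d < f (\<phi> g y) - f (\<phi> g x)}" for V
  have ev_gap: "eventually (\<lambda>n. d \<le> w n (gap V)) sequentially" if V: "openin X V" "V \<inter> Y \<noteq> {}" for V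
  proof -
    let ?A = "A \<inter> (V \<inter> Y)" and ?B = "B \<inter> (V \<inter> Y)"
    have A: "?A \<in> sets M" "0 < measure M ?A"
      using AM M.open_sets[OF V(1)] M.closed_sets[OF YX(2)]
        invariant_set_charges_open[OF Y M MY AM Apos Ainv V] by auto
    have B: "?B \<in> sets N" "0 < measure N ?B"
      using BN N.open_sets[OF V(1)] N.closed_sets[OF YX(2)]
        invariant_set_charges_open[OF Y N NY BN Bpos Binv V] by auto
    have "(\<lambda>n. mean_on N ?B (h n) - mean_on M ?A (h n)) \<longlonglongrightarrow> mean_on N ?B \<psi> - mean_on M ?A \<psi>"
      using A B hint psi_int psi_lim by (intro tendsto_diff M.mean_on_tendsto N.mean_on_tendsto) auto
    moreover have "b \<le> mean_on N ?B \<psi>"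
      by (rule N.mean_on_ge[OF B psi_int]) (auto simp: B_def)
    moreover have "mean_on M ?A \<psi> \<le> a"
      by (rule M.mean_on_le[OF A psi_int]) (auto simp: A_def)
    ultimately have "eventually (\<lambda>n. 2 * d < mean_on N ?B (h n) - mean_on M ?A (h n)) sequentially"
      using b by (intro order_tendstoD(1)) (auto simp: d_def)
    then show ?thesis
    proof eventually_elim
      case (elim n)
      have "mean_on N ?B (h n) - mean_on M ?A (h n) \<le> d + w n (gap V)"
        unfolding gap_def using d YX(1)
        by (intro average_gap[OF M.regular_prob_axioms N.regular_prob_axioms f f01 A _ B _ _ _ h]) auto
      then show ?case using elim by simp
    qed
  qed
  obtain U where U: "U \<le> sequentially" "ultrafilter U"
    using ultrafilter_below[OF sequentially_bot] .
  have Ubot: "U \<noteq> bot" using U(2) by (simp add: ultrafilter_def)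
  have "\<exists>l. ((\<lambda>n. w n S) \<longlongrightarrow> l) U" for S
    by (rule ultrafilter_tendsto_bounded[OF U(2), of "\<lambda>n. w n S" 0 1])
       (use translate_average_weight(1,2)[OF h] in auto)
  then obtain W where W: "\<And>S. ((\<lambda>n. w n S) \<longlongrightarrow> W S) U" by metis
  have Wadd: "finitely_additive W"
  proof
    fix S T
    show "0 \<le> W S"
      by (rule tendsto_lowerbound[OF W _ Ubot]) (use translate_average_weight(1)[OF h] in auto)
    have "((\<lambda>n. w n S) \<longlongrightarrow> W (S \<inter> T) + W (S - T)) U"
      using tendsto_add[OF W[of "S \<inter> T"] W[of "S - T"]] translate_average_weight(3)[OF h, of _ S T] by simp
    then show "W S = W (S \<inter> T) + W (S - T)" by (rule tendsto_unique[OF Ubot W])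
  qed
  interpret W: finitely_additive W by (rule Wadd)
  have W0: "W S = 0" if "S \<inter> carrier G = {}" for S
  proof (rule tendsto_unique[OF Ubot W])
    show "((\<lambda>n. w n S) \<longlongrightarrow> 0) U" using translate_average_weight(4)[OF h that] by simp
  qed
  have Wgap: "d \<le> W (gap V)" if "openin X V" "V \<inter> Y \<noteq> {}" for V
    by (rule tendsto_lowerbound[OF W _ Ubot]) (rule filter_leD[OF U(1) ev_gap[OF that]])
  obtain K :: nat where K: "3 / d + 1 < real K" using reals_Archimedean2 by blast
  have Kpos: "0 < real K"
  proof -
    have "0 < 3 / d" using d by simp
    then show ?thesis using K by linarith
  qed
  define sp where "sp j V = split_set f (real j * (d / 3)) (real (Suc j) * (d / 3)) (V \<inter> Y)" for j V
  have gap_sp: "gap V \<subseteq> (\<Union>j\<in>{..<K}. sp j V)" for V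
  proof
    fix g assume "g \<in> gap V"
    then obtain x y where g: "g \<in> carrier G" and xy: "x \<in> V \<inter> Y" "y \<in> V \<inter> Y" "d < f (\<phi> g y) - f (\<phi> g x)"
      by (auto simp: gap_def)
    have "f (\<phi> g x) \<in> {0..1}" using xy(1) YX(1) g by (intro f01 act_in) auto
    then obtain j where "j < K" "f (\<phi> g x) < real j * (d / 3)" "real (Suc j) * (d / 3) < f (\<phi> g y)"
      using gap_level[OF d _ _ xy(3) K] by auto
    then show "g \<in> (\<Union>j\<in>{..<K}. sp j V)" using g xy unfolding sp_def split_set_def by blast
  qed
  \<comment> \<open>The levels at which \<open>V\<close> is split with mass at least \<open>d / real K\<close>. By pigeonhole there is one, and
    for a \<open>V\<close> with the fewest such levels all smaller open sets have the same ones.\<close>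
  define T where "T V = {j. j < K \<and> d / real K \<le> W (sp j V)}" for V
  have T_ne: "T V \<noteq> {}" if V: "openin X V" "V \<inter> Y \<noteq> {}" for V
  proof
    assume "T V = {}"
    then have lt: "W (sp j V) < d / real K" if "j < K" for j using that by (force simp: T_def)
    have "d \<le> W (\<Union>j\<in>{..<K}. sp j V)" using Wgap[OF V] W.mono[OF gap_sp[of V]] by simp
    also have "\<dots> \<le> (\<Sum>j<K. W (sp j V))" by (rule W.UN_le) simp
    also have "\<dots> < (\<Sum>j<K. d / real K)"
      using lt Kpos by (intro sum_strict_mono) auto
    also have "\<dots> = d" using Kpos by simp
    finally show False by simp
  qed
  have T_mono: "T V \<subseteq> T V'" if "V \<subseteq> V'" for V V'
  proof -
    have "W (sp j V) \<le> W (sp j V')" for j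
      unfolding sp_def using that by (intro W.mono split_set_mono) auto
    then show ?thesis unfolding T_def using order_trans by blast
  qed
  have T_fin: "finite (T V)" for V by (simp add: T_def)
  have "openin X (topspace X) \<and> topspace X \<inter> Y \<noteq> {}" using YX by auto
  from ex_has_least_nat[of "\<lambda>V. openin X V \<and> V \<inter> Y \<noteq> {}", OF this, of "\<lambda>V. card (T V)"]
  obtain V where V: "openin X V" "V \<inter> Y \<noteq> {}"
    and min: "\<And>V'. openin X V' \<Longrightarrow> V' \<inter> Y \<noteq> {} \<Longrightarrow> card (T V) \<le> card (T V')" by blast
  obtain j where j: "j \<in> T V" using T_ne[OF V] by blast
  show False
  proof (rule no_heavy_splitting[OF tame f _ Wadd W0 V, of "real j * (d / 3)" "real (Suc j) * (d / 3)" "d / real K"])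
    show "real j * (d / 3) < real (Suc j) * (d / 3)" using d by simp
    show "0 < d / real K" using d Kpos by simp
    fix V' assume V': "openin X V'" "V' \<subseteq> V" "V' \<inter> Y \<noteq> {}"
    have "T V' = T V" by (rule card_seteq[OF T_fin T_mono[OF V'(2)] min[OF V'(1,3)]])
    then show "d / real K \<le> W (split_set f (real j * (d / 3)) (real (Suc j) * (d / 3)) (V' \<inter> Y))"
      using j by (auto simp: T_def sp_def)
  qed
qed

text \<open>Exchanging the two measures in \<open>invariant_integral_le\<close> gives equality of all integrals.\<close>

theorem unique_invariant_measure_on_minimal:
  assumes tame: "tame G X \<phi>" and Y: "minimal_subflow G X \<phi> Y"
    and M: "M \<in> Prob G X \<phi>" "measure M Y = 1" and N: "N \<in> Prob G X \<phi>" "measure N Y = 1"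
  shows "M = N"
  by (rule regular_prob_eqI[OF Prob_regular_prob[OF M(1)] Prob_regular_prob[OF N(1)]])
     (intro antisym invariant_integral_le[OF tame Y] M N; simp)

end

section \<open>Measures on a subflow and measures on the ambient flow\<close>

lemma sets_borel_of_subtopology:
  assumes Y: "closedin X Y"
  shows "sets (borel_of (subtopology X Y)) = (\<inter>) Y ` sets (borel_of X)"
proof -
  have YX: "Y \<subseteq> topspace X" using Y by (rule closedin_subset)
  have "{U. openin (subtopology X Y) U} = (\<inter>) Y ` {U. openin X U}"
    by (auto simp: openin_subtopology Int_commute)
  then have "sets (borel_of (subtopology X Y)) = sigma_sets Y ((\<inter>) Y ` {U. openin X U})"
    using YX by (simp add: sets_borel_of Int_absorb1)
  also have "\<dots> = (\<inter>) Y ` sigma_sets (topspace X) {U. openin X U}"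
    using closedin_in_sets_borel_of[OF Y] YX
    by (intro sigma_sets_Int[symmetric]) (auto simp: sets_borel_of)
  finally show ?thesis by (simp add: sets_borel_of)
qed

lemma sets_borel_of_subtopology_subset:
  assumes Y: "closedin X Y"
  shows "A \<in> sets (borel_of (subtopology X Y)) \<longleftrightarrow> A \<in> sets (borel_of X) \<and> A \<subseteq> Y"
  unfolding sets_borel_of_subtopology[OF Y]
  using closedin_in_sets_borel_of[OF Y] by (auto simp: image_iff intro!: bexI[of _ A])

context flow
begin

lemma extend_measurable:
  assumes Y: "subflow G X \<phi> Y" and N: "N \<in> Prob G (subtopology X Y) (restrict_action \<phi> Y)"
  shows "(\<lambda>x. x) \<in> measurable N (borel_of X)"
proof -
  interpret Y: flow G "subtopology X Y" "restrict_action \<phi> Y" by (rule flow_restrict_action[OF Y])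
  interpret N: regular_prob "subtopology X Y" N by (rule Y.Prob_regular_prob[OF N])
  have "(\<lambda>x. x) \<in> measurable (borel_of (subtopology X Y)) (borel_of X)"
    by (intro continuous_map_measurable_borel_of continuous_map_from_subtopology) simp
  then show ?thesis using measurable_cong_sets[OF N.sets_M refl] by blast
qed

lemma measure_extend:
  assumes Y: "subflow G X \<phi> Y" and N: "N \<in> Prob G (subtopology X Y) (restrict_action \<phi> Y)"
    and A: "A \<in> sets (borel_of X)"
  shows "measure (distr N (borel_of X) (\<lambda>x. x)) A = measure N (Y \<inter> A)"
proof -
  interpret Y: flow G "subtopology X Y" "restrict_action \<phi> Y" by (rule flow_restrict_action[OF Y])
  interpret N: regular_prob "subtopology X Y" N by (rule Y.Prob_regular_prob[OF N])
  show ?thesis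
    using measure_distr[OF extend_measurable[OF Y N] A] sets.sets_into_space[OF A] subflow_subset[OF Y]
    by (auto simp: Int_commute Int_assoc Int_absorb2)
qed

lemma extend_in_Prob:
  assumes Y: "subflow G X \<phi> Y" and N: "N \<in> Prob G (subtopology X Y) (restrict_action \<phi> Y)"
  shows "distr N (borel_of X) (\<lambda>x. x) \<in> Prob G X \<phi>" "measure (distr N (borel_of X) (\<lambda>x. x)) Y = 1"
proof -
  interpret Y: flow G "subtopology X Y" "restrict_action \<phi> Y" by (rule flow_restrict_action[OF Y])
  interpret N: regular_prob "subtopology X Y" N by (rule Y.Prob_regular_prob[OF N])
  let ?M = "distr N (borel_of X) (\<lambda>x. x)"
  have Ycl: "closedin X Y" using Y by (simp add: subflow_def)
  have YX: "Y \<subseteq> topspace X" using Y by (rule subflow_subset)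
  have sN: "space N = Y" using YX by (simp add: Int_absorb1)
  interpret M: prob_space ?M by (rule N.prob_space_distr[OF extend_measurable[OF Y N]])
  note mM = measure_extend[OF Y N]
  show "measure ?M Y = 1"
    using mM[OF closedin_in_sets_borel_of[OF Ycl]] N.prob_space sN by simp
  have "regular_borel_measure X ?M"
  proof (rule regular_borel_measureI[OF M.finite_measure_axioms compact Hausdorff])
    fix A and e :: real assume A: "A \<in> sets ?M" and e: "0 < e"
    have AX: "A \<in> sets (borel_of X)" using A by simp
    have "Y \<inter> A \<in> sets N"
      using AX closedin_in_sets_borel_of[OF Ycl] by (auto simp: N.sets_M sets_borel_of_subtopology_subset[OF Ycl])
    then obtain K where K: "closedin (subtopology X Y) K" "K \<subseteq> Y \<inter> A" "measure N (Y \<inter> A) - e < measure N K"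
      using N.inner_regular e by blast
    have "closedin X K" using K(1) Ycl by (rule closedin_trans_full)
    moreover have "measure ?M K = measure N K"
      using mM[OF closedin_in_sets_borel_of[OF \<open>closedin X K\<close>]] K(2) by (simp add: Int_absorb1)
    ultimately show "\<exists>K. closedin X K \<and> K \<subseteq> A \<and> measure ?M A - e < measure ?M K"
      using K mM[OF AX] by (intro exI[of _ K]) auto
  qed simp
  moreover have "distr ?M ?M (\<phi> g) = ?M" if g: "g \<in> carrier G" for g
  proof (rule measure_eqI)
    fix A assume "A \<in> sets (distr ?M ?M (\<phi> g))"
    then have A: "A \<in> sets (borel_of X)" by simp
    have meas: "\<phi> g \<in> measurable (borel_of X) (borel_of X)"
      by (rule continuous_map_measurable_borel_of[OF continuous_act[OF g]])
    then have meas': "\<phi> g \<in> measurable ?M ?M" by simp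
    have pre: "\<phi> g -` A \<inter> topspace X \<in> sets (borel_of X)"
      using measurable_sets[OF meas A] by simp
    have YA: "Y \<inter> A \<in> sets N"
      using A closedin_in_sets_borel_of[OF Ycl] by (auto simp: N.sets_M sets_borel_of_subtopology_subset[OF Ycl])
    have "measure (distr ?M ?M (\<phi> g)) A = measure ?M (\<phi> g -` A \<inter> topspace X)"
      using measure_distr[OF meas', of A] A by simp
    moreover have "measure ?M (\<phi> g -` A \<inter> topspace X) = measure N (Y \<inter> (\<phi> g -` A \<inter> topspace X))"
      by (rule mM[OF pre])
    moreover have "Y \<inter> (\<phi> g -` A \<inter> topspace X) = {x \<in> topspace (subtopology X Y). restrict_action \<phi> Y g x \<in> Y \<inter> A}"
      using subflow_act[OF Y g] YX by (auto simp: restrict_action_def)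
    moreover have "measure N {x \<in> topspace (subtopology X Y). restrict_action \<phi> Y g x \<in> Y \<inter> A} = measure N (Y \<inter> A)"
      by (rule Y.measure_preimage_act[OF N g YA])
    ultimately have "measure (distr ?M ?M (\<phi> g)) A = measure ?M A"
      using mM[OF A] by (simp only:)
    then show "emeasure (distr ?M ?M (\<phi> g)) A = emeasure ?M A"
      using M.prob_space_distr[OF meas'] by (simp add: M.emeasure_eq_measure finite_measure.emeasure_eq_measure prob_space.finite_measure)
  qed simp
  ultimately show "?M \<in> Prob G X \<phi>" using M.prob_space_axioms by (simp add: Prob_def)
qed

lemma extend_inject:
  assumes Y: "subflow G X \<phi> Y" and N: "N \<in> Prob G (subtopology X Y) (restrict_action \<phi> Y)"
    and N': "N' \<in> Prob G (subtopology X Y) (restrict_action \<phi> Y)"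
    and eq: "distr N (borel_of X) (\<lambda>x. x) = distr N' (borel_of X) (\<lambda>x. x)"
  shows "N = N'"
proof -
  interpret Y: flow G "subtopology X Y" "restrict_action \<phi> Y" by (rule flow_restrict_action[OF Y])
  interpret N: regular_prob "subtopology X Y" N by (rule Y.Prob_regular_prob[OF N])
  interpret N': regular_prob "subtopology X Y" N' by (rule Y.Prob_regular_prob[OF N'])
  have Ycl: "closedin X Y" using Y by (simp add: subflow_def)
  show ?thesis
  proof (rule measure_eqI)
    show "sets N = sets N'" by (simp add: N.sets_M N'.sets_M)
    fix A assume "A \<in> sets N"
    then have A: "A \<in> sets (borel_of X)" "A \<subseteq> Y"
      by (simp_all add: N.sets_M sets_borel_of_subtopology_subset[OF Ycl])
    have "measure N A = measure N' A"
      using measure_extend[OF Y N A(1)] measure_extend[OF Y N' A(1)] eq A(2) by (simp add: Int_absorb1)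
    then show "emeasure N A = emeasure N' A" by (simp add: N.emeasure_eq_measure N'.emeasure_eq_measure)
  qed
qed

lemma restrict_in_Prob:
  assumes Y: "subflow G X \<phi> Y" and M: "M \<in> Prob G X \<phi>" and MY: "measure M Y = 1"
  shows "restrict_space M Y \<in> Prob G (subtopology X Y) (restrict_action \<phi> Y)"
proof -
  interpret Y: flow G "subtopology X Y" "restrict_action \<phi> Y" by (rule flow_restrict_action[OF Y])
  interpret M: regular_prob X M by (rule Prob_regular_prob[OF M])
  let ?N = "restrict_space M Y"
  have Ycl: "closedin X Y" using Y by (simp add: subflow_def)
  have YX: "Y \<subseteq> topspace X" using Y by (rule subflow_subset)
  have YM: "Y \<inter> space M \<in> sets M" using M.closed_sets[OF Ycl] YX by (simp add: Int_absorb2)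
  have sets: "sets ?N = sets (borel_of (subtopology X Y))"
    by (simp add: sets_restrict_space M.sets_M sets_borel_of_subtopology[OF Ycl])
  have setsD: "A \<in> sets M \<and> A \<subseteq> Y" if "A \<in> sets ?N" for A
    using that by (simp add: sets sets_borel_of_subtopology_subset[OF Ycl] M.sets_M)
  have mN: "measure ?N A = measure M A" if "A \<subseteq> Y" for A
    by (rule measure_restrict_space[OF YM that])
  have eN: "emeasure ?N A = emeasure M A" if "A \<subseteq> Y" for A
    by (rule emeasure_restrict_space[OF YM that])
  have sN: "space ?N = Y" using YX by (simp add: space_restrict_space Int_absorb2)
  have "prob_space ?N"
    by (rule prob_spaceI) (simp add: sN eN M.emeasure_eq_measure MY)
  interpret N: prob_space ?N by fact
  have "regular_borel_measure (subtopology X Y) ?N"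
  proof (rule regular_borel_measureI[OF N.finite_measure_axioms Y.compact Y.Hausdorff sets])
    fix A and e :: real assume "A \<in> sets ?N" and e: "0 < e"
    then have A: "A \<in> sets M" "A \<subseteq> Y" using setsD by auto
    obtain K where K: "closedin X K" "K \<subseteq> A" "measure M A - e < measure M K"
      by (rule M.inner_regular[OF A(1) e])
    have KY: "K \<subseteq> Y" using K(2) A(2) by blast
    have "closedin (subtopology X Y) K"
      using K(1) KY by (auto simp: closedin_subtopology)
    then show "\<exists>K. closedin (subtopology X Y) K \<and> K \<subseteq> A \<and> measure ?N A - e < measure ?N K"
      using K mN[OF KY] mN[OF A(2)] by auto
  qed
  moreover have "distr ?N ?N (restrict_action \<phi> Y g) = ?N" if g: "g \<in> carrier G" for g
  proof (rule measure_eqI)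
    fix A assume "A \<in> sets (distr ?N ?N (restrict_action \<phi> Y g))"
    then have AN: "A \<in> sets ?N" by simp
    then have A: "A \<in> sets M" "A \<subseteq> Y" using setsD by auto
    have meas: "restrict_action \<phi> Y g \<in> measurable ?N ?N"
      using continuous_map_measurable_borel_of[OF Y.continuous_act[OF g]] measurable_cong_sets[OF sets sets] by blast
    have pre: "restrict_action \<phi> Y g -` A \<inter> space ?N = Y \<inter> {x \<in> topspace X. \<phi> g x \<in> A}"
      using YX by (auto simp: sN restrict_action_def)
    have preM: "{x \<in> topspace X. \<phi> g x \<in> A} \<in> sets M"
      using measurable_sets[OF act_measurable[OF M g] A(1)] by (simp add: vimage_def Int_def conj_commute)
    have "AE x in M. x \<in> Y" using MY by (rule M.AE_prob_1)
    then have "measure M (Y \<inter> {x \<in> topspace X. \<phi> g x \<in> A}) = measure M {x \<in> topspace X. \<phi> g x \<in> A}"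
      using preM M.closed_sets[OF Ycl] by (intro M.finite_measure_eq_AE) auto
    then have "measure M (Y \<inter> {x \<in> topspace X. \<phi> g x \<in> A}) = measure M A"
      using measure_preimage_act[OF M g A(1)] by simp
    then have "measure (distr ?N ?N (restrict_action \<phi> Y g)) A = measure ?N A"
      using measure_distr[OF meas AN] pre mN[OF A(2)] mN[of "Y \<inter> {x \<in> topspace X. \<phi> g x \<in> A}"] by simp
    then show "emeasure (distr ?N ?N (restrict_action \<phi> Y g)) A = emeasure ?N A"
      using N.prob_space_distr[OF meas] by (simp add: N.emeasure_eq_measure finite_measure.emeasure_eq_measure prob_space.finite_measure)
  qed simp
  ultimately show ?thesis using \<open>prob_space ?N\<close> by (simp add: Prob_def)
qed

lemma supp_minimal_subflow:
  assumes Y: "minimal_subflow G X \<phi> Y" and M: "M \<in> Prob G X \<phi>" and MY: "measure M Y = 1"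
  shows "supp X M = Y"
proof -
  interpret M: regular_prob X M by (rule Prob_regular_prob[OF M])
  have Ycl: "closedin X Y" using Y by (simp add: minimal_subflow_def subflow_def)
  have "measure M (topspace X - Y) = 0"
    using M.prob_compl[OF M.closed_sets[OF Ycl]] MY by simp
  moreover have "openin X (topspace X - Y)" using Ycl by blast
  ultimately have "supp X M \<subseteq> Y" by (auto simp: M.supp_eq)
  then show ?thesis using Y subflow_supp[OF M] by (auto simp: minimal_subflow_iff)
qed

text \<open>Both parts of a convex decomposition of \<open>M\<close> are concentrated on \<open>Y\<close>, hence equal to each
  other by uniqueness.\<close>

lemma ergodic_of_minimal_subflow:
  assumes tame: "tame G X \<phi>" and Y: "minimal_subflow G X \<phi> Y" and M: "M \<in> Prob G X \<phi>" and MY: "measure M Y = 1"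
  shows "M \<in> Erg G X \<phi>"
proof (rule ccontr)
  assume "M \<notin> Erg G X \<phi>"
  then obtain N1 N2 and t :: real where N: "N1 \<in> Prob G X \<phi>" "N2 \<in> Prob G X \<phi>" "0 < t" "t < 1" "N1 \<noteq> N2"
    and comb: "\<And>A. A \<in> sets (borel_of X) \<Longrightarrow> measure M A = (1 - t) * measure N1 A + t * measure N2 A"
    using M unfolding Erg_def by blast
  interpret N1: regular_prob X N1 by (rule Prob_regular_prob[OF N(1)])
  interpret N2: regular_prob X N2 by (rule Prob_regular_prob[OF N(2)])
  have Ycl: "closedin X Y" using Y by (simp add: minimal_subflow_def subflow_def)
  have one: "1 = (1 - t) * measure N1 Y + t * measure N2 Y"
    using comb[OF closedin_in_sets_borel_of[OF Ycl]] MY by simp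
  have "(1 - t) * measure N1 Y \<le> (1 - t) * 1" "t * measure N2 Y \<le> t * 1"
    using N(3,4) by (intro mult_left_mono; simp)+
  moreover from this(2) have "(1 - t) * 1 \<le> (1 - t) * measure N1 Y" using one by (simp add: algebra_simps)
  ultimately have "(1 - t) * measure N1 Y = (1 - t) * 1" by (intro antisym)
  then have "measure N1 Y = 1" using N(4) by simp
  then have "measure N2 Y = 1" using one N(3) by simp
  with \<open>measure N1 Y = 1\<close> have "N1 = N2" by (intro unique_invariant_measure_on_minimal[OF tame Y] N)
  then show False using N(5) by simp
qed

end

section \<open>The support map\<close>

theorem corollary4p6:
  fixes G :: "('g, 'm) monoid_scheme" and X :: "'a topology" and \<phi> :: "'g \<Rightarrow> 'a \<Rightarrow> 'a"
  assumes "flow G X \<phi>" and "tame G X \<phi>"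
  shows "bij_betw (supp X) (Erg G X \<phi>) (Min_am G X \<phi>)
    \<and> (\<forall>Y\<in>Min_am G X \<phi>.
         (\<exists>!\<nu>. \<nu> \<in> Prob G (subtopology X Y) (restrict_action \<phi> Y)) \<and>
         the_inv_into (Erg G X \<phi>) (supp X) Y =
           distr (THE \<nu>. \<nu> \<in> Prob G (subtopology X Y) (restrict_action \<phi> Y)) (borel_of X) (\<lambda>x. x))
    \<and> (\<forall>\<mu>\<in>Erg G X \<phi>. \<forall>\<nu>\<in>Erg G X \<phi>. \<mu> \<noteq> \<nu> \<longrightarrow> disjnt (supp X \<mu>) (supp X \<nu>))
    \<and> (hereditarily_amenable G X \<phi> \<longrightarrow> Min_am G X \<phi> = {Y. minimal_subflow G X \<phi> Y})"
proof -
  interpret flow G X \<phi> by (rule assms(1))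
  note tame = assms(2)
  have ErgP: "M \<in> Prob G X \<phi>" if "M \<in> Erg G X \<phi>" for M using that by (simp add: Erg_def)
  have full: "measure M (supp X M) = 1" if "M \<in> Prob G X \<phi>" for M
    using regular_prob.measure_supp[OF Prob_regular_prob[OF that]] .
  have min: "minimal_subflow G X \<phi> (supp X M)" if "M \<in> Erg G X \<phi>" for M
    by (rule minimal_subflow_supp_ergodic[OF tame that])
  have inj: "inj_on (supp X) (Erg G X \<phi>)"
  proof (rule inj_onI)
    fix M N assume MN: "M \<in> Erg G X \<phi>" "N \<in> Erg G X \<phi>" "supp X M = supp X N"
    show "M = N"
      using MN full[OF ErgP[OF MN(1)]] full[OF ErgP[OF MN(2)]]
      by (intro unique_invariant_measure_on_minimal[OF tame min[OF MN(1)]] ErgP) auto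
  qed
  have into: "supp X M \<in> Min_am G X \<phi>" if M: "M \<in> Erg G X \<phi>" for M
  proof -
    have Y: "subflow G X \<phi> (supp X M)" using min[OF M] by (simp add: minimal_subflow_def)
    show ?thesis
      using min[OF M] Y restrict_in_Prob[OF Y ErgP[OF M] full[OF ErgP[OF M]]]
      by (auto simp: Min_am_def amenable_subflow_def amenable_flow_def)
  qed
  \<comment> \<open>Extending the invariant measure of \<open>Y\<close> by zero is inverse to taking supports.\<close>
  have lift: "(\<exists>!\<nu>. \<nu> \<in> Prob G (subtopology X Y) (restrict_action \<phi> Y)) \<and>
      (\<forall>\<nu>\<in>Prob G (subtopology X Y) (restrict_action \<phi> Y).
        distr \<nu> (borel_of X) (\<lambda>x. x) \<in> Erg G X \<phi> \<and> supp X (distr \<nu> (borel_of X) (\<lambda>x. x)) = Y)"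
    if "Y \<in> Min_am G X \<phi>" for Y
  proof -
    have Ymin: "minimal_subflow G X \<phi> Y" and Y: "subflow G X \<phi> Y"
      and am: "Prob G (subtopology X Y) (restrict_action \<phi> Y) \<noteq> {}"
      using that by (auto simp: Min_am_def amenable_subflow_def amenable_flow_def)
    have uniq: "\<nu> = \<nu>'" if \<nu>: "\<nu> \<in> Prob G (subtopology X Y) (restrict_action \<phi> Y)"
      "\<nu>' \<in> Prob G (subtopology X Y) (restrict_action \<phi> Y)" for \<nu> \<nu>'
      by (rule extend_inject[OF Y \<nu>])
        (rule unique_invariant_measure_on_minimal[OF tame Ymin extend_in_Prob[OF Y \<nu>(1)] extend_in_Prob[OF Y \<nu>(2)]])
    have "\<exists>!\<nu>. \<nu> \<in> Prob G (subtopology X Y) (restrict_action \<phi> Y)" using am uniq by blast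
    then show ?thesis
      using ergodic_of_minimal_subflow[OF tame Ymin extend_in_Prob[OF Y]]
        supp_minimal_subflow[OF Ymin extend_in_Prob[OF Y]] by blast
  qed
  have bij: "bij_betw (supp X) (Erg G X \<phi>) (Min_am G X \<phi>)"
    unfolding bij_betw_def
  proof (intro conjI inj equalityI subsetI)
    fix Y assume "Y \<in> supp X ` Erg G X \<phi>"
    then show "Y \<in> Min_am G X \<phi>" using into by blast
  next
    fix Y assume "Y \<in> Min_am G X \<phi>"
    then obtain \<nu> where "distr \<nu> (borel_of X) (\<lambda>x. x) \<in> Erg G X \<phi>" "supp X (distr \<nu> (borel_of X) (\<lambda>x. x)) = Y"
      using lift[of Y] by blast
    then show "Y \<in> supp X ` Erg G X \<phi>" by (rule_tac image_eqI[OF sym])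
  qed
  have inverse: "the_inv_into (Erg G X \<phi>) (supp X) Y =
      distr (THE \<nu>. \<nu> \<in> Prob G (subtopology X Y) (restrict_action \<phi> Y)) (borel_of X) (\<lambda>x. x)"
    if Y: "Y \<in> Min_am G X \<phi>" for Y
  proof -
    have "(THE \<nu>. \<nu> \<in> Prob G (subtopology X Y) (restrict_action \<phi> Y)) \<in> Prob G (subtopology X Y) (restrict_action \<phi> Y)"
      by (rule theI'[OF lift[OF Y, THEN conjunct1]])
    then have "distr (THE \<nu>. \<nu> \<in> Prob G (subtopology X Y) (restrict_action \<phi> Y)) (borel_of X) (\<lambda>x. x) \<in> Erg G X \<phi> \<and>
        supp X (distr (THE \<nu>. \<nu> \<in> Prob G (subtopology X Y) (restrict_action \<phi> Y)) (borel_of X) (\<lambda>x. x)) = Y"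
      by (rule bspec[OF lift[OF Y, THEN conjunct2]])
    then show ?thesis by (elim conjE) (rule the_inv_into_f_eq[OF inj])
  qed
  have disj: "disjnt (supp X M) (supp X N)" if MN: "M \<in> Erg G X \<phi>" "N \<in> Erg G X \<phi>" "M \<noteq> N" for M N
  proof (rule ccontr)
    assume "\<not> disjnt (supp X M) (supp X N)"
    then have "supp X M \<inter> supp X N \<noteq> {}" by (simp add: disjnt_def)
    then have "subflow G X \<phi> (supp X M \<inter> supp X N)"
      using subflow_supp[OF ErgP[OF MN(1)]] subflow_supp[OF ErgP[OF MN(2)]]
      unfolding subflow_def by (blast intro: closedin_Int)
    then have "supp X M \<inter> supp X N = supp X M" "supp X M \<inter> supp X N = supp X N"
      using min[OF MN(1)] min[OF MN(2)] by (auto simp: minimal_subflow_iff)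
    then have "supp X M = supp X N" by simp
    then show False using inj MN by (auto dest: inj_onD)
  qed
  have hered: "Min_am G X \<phi> = {Y. minimal_subflow G X \<phi> Y}" if "hereditarily_amenable G X \<phi>"
    using that by (auto simp: Min_am_def hereditarily_amenable_def minimal_subflow_def)
  show ?thesis
    by (intro conjI ballI impI bij inverse disj hered lift[THEN conjunct1])
qed

end
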